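(* Let $\Gamma$ be a tropical curve, $D$ a divisor on $\Gamma$ such that $R(D)$ is nonempty and does not consist only of constant functions, and let $\mathcal F=\{f_1,\dots,f_n\}\subset R(D)$ be a finite nonempty subset without base points. Then the degree of the embedded tropical curve $\tilde\phi_{\mathcal F}(\tilde\Gamma)\subset\mathbb{TP}^{n-1}$, obtained from $(\Gamma,\phi_{\mathcal F})$ by the balancing procedure, equals $\deg(D)$.
   Context: A tropical curve $\Gamma$ is a compact connected metric graph whose leaf edges may have infinite length (with a point at infinity added). Divisors are finite formal $\mathbb Z$-combinations of points, $\deg D=\sum_x D(x)$. A rational function is continuous, piecewise linear with finitely many pieces and integer slopes, real-valued except possibly $\pm\infty$ at points at infinity; $(f)=\sum_x\mathrm{ord}_x(f)\cdot x$, $\mathrm{ord}_x(f)$ the sum of outgoing slopes at $x$. $R(D)=\{f:D+(f)\ge0\}$. $\mathcal F\subset R(D)$ has no base points if for every $x\in\Gamma$ there is $f\in\mathcal F$ with $(D+(f))(x)=0$. $\mathbb{TP}^{n-1}=\mathbb R^n/\mathbb R\mathbf 1$, $\mathbf 1=(1,\dots,1)$. A vector is primitive if it has an integral representative in $\mathbb Z^n$ and generates the semigroup of integral vectors on its ray, $(\mathbb Z^n\cap(\mathbb R_+v+\mathbb R\mathbf 1))/\mathbb Z\mathbf 1$. Embedded tropical curve: a one-dimensional polyhedral complex $C$ in $\mathbb{TP}^{n-1}$ with rational slopes and a multiplicity $m_e\in\mathbb Z_{>0}$ on each edge such that at each point $x\in C$, $\sum_e m_ev_e=0$, the sum over edges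 $e$ containing $x$, with $v_e$ the primitive vector in direction $e$ pointing away from $x$. Degree: if the unbounded rays of $C$ have primitive directions $v_1,\dots,v_k$ with multiplicities $m_1,\dots,m_k$, take for each $v_i$ the representative in $\mathbb Z^n$ with all coordinates $\le0$ and maximum coordinate $0$; then $\sum m_iv_i=-d\cdot\mathbf 1$, and $d$ is the degree. Parameterized tropical curve: a pair $(\Gamma,h)$ with $h:\Gamma\to\mathbb{TP}^{n-1}$ piecewise linear with integer slopes such that at every finite point $x\in\Gamma$, $\sum_e m_ev_e=0$, the sum over outgoing directions $e$ at $x$, where $h$ is locally $t\mapsto h(x)+t\,m_ev_e$ along $e$ ($v_e$ primitive, $m_e$ a positive integer; directions on which $h$ is constant contribute $0$). The image $h(\Gamma)$ is an embedded tropical curve, where the multiplicity of an edge is $\sum_{y\in h^{-1}(p)}m_y$ for a point $p$ on that edge whose fiber is finite and consists of points where $h$ is smooth; here $h$ is locally $t\mapsto p+t\,m_yv$ near $y$ with $v$ primitive. The map: $\phi_{\mathcal F}:\Gamma\to\mathbb{TP}^{n-1}$, $x\mapsto(f_1(x),\dots,f_n(x))$. Balancing procedure: for each finite point $x\in\Gamma$ let $u(x)=\sum_e m_ev_e\in\mathbb{TP}^{n-1}$ be the sum over outgoing directions of the slope vectors of $\phi_{\mathcal F}$ at $x$, represented in $\mathbb Z^n$ with all coordinates nonnegative and minimum coordinate $0$. The curve $\tilde\Gamma$ is obtained from $\Gamma$ by attaching, at every finite point $x$ with $u(x)\neq0$, a leaf edge of infinite length identified with $[0,\infty]$; $\tilde\phi_{\mathcal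 F}$ equals $\phi_{\mathcal F}$ on $\Gamma$ and $t\mapsto\phi_{\mathcal F}(x)-t\cdot u(x)$ on the new leaf at $x$. No leaf is attached at points at infinity. Then $(\tilde\Gamma,\tilde\phi_{\mathcal F})$ is a parameterized tropical curve. *)

theory Defs
  imports
    "HOL-Analysis.Analysis"
    "HOL-Library.Poly_Mapping"
    "Graph_Theory.Digraph_Component"
begin

section \<open>Tropical curves\<close>

text \<open>
  A metric graph is given by a model: a finite connected multigraph (loops and parallel
  edges allowed) with an edge length in \<open>(0, \<infinity>]\<close>. The orientation of an arc only fixes a
  parametrization of the edge by \<open>[0, len e]\<close>.
\<close>

record ('v, 'e) metric_graph = "('v, 'e) pre_digraph" +
  len :: "'e \<Rightarrow> ereal"

text \<open>
  An edge of infinite length is a leaf edge, oriented so that its head is the leaf; this head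
  is then the point at infinity. (A curve isometric to \<open>[-\<infinity>, \<infinity>]\<close> is modelled with a
  vertex in the middle.)
\<close>

definition tropical_curve :: "('v, 'e) metric_graph \<Rightarrow> bool" where
  "tropical_curve G \<longleftrightarrow>
     fin_digraph (pre_digraph.truncate G) \<and>
     Digraph_Component.connected (pre_digraph.truncate G) \<and>
     (\<forall>e\<in>arcs G. 0 < len G e) \<and>
     (\<forall>e\<in>arcs G. len G e = \<infinity> \<longrightarrow>
        tail G e \<noteq> head G e \<and>
        (\<forall>e'\<in>arcs G. e' \<noteq> e \<longrightarrow> tail G e' \<noteq> head G e \<and> head G e' \<noteq> head G e))"

datatype ('v, 'e) point = Vertex 'v | Inner 'e real

definition points :: "('v, 'e) metric_graph \<Rightarrow> ('v, 'e) point set" where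
  "points G = Vertex ` verts G \<union> {Inner e t | e t. e \<in> arcs G \<and> 0 < t \<and> ereal t < len G e}"

definition finite_points :: "('v, 'e) metric_graph \<Rightarrow> ('v, 'e) point set" where
  "finite_points G = points G - {Vertex (head G e) | e. e \<in> arcs G \<and> len G e = \<infinity>}"

definition pt :: "('v, 'e) metric_graph \<Rightarrow> 'e \<Rightarrow> ereal \<Rightarrow> ('v, 'e) point" where
  "pt G e t = (if t = 0 then Vertex (tail G e)
               else if t = len G e then Vertex (head G e)
               else Inner e (real_of_ereal t))"

text \<open>
  An outgoing direction \<open>(e, t, s)\<close> at \<open>pt G e t\<close> points along the edge \<open>e\<close>, towards larger
  parameters if \<open>s\<close> is true and towards smaller ones otherwise. A loop contributes two
  directions at its vertex.
\<close>

definition directions ::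
  "('v, 'e) metric_graph \<Rightarrow> ('v, 'e) point \<Rightarrow> ('e \<times> ereal \<times> bool) set" where
  "directions G x = {(e, t, s). e \<in> arcs G \<and> 0 \<le> t \<and> t \<le> len G e \<and> pt G e t = x \<and>
                                (if s then t < len G e else 0 < t)}"

fun has_slope :: "('v, 'e) metric_graph \<Rightarrow> (('v, 'e) point \<Rightarrow> 'a::real_vector) \<Rightarrow>
    'e \<times> ereal \<times> bool \<Rightarrow> 'a \<Rightarrow> bool" where
  "has_slope G g (e, t, s) w \<longleftrightarrow>
     (\<exists>c. \<forall>\<^sub>F r in (if s then at_right t else at_left t).
        g (pt G e r) = c + ((if s then 1 else - 1) * real_of_ereal r) *\<^sub>R w)"

definition slope :: "('v, 'e) metric_graph \<Rightarrow> (('v, 'e) point \<Rightarrow> 'a::real_vector) \<Rightarrow>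
    'e \<times> ereal \<times> bool \<Rightarrow> 'a" where
  "slope G g d = (THE w. has_slope G g d w)"

lemma has_slope_unique:
  assumes "has_slope G g (e, t, s) w" "has_slope G g (e, t, s) w'"
    and "if s then t < \<infinity> else 0 < t"
  shows "w = w'"
proof -
  let ?F = "if s then at_right t else at_left t"
  let ?\<sigma> = "if s then 1 else - 1 :: real"
  obtain c c' where ev: "\<forall>\<^sub>F r in ?F. g (pt G e r) = c + (?\<sigma> * real_of_ereal r) *\<^sub>R w"
    "\<forall>\<^sub>F r in ?F. g (pt G e r) = c' + (?\<sigma> * real_of_ereal r) *\<^sub>R w'"
    using assms(1,2) by auto
  from ev have ev: "\<forall>\<^sub>F r in ?F. c + (?\<sigma> * real_of_ereal r) *\<^sub>R w = c' + (?\<sigma> * real_of_ereal r) *\<^sub>R w'"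
    by eventually_elim simp
  have "\<exists>a b. a < b \<and> (\<forall>r. a < r \<and> r < b \<longrightarrow> c + (?\<sigma> * real_of_ereal r) *\<^sub>R w = c' + (?\<sigma> * real_of_ereal r) *\<^sub>R w')"
  proof (cases s)
    case True
    then have "t < \<infinity>" using assms(3) by simp
    then obtain b where "t < b"
      "\<forall>r>t. r < b \<longrightarrow> c + (?\<sigma> * real_of_ereal r) *\<^sub>R w = c' + (?\<sigma> * real_of_ereal r) *\<^sub>R w'"
      using ev True eventually_at_right[of t \<infinity>] by auto
    then show ?thesis by blast
  next
    case False
    then have "0 < t" using assms(3) by simp
    then obtain a where "a < t"
      "\<forall>r>a. r < t \<longrightarrow> c + (?\<sigma> * real_of_ereal r) *\<^sub>R w = c' + (?\<sigma> * real_of_ereal r) *\<^sub>R w'"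
      using ev False eventually_at_left[of 0 t] by auto
    then show ?thesis by blast
  qed
  then obtain a b where ab: "a < b" and
    eq: "\<And>r. a < r \<Longrightarrow> r < b \<Longrightarrow> c + (?\<sigma> * real_of_ereal r) *\<^sub>R w = c' + (?\<sigma> * real_of_ereal r) *\<^sub>R w'"
    by blast
  obtain x where x: "a < ereal x" "ereal x < b" using ereal_dense2[OF ab] by blast
  obtain y where y: "ereal x < ereal y" "ereal y < b" using ereal_dense2[OF x(2)] by blast
  have 1: "c + (?\<sigma> * x) *\<^sub>R w = c' + (?\<sigma> * x) *\<^sub>R w'"
    using eq[OF x] by simp
  have 2: "c + (?\<sigma> * y) *\<^sub>R w = c' + (?\<sigma> * y) *\<^sub>R w'"
    using eq[of "ereal y"] less_trans[OF x(1) y(1)] y(2) by simp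
  have "(?\<sigma> * y) *\<^sub>R w - (?\<sigma> * x) *\<^sub>R w = (?\<sigma> * y) *\<^sub>R w' - (?\<sigma> * x) *\<^sub>R w'"
    using arg_cong2[OF 2 1, of "(-)"] unfolding add_diff_add by simp
  then have "(?\<sigma> * (y - x)) *\<^sub>R w = (?\<sigma> * (y - x)) *\<^sub>R w'"
    by (simp only: right_diff_distrib scaleR_diff_left)
  then show "w = w'" using y(1) by (auto split: if_splits)
qed


section \<open>Rational functions and divisors\<close>

text \<open>
  Functions on the curve are represented by functions that are \<open>undefined\<close> outside
  \<open>points G\<close>. Continuity on the curve is continuity on each closed edge, where an edge of
  infinite length is parametrized by the compact interval \<open>[0, \<infinity>]\<close>.
\<close>

definition rational_function ::
  "('v, 'e) metric_graph \<Rightarrow> (('v, 'e) point \<Rightarrow> ereal) \<Rightarrow> bool" where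
  "rational_function G f \<longleftrightarrow>
     f \<in> extensional (points G) \<and>
     (\<forall>x\<in>finite_points G. \<bar>f x\<bar> \<noteq> \<infinity>) \<and>
     (\<forall>e\<in>arcs G. continuous_on {0..len G e} (\<lambda>t. f (pt G e t))) \<and>
     (\<forall>e\<in>arcs G. \<exists>S::real set. finite S \<and>
        (\<forall>a b. 0 \<le> a \<and> a < b \<and> ereal b \<le> len G e \<and> {a<..<b} \<inter> S = {} \<longrightarrow>
           (\<exists>(k::int) (c::real). \<forall>t\<in>{a<..<b}. f (Inner e t) = ereal (c + of_int k * t))))"

definition ord_at ::
  "('v, 'e) metric_graph \<Rightarrow> (('v, 'e) point \<Rightarrow> ereal) \<Rightarrow> ('v, 'e) point \<Rightarrow> real" where
  "ord_at G f x = (\<Sum>d\<in>directions G x. slope G (\<lambda>y. real_of_ereal (f y)) d)"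

definition divisor_on :: "('v, 'e) metric_graph \<Rightarrow> (('v, 'e) point \<Rightarrow>\<^sub>0 int) \<Rightarrow> bool" where
  "divisor_on G D \<longleftrightarrow> Poly_Mapping.keys D \<subseteq> points G"

definition divisor_degree :: "(('v, 'e) point \<Rightarrow>\<^sub>0 int) \<Rightarrow> int" where
  "divisor_degree D = (\<Sum>x\<in>Poly_Mapping.keys D. Poly_Mapping.lookup D x)"

definition R :: "('v, 'e) metric_graph \<Rightarrow> (('v, 'e) point \<Rightarrow>\<^sub>0 int) \<Rightarrow>
    (('v, 'e) point \<Rightarrow> ereal) set" where
  "R G D = {f. rational_function G f \<and>
               (\<forall>x\<in>points G. 0 \<le> real_of_int (Poly_Mapping.lookup D x) + ord_at G f x)}"

definition no_base_points :: "('v, 'e) metric_graph \<Rightarrow> (('v, 'e) point \<Rightarrow>\<^sub>0 int) \<Rightarrow>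
    (('v, 'e) point \<Rightarrow> ereal) set \<Rightarrow> bool" where
  "no_base_points G D F \<longleftrightarrow>
     (\<forall>x\<in>points G. \<exists>f\<in>F. real_of_int (Poly_Mapping.lookup D x) + ord_at G f x = 0)"


section \<open>Tropical projective space\<close>

definition tp_rel :: "real ^ 'n \<Rightarrow> real ^ 'n \<Rightarrow> bool" where
  "tp_rel x y \<longleftrightarrow> (\<exists>c. x = y + vec c)"

lemma equivp_tp_rel: "equivp (tp_rel :: real ^ 'n \<Rightarrow> real ^ 'n \<Rightarrow> bool)"
proof (rule equivpI)
  show "reflp (tp_rel :: real ^ 'n \<Rightarrow> real ^ 'n \<Rightarrow> bool)"
  proof (rule reflpI)
    fix x :: "real ^ 'n"
    have "x = x + vec 0" by (simp add: vec_eq_iff)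
    then show "tp_rel x x" unfolding tp_rel_def by blast
  qed
  show "symp (tp_rel :: real ^ 'n \<Rightarrow> real ^ 'n \<Rightarrow> bool)"
  proof (rule sympI)
    fix x y :: "real ^ 'n" assume "tp_rel x y"
    then obtain c where "x = y + vec c" by (auto simp: tp_rel_def)
    then have "y = x + vec (- c)" by (simp add: vec_eq_iff)
    then show "tp_rel y x" by (auto simp: tp_rel_def)
  qed
  show "transp (tp_rel :: real ^ 'n \<Rightarrow> real ^ 'n \<Rightarrow> bool)"
  proof (rule transpI)
    fix x y z :: "real ^ 'n" assume "tp_rel x y" "tp_rel y z"
    then obtain c d where "x = y + vec c" "y = z + vec d" by (auto simp: tp_rel_def)
    then have "x = z + vec (d + c)" by (simp add: vec_eq_iff)
    then show "tp_rel x z" by (auto simp: tp_rel_def)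
  qed
qed

text \<open>With \<open>n = CARD('n)\<close>, the type \<open>'n tp\<close> is the quotient of real \<open>n\<close>-space
  by the line spanned by the all-ones vector.\<close>

quotient_type 'n tp = "real ^ ('n::finite)" / tp_rel
  morphisms rep_tp tp
  by (rule equivp_tp_rel)

instantiation tp :: (finite) real_vector
begin

lift_definition zero_tp :: "'a tp" is 0 .

lift_definition plus_tp :: "'a tp \<Rightarrow> 'a tp \<Rightarrow> 'a tp" is "(+)"
proof -
  fix x x' y y' :: "real ^ 'a" assume "tp_rel x x'" "tp_rel y y'"
  then obtain c d where "x = x' + vec c" "y = y' + vec d" by (auto simp: tp_rel_def)
  then have "x + y = x' + y' + vec (c + d)" by (simp add: vec_eq_iff)
  then show "tp_rel (x + y) (x' + y')" by (auto simp: tp_rel_def)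
qed

lift_definition minus_tp :: "'a tp \<Rightarrow> 'a tp \<Rightarrow> 'a tp" is "(-)"
proof -
  fix x x' y y' :: "real ^ 'a" assume "tp_rel x x'" "tp_rel y y'"
  then obtain c d where "x = x' + vec c" "y = y' + vec d" by (auto simp: tp_rel_def)
  then have "x - y = x' - y' + vec (c - d)" by (simp add: vec_eq_iff)
  then show "tp_rel (x - y) (x' - y')" by (auto simp: tp_rel_def)
qed

lift_definition uminus_tp :: "'a tp \<Rightarrow> 'a tp" is uminus
proof -
  fix x x' :: "real ^ 'a" assume "tp_rel x x'"
  then obtain c where "x = x' + vec c" by (auto simp: tp_rel_def)
  then have "- x = - x' + vec (- c)" by (simp add: vec_eq_iff)
  then show "tp_rel (- x) (- x')" by (auto simp: tp_rel_def)
qed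

lift_definition scaleR_tp :: "real \<Rightarrow> 'a tp \<Rightarrow> 'a tp" is scaleR
proof -
  fix r and x x' :: "real ^ 'a" assume "tp_rel x x'"
  then obtain c where "x = x' + vec c" by (auto simp: tp_rel_def)
  then have "r *\<^sub>R x = r *\<^sub>R x' + vec (r * c)" by (simp add: vec_eq_iff algebra_simps)
  then show "tp_rel (r *\<^sub>R x) (r *\<^sub>R x')" by (auto simp: tp_rel_def)
qed

instance
proof
  fix a b c :: "'a tp" and r s :: real
  have refl: "tp_rel x y" if "x = y" for x y :: "real ^ 'a"
    using that by (auto intro!: exI[of _ 0] simp: tp_rel_def vec_eq_iff)
  show "a + b + c = a + (b + c)" by transfer (auto intro: refl)
  show "a + b = b + a" by transfer (auto intro: refl)
  show "0 + a = a" by transfer (auto intro: refl)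
  show "- a + a = 0" by transfer (auto intro: refl)
  show "a - b = a + - b" by transfer (auto intro: refl)
  show "r *\<^sub>R (a + b) = r *\<^sub>R a + r *\<^sub>R b" by transfer (auto intro: refl simp: algebra_simps)
  show "(r + s) *\<^sub>R a = r *\<^sub>R a + s *\<^sub>R a" by transfer (auto intro: refl simp: algebra_simps)
  show "r *\<^sub>R s *\<^sub>R a = (r * s) *\<^sub>R a" by transfer (auto intro: refl)
  show "1 *\<^sub>R a = a" by transfer (auto intro: refl)
qed

end

definition tp_of_int :: "int ^ 'n \<Rightarrow> 'n::finite tp" where
  "tp_of_int z = tp (\<chi> i. real_of_int (z $ i))"

definition primitive :: "'n::finite tp \<Rightarrow> bool" where
  "primitive v \<longleftrightarrow> v \<noteq> 0 \<and> v \<in> range tp_of_int \<and>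
     {w \<in> range tp_of_int. \<exists>c\<ge>0. w = c *\<^sub>R v} = range (\<lambda>k::nat. real k *\<^sub>R v)"

definition nonpos_rep :: "'n::finite tp \<Rightarrow> int ^ 'n" where
  "nonpos_rep v = (THE z. tp_of_int z = v \<and> (\<forall>i. z $ i \<le> 0) \<and> (\<exists>i. z $ i = 0))"


lemma ex1_nonpos_rep: "\<exists>!z. tp_of_int z = tp_of_int w \<and> (\<forall>i. z $ i \<le> 0) \<and> (\<exists>i. z $ i = 0)"
proof -
  have eq: "tp_of_int z = tp_of_int w \<longleftrightarrow> (\<exists>c. \<forall>i. z $ i = w $ i + c)" for z
  proof
    assume "tp_of_int z = tp_of_int w"
    then obtain c where c: "\<And>i. real_of_int (z $ i) = real_of_int (w $ i) + c"
      unfolding tp_of_int_def tp.abs_eq_iff tp_rel_def by (auto simp: vec_eq_iff)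
    have "z $ i = w $ i + (z $ undefined - w $ undefined)" for i
      using c[of i] c[of undefined] by linarith
    then show "\<exists>c. \<forall>i. z $ i = w $ i + c" by blast
  next
    assume "\<exists>c. \<forall>i. z $ i = w $ i + c"
    then obtain c where "\<And>i. z $ i = w $ i + c" by blast
    then show "tp_of_int z = tp_of_int w"
      unfolding tp_of_int_def tp.abs_eq_iff tp_rel_def
      by (intro exI[of _ "real_of_int c"]) (auto simp: vec_eq_iff)
  qed
  define M where "M = Max (range (($) w))"
  have M: "w $ i \<le> M" for i unfolding M_def by (intro Max_ge) auto
  have "M \<in> range (($) w)" unfolding M_def by (intro Max_in) auto
  then obtain j where j: "w $ j = M" by auto
  show ?thesis
  proof (rule ex1I[of _ "w - vec M"])
    show "tp_of_int (w - vec M) = tp_of_int w \<and> (\<forall>i. (w - vec M) $ i \<le> 0) \<and>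
      (\<exists>i. (w - vec M) $ i = 0)"
      unfolding eq using M j by (auto intro!: exI[of _ "- M"] exI[of _ j])
  next
    fix z assume z: "tp_of_int z = tp_of_int w \<and> (\<forall>i. z $ i \<le> 0) \<and> (\<exists>i. z $ i = 0)"
    then obtain c k where c: "\<And>i. z $ i = w $ i + c" and k: "z $ k = 0" unfolding eq by blast
    have "z $ j \<le> 0" using z by blast
    then have "c = - M" using c[of j] c[of k] k j M[of k] by linarith
    then show "z = w - vec M" using c by (simp add: vec_eq_iff)
  qed
qed


section \<open>Embedded tropical curves\<close>

text \<open>One-dimensional polyhedra with rational slope: segments, rays and lines.\<close>

definition rational_edge :: "'n::finite tp set \<Rightarrow> bool" where
  "rational_edge C \<longleftrightarrow> (\<exists>p v. \<exists>I::real set. primitive v \<and> is_interval I \<and> closed I \<and>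
     (\<exists>a\<in>I. \<exists>b\<in>I. a < b) \<and> C = (\<lambda>t. p + t *\<^sub>R v) ` I)"

definition edges :: "'n::finite tp set set \<Rightarrow> 'n tp set set" where
  "edges K = {C \<in> K. rational_edge C}"

text \<open>
  Cells of dimension 0 and 1. A complex that is a single point is not excluded: it occurs as
  the image of a constant map.
\<close>

definition rational_complex :: "'n::finite tp set set \<Rightarrow> bool" where
  "rational_complex K \<longleftrightarrow> finite K \<and>
     (\<forall>C\<in>K. (\<exists>p. C = {p}) \<or> rational_edge C) \<and>
     (\<forall>C\<in>K. \<forall>C'. C' face_of C \<and> C' \<noteq> {} \<longrightarrow> C' \<in> K) \<and>
     (\<forall>C\<in>K. \<forall>C'\<in>K. (C \<inter> C') face_of C \<and> (C \<inter> C') face_of C')"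

text \<open>
  The pairs of an edge \<open>e\<close> containing \<open>x\<close> and a primitive vector along \<open>e\<close> pointing away
  from \<open>x\<close>. If \<open>x\<close> is in the relative interior of \<open>e\<close>, both directions of \<open>e\<close> occur.
\<close>

definition edge_directions ::
  "'n::finite tp set set \<Rightarrow> 'n tp \<Rightarrow> ('n tp set \<times> 'n tp) set" where
  "edge_directions K x =
     {(e, v). e \<in> edges K \<and> primitive v \<and> (\<exists>\<epsilon>>0. \<forall>t\<in>{0..\<epsilon>}. x + t *\<^sub>R v \<in> e)}"

definition embedded_tropical_curve ::
  "'n::finite tp set set \<Rightarrow> ('n tp set \<Rightarrow> nat) \<Rightarrow> bool" where
  "embedded_tropical_curve K m \<longleftrightarrow> rational_complex K \<and> (\<forall>e\<in>edges K. 0 < m e) \<and>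
     (\<forall>x\<in>\<Union>K. (\<Sum>(e, v)\<in>edge_directions K x. real (m e) *\<^sub>R v) = 0)"

text \<open>The unbounded edges with their primitive directions; an edge that is a line counts as
  two rays.\<close>

definition rays :: "'n::finite tp set set \<Rightarrow> ('n tp set \<times> 'n tp) set" where
  "rays K = {(e, v). e \<in> edges K \<and> primitive v \<and> (\<exists>p. \<forall>t\<ge>0. p + t *\<^sub>R v \<in> e)}"

definition has_degree ::
  "'n::finite tp set set \<Rightarrow> ('n tp set \<Rightarrow> nat) \<Rightarrow> int \<Rightarrow> bool" where
  "has_degree K m d \<longleftrightarrow> (\<Sum>(e, v)\<in>rays K. int (m e) *s nonpos_rep v) = vec (- d)"

lemma has_degree_unique: "has_degree K m d \<Longrightarrow> has_degree K m d' \<Longrightarrow> d = d'"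
  unfolding has_degree_def by (auto simp: vec_eq_iff)


section \<open>Images of curves mapped to tropical projective space\<close>

text \<open>
  Maps from a tropical curve to \<open>'n tp\<close> are only considered on \<open>finite_points\<close>, as the
  target has no points at infinity.
\<close>

definition smooth_at :: "('v, 'e) metric_graph \<Rightarrow> (('v, 'e) point \<Rightarrow> 'n::finite tp) \<Rightarrow>
    ('v, 'e) point \<Rightarrow> nat \<Rightarrow> 'n tp \<Rightarrow> bool" where
  "smooth_at G h y m v \<longleftrightarrow> 0 < m \<and> primitive v \<and>
     (\<exists>d d'. d \<noteq> d' \<and> directions G y = {d, d'} \<and>
        has_slope G h d (real m *\<^sub>R v) \<and> has_slope G h d' (- (real m *\<^sub>R v)))"

definition point_mult :: "('v, 'e) metric_graph \<Rightarrow> (('v, 'e) point \<Rightarrow> 'n::finite tp) \<Rightarrow>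
    ('v, 'e) point \<Rightarrow> nat" where
  "point_mult G h y = (THE m. \<exists>v. smooth_at G h y m v)"

definition fiber :: "('v, 'e) metric_graph \<Rightarrow> (('v, 'e) point \<Rightarrow> 'n::finite tp) \<Rightarrow>
    'n tp \<Rightarrow> ('v, 'e) point set" where
  "fiber G h p = {y \<in> finite_points G. h y = p}"

text \<open>
  The weighted complex \<open>(K, m)\<close> is a polyhedral structure on the image of \<open>h\<close>, carrying the
  multiplicities induced by \<open>h\<close>. In the last condition, \<open>{p} \<notin> K\<close> says that \<open>p\<close> is in the
  relative interior of \<open>e\<close>.
\<close>

definition image_tropical_curve ::
  "('v, 'e) metric_graph \<Rightarrow> (('v, 'e) point \<Rightarrow> 'n::finite tp) \<Rightarrow>
   'n tp set set \<Rightarrow> ('n tp set \<Rightarrow> nat) \<Rightarrow> bool" where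
  "image_tropical_curve G h K m \<longleftrightarrow>
     embedded_tropical_curve K m \<and>
     \<Union>K = h ` finite_points G \<and>
     (\<forall>e\<in>edges K. \<forall>p\<in>e.
        {p} \<notin> K \<and> finite (fiber G h p) \<and> (\<forall>y\<in>fiber G h p. \<exists>m' v. smooth_at G h y m' v) \<longrightarrow>
        m e = (\<Sum>y\<in>fiber G h p. point_mult G h y))"


section \<open>The balancing procedure\<close>

text \<open>
  To attach leaves at the points of a finite set \<open>P\<close>, every edge is first subdivided at the
  points of \<open>P\<close> in its interior: \<open>Piece e a b\<close> is the part of the edge \<open>e\<close> between the
  consecutive subdivision parameters \<open>a < b\<close>. \<open>Leaf x\<close> is the leaf edge attached at \<open>x\<close> and
  \<open>Leaf_End x\<close> its point at infinity.
\<close>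

datatype ('v, 'e) attached_vertex = Old "('v, 'e) point" | Leaf_End "('v, 'e) point"

datatype ('v, 'e) attached_arc = Piece 'e ereal ereal | Leaf "('v, 'e) point"

definition cuts :: "('v, 'e) metric_graph \<Rightarrow> ('v, 'e) point set \<Rightarrow> 'e \<Rightarrow> ereal set" where
  "cuts G P e = {0, len G e} \<union> {ereal t | t. Inner e t \<in> P}"

definition attach_leaves :: "('v, 'e) metric_graph \<Rightarrow> ('v, 'e) point set \<Rightarrow>
    (('v, 'e) attached_vertex, ('v, 'e) attached_arc) metric_graph" where
  "attach_leaves G P =
     \<lparr>verts = Old ` (Vertex ` verts G \<union> P) \<union> Leaf_End ` P,
      arcs = {Piece e a b | e a b. e \<in> arcs G \<and> a \<in> cuts G P e \<and> b \<in> cuts G P e \<and> a < b \<and>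
                                   cuts G P e \<inter> {a<..<b} = {}} \<union> Leaf ` P,
      tail = (\<lambda>\<alpha>. case \<alpha> of Piece e a b \<Rightarrow> Old (pt G e a) | Leaf x \<Rightarrow> Old x),
      head = (\<lambda>\<alpha>. case \<alpha> of Piece e a b \<Rightarrow> Old (pt G e b) | Leaf x \<Rightarrow> Leaf_End x),
      len = (\<lambda>\<alpha>. case \<alpha> of Piece e a b \<Rightarrow> b - a | Leaf x \<Rightarrow> \<infinity>)\<rparr>"

definition imbalance :: "('v, 'e) metric_graph \<Rightarrow> (('v, 'e) point \<Rightarrow> 'n::finite tp) \<Rightarrow>
    ('v, 'e) point \<Rightarrow> 'n tp" where
  "imbalance G h x = (\<Sum>d\<in>directions G x. slope G h d)"

definition balanced_curve :: "('v, 'e) metric_graph \<Rightarrow> (('v, 'e) point \<Rightarrow> 'n::finite tp) \<Rightarrow>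
    (('v, 'e) attached_vertex, ('v, 'e) attached_arc) metric_graph" where
  "balanced_curve G h = attach_leaves G {x \<in> finite_points G. imbalance G h x \<noteq> 0}"

fun balanced_map :: "('v, 'e) metric_graph \<Rightarrow> (('v, 'e) point \<Rightarrow> 'n::finite tp) \<Rightarrow>
    (('v, 'e) attached_vertex, ('v, 'e) attached_arc) point \<Rightarrow> 'n tp" where
  "balanced_map G h (Vertex (Old x)) = h x"
| "balanced_map G h (Inner (Piece e a b) t) = h (pt G e (a + ereal t))"
| "balanced_map G h (Inner (Leaf x) t) = h x - t *\<^sub>R imbalance G h x"
| "balanced_map G h (Vertex (Leaf_End x)) = undefined"

definition tropical_map ::
  "('n::finite \<Rightarrow> ('v, 'e) point \<Rightarrow> ereal) \<Rightarrow> ('v, 'e) point \<Rightarrow> 'n tp" where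
  "tropical_map f x = tp (\<chi> i. real_of_ereal (f i x))"

end

theory Submission
  imports Defs
begin

text \<open>
  No base points means \<open>D(x) = - min\<^sub>i ord\<^sub>x(f\<^sub>i)\<close> at every point \<open>x\<close>. Hence the representative with
  coordinates at most 0 and maximum 0 of the direction of the leaf attached at a finite point \<open>x\<close>,
  scaled by its multiplicity, has coordinates \<open>- (D(x) + ord\<^sub>x(f\<^sub>i))\<close>, and the same holds for the
  direction in which the image leaves towards a point at infinity \<open>x\<close>. At all other points
  \<open>D(x) + ord\<^sub>x(f\<^sub>i)\<close> vanishes for all \<open>i\<close>. The sum of all unbounded directions therefore has
  coordinates \<open>- deg D - deg (f\<^sub>i) = - deg D\<close>.

  In the interior of an edge the points with nonzero imbalance are exactly the break points of the map,
  so the balanced map is linear on every edge of the subdivided curve. The image of such a map becomes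
  a polyhedral complex when it is cut at the images of vertices and at the points where edges of
  different slopes cross.
\<close>

section \<open>Integral vectors of tropical projective space\<close>

text \<open>The statement concerns every weighted complex that carries the image, so the degree
  cannot be read off from one constructed complex. For an arbitrary one, the multiplicity of an
  unbounded edge is evaluated far out, where only infinite edges of the curve are left above it. The
  sum over rays thereby becomes a sum over the infinite edges of the balanced curve, in which the
  complex no longer occurs. The complex obtained by cutting provides existence.

  Fibres are the other obstacle: the map may contract edges, lay several edges over one another and
  send many points to one crossing. Local data are therefore collected at a point x of the image, as
  the set of half-edges leaving x in a given direction (\<open>germs_in\<close>). Away from finitely
  many nodes this set is locally constant along a line, and its weight is the multiplicity.

  At a point at infinity the only direction points inwards, so the image runs off along minus the
  slope there, just as it follows minus the imbalance on a leaf. Both kinds of ends thus obey one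
  formula.\<close>

abbreviation int_vectors :: "'n::finite tp set" where
  "int_vectors \<equiv> range tp_of_int"

lemma tp_eq_iff: "tp x = tp y \<longleftrightarrow> (\<exists>c. \<forall>i. x $ i = y $ i + c)"
  unfolding tp.abs_eq_iff tp_rel_def by (simp add: vec_eq_iff)

lemma tp_add: "tp x + tp y = tp (x + y)"
  by (simp add: plus_tp.abs_eq)

lemma tp_scaleR: "r *\<^sub>R tp x = tp (r *\<^sub>R x)"
  by (simp add: scaleR_tp.abs_eq)

lemma tp_zero: "tp 0 = 0"
  by (simp add: zero_tp.abs_eq)

lemma tp_uminus: "- tp x = tp (- x)"
  by (simp add: uminus_tp.abs_eq)

lemma tp_sum: "(\<Sum>a\<in>A. tp (F a)) = tp (\<Sum>a\<in>A. F a)"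
  by (induction A rule: infinite_finite_induct) (auto simp: tp_zero tp_add)

lemma tp_of_int_add: "tp_of_int x + tp_of_int y = tp_of_int (x + y)"
  unfolding tp_of_int_def tp_add by (simp add: tp_eq_iff)

lemma tp_of_int_uminus: "- tp_of_int x = tp_of_int (- x)"
  unfolding tp_of_int_def tp_uminus by (simp add: tp_eq_iff)

lemma tp_of_int_0: "tp_of_int 0 = 0"
  unfolding tp_of_int_def tp_zero[symmetric] by (simp add: tp_eq_iff)

lemma tp_of_int_of_nat: "real k *\<^sub>R tp_of_int z = tp_of_int (int k *s z)"
  unfolding tp_of_int_def tp_scaleR by (simp add: tp_eq_iff)

lemma integral_0 [simp]: "0 \<in> int_vectors"
  by (metis rangeI tp_of_int_0)

lemma integral_add: "x \<in> int_vectors \<Longrightarrow> y \<in> int_vectors \<Longrightarrow> x + y \<in> int_vectors"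
  using tp_of_int_add by blast

lemma integral_uminus: "x \<in> int_vectors \<Longrightarrow> - x \<in> int_vectors"
  using tp_of_int_uminus by blast

lemma integral_uminus_iff [simp]: "- x \<in> int_vectors \<longleftrightarrow> x \<in> int_vectors"
  using integral_uminus[of x] integral_uminus[of "- x"] by auto

lemma integral_diff: "x \<in> int_vectors \<Longrightarrow> y \<in> int_vectors \<Longrightarrow> x - y \<in> int_vectors"
  using integral_add[of x "- y"] by simp

lemma integral_scale_nat: "x \<in> int_vectors \<Longrightarrow> real k *\<^sub>R x \<in> int_vectors"
  using tp_of_int_of_nat by blast

lemma primitive_not_0: "primitive v \<Longrightarrow> v \<noteq> 0"
  unfolding primitive_def by blast

lemma primitive_integral: "primitive v \<Longrightarrow> v \<in> int_vectors"
  unfolding primitive_def by blast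

lemma primitive_multiple:
  assumes "primitive v" "c *\<^sub>R v \<in> int_vectors" "0 \<le> c"
  shows "\<exists>k::nat. c = real k"
proof -
  have "c *\<^sub>R v \<in> range (\<lambda>k::nat. real k *\<^sub>R v)"
    using assms unfolding primitive_def by blast
  then show ?thesis using primitive_not_0[OF assms(1)] by auto
qed

lemma primitive_uminus: "primitive v \<Longrightarrow> primitive (- v)"
proof -
  assume v: "primitive v"
  show ?thesis unfolding primitive_def
  proof (intro conjI equalityI subsetI)
    show "- v \<noteq> 0" "- v \<in> int_vectors"
      using primitive_not_0[OF v] primitive_integral[OF v] by auto
  next
    fix u assume "u \<in> {w \<in> int_vectors. \<exists>c\<ge>0. w = c *\<^sub>R - v}"
    then obtain c where c: "u \<in> int_vectors" "0 \<le> c" "u = c *\<^sub>R - v" by blast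
    have "c *\<^sub>R v \<in> int_vectors" using c integral_uminus[of u] by simp
    then obtain k :: nat where "c = real k" using primitive_multiple[OF v _ c(2)] by blast
    then show "u \<in> range (\<lambda>k::nat. real k *\<^sub>R - v)" using c by blast
  next
    fix u assume "u \<in> range (\<lambda>k::nat. real k *\<^sub>R - v)"
    then obtain k :: nat where "u = real k *\<^sub>R - v" by blast
    then show "u \<in> {w \<in> int_vectors. \<exists>c\<ge>0. w = c *\<^sub>R - v}"
      using integral_scale_nat[of "- v" k] primitive_integral[OF v]
      by (auto intro!: exI[of _ "real k"])
  qed
qed

lemma primitive_uminus_iff [simp]: "primitive (- v) \<longleftrightarrow> primitive v"
  using primitive_uminus[of v] primitive_uminus[of "- v"] by auto

lemma primitive_unique_pos:
  assumes "primitive v" "primitive v'" "v' = r *\<^sub>R v" "0 \<le> r"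
  shows "v' = v"
proof -
  have r: "r \<noteq> 0" using assms primitive_not_0 by fastforce
  obtain k :: nat where k: "r = real k"
    using primitive_multiple[OF assms(1), of r] assms primitive_integral by metis
  have "inverse r *\<^sub>R v' = v" using assms(3) r by simp
  then obtain k' :: nat where "inverse r = real k'"
    using primitive_multiple[OF assms(2), of "inverse r"] primitive_integral[OF assms(1)] assms(4)
    by auto
  then have "real (k' * k) = 1" using k r by (metis left_inverse of_nat_mult)
  then have "k = 1" using nat_mult_eq_1_iff by (metis of_nat_eq_1_iff)
  then show ?thesis using assms(3) k by simp
qed

lemma primitive_unique:
  assumes "primitive v" "primitive v'" "v' = r *\<^sub>R v"
  shows "v' = v \<or> v' = - v"
proof (cases "0 \<le> r")
  case True
  then show ?thesis using primitive_unique_pos assms by blast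
next
  case False
  then have "- v' = v"
    using primitive_unique_pos[of v "- v'" "- r"] assms by simp
  then show ?thesis by auto
qed

text \<open>Some two coordinates of an integral representative of \<open>w\<close> differ. Their
  difference ignores shifts by the all-ones vector, so \<open>c\<close> times it is an integer
  whenever \<open>c *\<^sub>R w\<close> is integral: all such scalars share the denominator
  \<open>N\<close>.\<close>

lemma integral_multiple_discrete:
  assumes "w \<in> int_vectors" "w \<noteq> 0"
  shows "\<exists>N::nat. 0 < N \<and> (\<forall>c. c *\<^sub>R w \<in> int_vectors \<longrightarrow> (\<exists>k::int. c * real N = of_int k))"
proof -
  obtain z where z: "w = tp_of_int z" using assms(1) by blast
  \<comment> \<open>An arbitrary index serves as reference coordinate. If all coordinates agreed
    with it, \<open>w\<close> would be represented by a multiple of the all-ones vector.\<close>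
  have "\<exists>i. z $ i \<noteq> z $ undefined"
  proof (rule ccontr)
    assume "\<nexists>i. z $ i \<noteq> z $ undefined"
    then have "w = 0" unfolding z tp_of_int_def tp_zero[symmetric] tp_eq_iff
      by (intro exI[of _ "real_of_int (z $ undefined)"]) auto
    then show False using assms(2) by simp
  qed
  then obtain i where i: "z $ i \<noteq> z $ undefined" by blast
  let ?j = "undefined :: 'a"
  let ?d = "z $ i - z $ ?j"
  have int: "\<exists>k::int. c * of_int ?d = of_int k" if "c *\<^sub>R w \<in> int_vectors" for c
  proof -
    from that obtain y where "c *\<^sub>R w = tp_of_int y" by blast
    then obtain a where a: "\<And>l. c * real_of_int (z $ l) = real_of_int (y $ l) + a"
      unfolding z tp_of_int_def tp_scaleR tp_eq_iff by auto
    have "c * real_of_int ?d = real_of_int (y $ i - y $ ?j)"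
      using a[of i] a[of ?j] by (simp add: algebra_simps)
    then show ?thesis by blast
  qed
  show ?thesis
  proof (intro exI[of _ "nat \<bar>?d\<bar>"] conjI allI impI)
    show "0 < nat \<bar>?d\<bar>" using i by simp
    fix c assume "c *\<^sub>R w \<in> int_vectors"
    then obtain k where k: "c * of_int ?d = of_int k" using int by blast
    show "\<exists>k::int. c * real (nat \<bar>?d\<bar>) = of_int k"
    proof (cases "0 \<le> ?d")
      case True
      then show ?thesis using k by auto
    next
      case False
      then show ?thesis using k by (auto intro!: exI[of _ "-k"] simp: algebra_simps)
    qed
  qed
qed

text \<open>All integral multiples of \<open>w\<close> have scalars with the common denominator
  \<open>N\<close>. The smallest positive numerator \<open>k0\<close> gives the shortest integral
  vector on the ray, which generates the others by division with remainder.\<close>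

lemma integral_primitive_multiple:
  assumes "w \<in> int_vectors" "w \<noteq> 0"
  obtains m v where "0 < m" "primitive v" "w = real m *\<^sub>R v"
proof -
  obtain N :: nat where N: "0 < N"
    "\<And>c. c *\<^sub>R w \<in> int_vectors \<Longrightarrow> \<exists>k::int. c * real N = of_int k"
    using integral_multiple_discrete[OF assms] by blast
  define P where "P k \<longleftrightarrow> 0 < k \<and> (real k / real N) *\<^sub>R w \<in> int_vectors" for k :: nat
  define k0 where "k0 = (LEAST k. P k)"
  have "P N" unfolding P_def using N(1) assms(1) by simp
  then have P0: "P k0" and least: "\<And>k. P k \<Longrightarrow> k0 \<le> k"
    unfolding k0_def by (auto intro: LeastI Least_le)
  define v where "v = (real k0 / real N) *\<^sub>R w"
  have k0: "0 < k0" and vint: "v \<in> int_vectors" using P0 by (auto simp: P_def v_def)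
  have v0: "v \<noteq> 0" using k0 N(1) assms(2) by (simp add: v_def)
  have mult: "\<exists>k::nat. c = real k" if c: "c *\<^sub>R v \<in> int_vectors" "0 \<le> c" for c
  proof -
    \<comment> \<open>The remainder after removing whole copies of \<open>v\<close>. As a multiple
      of \<open>w\<close> it has the numerator \<open>d * real k0\<close>, which is less than
      \<open>k0\<close> and hence 0 by minimality.\<close>
    define d where "d = c - real (nat \<lfloor>c\<rfloor>)"
    have d: "0 \<le> d" "d < 1" unfolding d_def using c(2) by linarith+
    have "d *\<^sub>R v \<in> int_vectors"
      unfolding d_def scaleR_diff_left by (intro integral_diff c integral_scale_nat vint)
    then have dk: "(d * real k0 / real N) *\<^sub>R w \<in> int_vectors" by (simp add: v_def)
    then obtain k :: int where "d * real k0 / real N * real N = of_int k" using N(2) by blast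
    then have k: "d * real k0 = of_int k" using N(1) by simp
    have "0 \<le> real_of_int k" using d(1) k[symmetric] by simp
    then have k0': "0 \<le> k" by simp
    have "real_of_int k < real k0" using k d(2) k0 mult_strict_right_mono[of d 1 "real k0"] by simp
    then have lt: "nat k < k0" using k0' by linarith
    have "\<not> P (nat k)" using least lt by (meson leD)
    then have "k = 0" using dk k k0' by (auto simp: P_def)
    then have "d = 0" using k k0 by simp
    then show ?thesis unfolding d_def by auto
  qed
  have prim: "primitive v" unfolding primitive_def
  proof (intro conjI v0 vint equalityI subsetI)
    fix u assume "u \<in> {w \<in> int_vectors. \<exists>c\<ge>0. w = c *\<^sub>R v}"
    then obtain c where c: "u \<in> int_vectors" "0 \<le> c" "u = c *\<^sub>R v" by blast
    then obtain k :: nat where "c = real k" using mult by metis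
    then show "u \<in> range (\<lambda>k::nat. real k *\<^sub>R v)" using c(3) by blast
  next
    fix u assume "u \<in> range (\<lambda>k::nat. real k *\<^sub>R v)"
    then show "u \<in> {w \<in> int_vectors. \<exists>c\<ge>0. w = c *\<^sub>R v}"
      using integral_scale_nat[OF vint] of_nat_0_le_iff by blast
  qed
  have w: "w = (real N / real k0) *\<^sub>R v" using k0 N(1) by (simp add: v_def)
  then obtain m :: nat where m: "real N / real k0 = real m"
    using mult[of "real N / real k0"] assms(1) by auto
  have "0 < m" using m N(1) k0 by (cases m) auto
  then show ?thesis using that prim w m by metis
qed

lemma nonpos_rep:
  assumes "v \<in> int_vectors"
  shows "tp_of_int (nonpos_rep v) = v" "nonpos_rep v $ i \<le> 0" "\<exists>i. nonpos_rep v $ i = 0"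
proof -
  obtain w where "v = tp_of_int w" using assms by blast
  then have "\<exists>!z. tp_of_int z = v \<and> (\<forall>i. z $ i \<le> 0) \<and> (\<exists>i. z $ i = 0)"
    using ex1_nonpos_rep[of w] by simp
  from theI'[OF this] show "tp_of_int (nonpos_rep v) = v" "nonpos_rep v $ i \<le> 0"
    "\<exists>i. nonpos_rep v $ i = 0" unfolding nonpos_rep_def by auto
qed

lemma nonpos_rep_eqI:
  assumes "tp_of_int z = v" "\<And>i. z $ i \<le> 0" "z $ j = 0"
  shows "nonpos_rep v = z"
proof -
  have "\<exists>!z. tp_of_int z = v \<and> (\<forall>i. z $ i \<le> 0) \<and> (\<exists>i. z $ i = 0)"
    using ex1_nonpos_rep[of z] assms(1) by simp
  then show ?thesis unfolding nonpos_rep_def by (rule the1_equality) (use assms in blast)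
qed

text \<open>A nonnegative factor keeps the coordinates nonpositive and preserves the zero
  coordinate; a negative one would not, hence the natural number.\<close>

lemma nonpos_rep_scale:
  assumes "v \<in> int_vectors"
  shows "nonpos_rep (real k *\<^sub>R v) = int k *s nonpos_rep v"
proof -
  obtain j where "nonpos_rep v $ j = 0" using nonpos_rep(3)[OF assms] by blast
  then show ?thesis
    using nonpos_rep[OF assms]
    by (intro nonpos_rep_eqI[of _ _ j]) (auto simp: tp_of_int_of_nat[symmetric] mult_nonneg_nonpos)
qed

lemma nonpos_rep_0: "nonpos_rep 0 = 0"
  by (rule nonpos_rep_eqI[of _ _ undefined]) (auto simp: tp_of_int_0)

section \<open>Primitive direction and lattice length of an integral vector\<close>

definition prim_dir :: "'n::finite tp \<Rightarrow> 'n tp" where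
  "prim_dir w = (SOME v. primitive v \<and> (\<exists>m::nat. 0 < m \<and> w = real m *\<^sub>R v))"

text \<open>Both this and \<open>prim_dir\<close> are choices, but for nonzero integral
  \<open>w\<close> they are determined: \<open>prim_dir_eqI\<close> recovers them from any positive
  multiple of a primitive vector that equals \<open>w\<close>.\<close>

definition lat_length :: "'n::finite tp \<Rightarrow> nat" where
  "lat_length w = (SOME m. 0 < m \<and> w = real m *\<^sub>R prim_dir w)"

lemma prim_dir_lat_length:
  assumes "w \<in> int_vectors" "w \<noteq> 0"
  shows "primitive (prim_dir w)" "0 < lat_length w" "real (lat_length w) *\<^sub>R prim_dir w = w"
proof -
  have "\<exists>v. primitive v \<and> (\<exists>m::nat. 0 < m \<and> w = real m *\<^sub>R v)"
    using integral_primitive_multiple[OF assms] by metis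
  then have 1: "primitive (prim_dir w) \<and> (\<exists>m::nat. 0 < m \<and> w = real m *\<^sub>R prim_dir w)"
    unfolding prim_dir_def by (rule someI_ex)
  then show "primitive (prim_dir w)" by blast
  from 1 have "\<exists>m. 0 < m \<and> w = real m *\<^sub>R prim_dir w" by blast
  from someI_ex[OF this] have "0 < lat_length w \<and> w = real (lat_length w) *\<^sub>R prim_dir w"
    by (simp add: lat_length_def)
  then show "0 < lat_length w" "real (lat_length w) *\<^sub>R prim_dir w = w" by auto
qed

lemma prim_dir_eqI:
  assumes "w \<in> int_vectors" "primitive v" "w = r *\<^sub>R v" "0 < r"
  shows "prim_dir w = v" "real (lat_length w) = r"
proof -
  have w0: "w \<noteq> 0" using assms primitive_not_0 by auto
  note * = prim_dir_lat_length[OF assms(1) w0]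
  have "r *\<^sub>R v = real (lat_length w) *\<^sub>R prim_dir w" using *(3) assms(3) by simp
  then have "inverse r *\<^sub>R r *\<^sub>R v = inverse r *\<^sub>R real (lat_length w) *\<^sub>R prim_dir w" by simp
  then have "v = (real (lat_length w) / r) *\<^sub>R prim_dir w"
    using assms(4) by (simp add: field_simps)
  then show 1: "prim_dir w = v"
    using primitive_unique_pos[OF *(1) assms(2), of "real (lat_length w) / r"] assms(4) by simp
  show "real (lat_length w) = r"
    using *(3) assms(3) primitive_not_0[OF assms(2)] unfolding 1 by auto
qed

lemma prim_dir_parallel:
  assumes "w \<in> int_vectors" "w = r *\<^sub>R v" "r \<noteq> 0" "primitive v"
  shows "prim_dir w = v \<or> prim_dir w = - v"
proof (cases "0 < r")
  case True
  then show ?thesis using prim_dir_eqI assms by blast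
next
  case False
  then have "prim_dir w = - v"
    using prim_dir_eqI[of w "- v" "- r"] assms by auto
  then show ?thesis by blast
qed

text \<open>Lets the contributions of several infinite edges above one ray add up to the
  multiplicity of the ray times a single primitive vector.\<close>

lemma nonpos_rep_lat_length:
  assumes "w \<in> int_vectors" "w \<noteq> 0"
  shows "nonpos_rep w = int (lat_length w) *s nonpos_rep (prim_dir w)"
  using nonpos_rep_scale[of "prim_dir w" "lat_length w"] prim_dir_lat_length[OF assms]
  by (simp add: primitive_integral)


section \<open>Slopes and directions\<close>

definition sgn_dir :: "bool \<Rightarrow> real" where
  "sgn_dir s = (if s then 1 else - 1)"

lemma sgn_dir_simps [simp]: "sgn_dir True = 1" "sgn_dir False = - 1"
  by (auto simp: sgn_dir_def)

lemma sgn_dir_not [simp]: "sgn_dir (\<not> s) = - sgn_dir s"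
  by (cases s) auto

lemma has_slope_right:
  assumes "0 \<le> a" "a < b"
    and "\<And>r. a < ereal r \<Longrightarrow> ereal r < b \<Longrightarrow> g (pt G e (ereal r)) = c + r *\<^sub>R w"
  shows "has_slope G g (e, a, True) w"
proof -
  have "\<forall>\<^sub>F r in at_right a. g (pt G e r) = c + ((1::real) * real_of_ereal r) *\<^sub>R w"
    unfolding eventually_at_right[OF assms(2)]
  proof (intro exI[of _ b] conjI assms(2) allI impI)
    fix y assume y: "a < y" "y < b"
    then obtain r where r: "y = ereal r" using assms(1) by (cases y) auto
    show "g (pt G e y) = c + (1 * real_of_ereal y) *\<^sub>R w"
      using assms(3)[of r] y r by simp
  qed
  then show ?thesis by auto
qed

lemma has_slope_left:
  assumes "0 \<le> a" "a < b"
    and "\<And>r. a < ereal r \<Longrightarrow> ereal r < b \<Longrightarrow> g (pt G e (ereal r)) = c + r *\<^sub>R w"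
  shows "has_slope G g (e, b, False) (- w)"
proof -
  have "\<forall>\<^sub>F r in at_left b. g (pt G e r) = c + (- 1 * real_of_ereal r) *\<^sub>R (- w)"
    unfolding eventually_at_left[OF assms(2)]
  proof (intro exI[of _ a] conjI assms(2) allI impI)
    fix y assume y: "a < y" "y < b"
    then obtain r where r: "y = ereal r" using assms(1) by (cases y) auto
    show "g (pt G e y) = c + (- 1 * real_of_ereal y) *\<^sub>R (- w)"
      using assms(3)[of r] y r by simp
  qed
  then show ?thesis by auto
qed

lemma slope_eqI:
  assumes "has_slope G g (e, t, s) w" "if s then t < \<infinity> else 0 < t"
  shows "slope G g (e, t, s) = w"
  unfolding slope_def
proof (rule the_equality)
  show "has_slope G g (e, t, s) w" by fact
  show "w' = w" if "has_slope G g (e, t, s) w'" for w'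
    using has_slope_unique[OF that assms] .
qed

lemma directions_Inner:
  assumes "e \<in> arcs G" "0 < t" "ereal t < len G e"
  shows "directions G (Inner e t) = {(e, ereal t, True), (e, ereal t, False)}"
proof (intro equalityI subsetI)
  fix d assume d: "d \<in> directions G (Inner e t)"
  obtain e' t' s where [simp]: "d = (e', t', s)" by (cases d)
  have *: "pt G e' t' = Inner e t" "0 \<le> t'" "t' \<le> len G e'" using d by (auto simp: directions_def)
  then have "t' \<noteq> 0" "t' \<noteq> len G e'" "e' = e" "real_of_ereal t' = t"
    by (auto simp: pt_def split: if_splits)
  then have "t' = ereal t" using *(2,3) by (cases t') auto
  then show "d \<in> {(e, ereal t, True), (e, ereal t, False)}"
    using \<open>e' = e\<close> by (cases s) auto
qed (use assms in \<open>auto simp: directions_def pt_def\<close>)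

lemma finite_directions:
  assumes "finite (arcs G)"
  shows "finite (directions G x)"
proof -
  let ?T = "\<lambda>e. {0, len G e} \<union> (case x of Vertex v \<Rightarrow> {} | Inner e' t \<Rightarrow> {ereal t})"
  have "directions G x \<subseteq> (\<Union>e\<in>arcs G. {e} \<times> ?T e \<times> UNIV)"
  proof
    fix d assume d: "d \<in> directions G x"
    obtain e t s where [simp]: "d = (e, t, s)" by (cases d)
    have *: "e \<in> arcs G" "pt G e t = x" "0 \<le> t" "t \<le> len G e"
      using d by (auto simp: directions_def)
    have "t \<in> ?T e"
    proof (cases "t = 0 \<or> t = len G e")
      case False
      then have "x = Inner e (real_of_ereal t)" using * by (simp add: pt_def)
      moreover have "\<bar>t\<bar> \<noteq> \<infinity>" using False * by (cases t) auto
      ultimately show ?thesis by (auto simp: ereal_real)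
    qed auto
    then show "d \<in> (\<Union>e\<in>arcs G. {e} \<times> ?T e \<times> UNIV)" using * by auto
  qed
  moreover have "finite \<dots>" using assms by (intro finite_UN_I) (auto split: point.split)
  ultimately show ?thesis by (rule finite_subset)
qed


text \<open>Includes the position \<open>t = \<infinity>\<close>: the slope there is read off from
  large finite parameters and points back along the edge.\<close>

lemma linear_slope:
  assumes "\<And>t. 0 \<le> t \<Longrightarrow> ereal t \<le> len G e \<Longrightarrow> h (pt G e (ereal t)) = c + t *\<^sub>R w"
    and "(e, t, s) \<in> directions G y"
  shows "has_slope G h (e, t, s) (sgn_dir s *\<^sub>R w)" "slope G h (e, t, s) = sgn_dir s *\<^sub>R w"
proof -
  have d: "e \<in> arcs G" "0 \<le> t" "t \<le> len G e" "if s then t < len G e else 0 < t"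
    using assms(2) unfolding directions_def by auto
  show slope: "has_slope G h (e, t, s) (sgn_dir s *\<^sub>R w)"
  proof (cases s)
    case True
    have "0 \<le> r" if "t < ereal r" for r
      using order.strict_trans1[OF d(2) that] by simp
    then have "has_slope G h (e, t, True) w"
      by (intro has_slope_right[of _ "len G e" _ _ _ c])
        (use d True assms(1) in \<open>auto simp: less_imp_le\<close>)
    then show ?thesis using True by simp
  next
    case False
    have "has_slope G h (e, t, False) (- w)"
      by (rule has_slope_left[of 0 _ _ _ _ c])
        (use d False assms(1) in \<open>auto simp: less_imp_le order.trans\<close>)
    then show ?thesis using False by simp
  qed
  show "slope G h (e, t, s) = sgn_dir s *\<^sub>R w"
    by (rule slope_eqI[OF slope]) (use d(4) in \<open>auto split: if_splits\<close>)
qed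


text \<open>Collects the graph facts for two instances, the given curve and the curve with attached
  leaves. \<open>infinite_tail\<close> includes the case \<open>e' = e\<close>, so an infinite edge
  is not a loop.\<close>

locale finite_metric_graph =
  fixes G :: "('v, 'e) metric_graph"
  assumes finite_verts: "finite (verts G)" and finite_arcs: "finite (arcs G)"
    and tail_in: "e \<in> arcs G \<Longrightarrow> tail G e \<in> verts G"
    and head_in: "e \<in> arcs G \<Longrightarrow> head G e \<in> verts G"
    and len_pos: "e \<in> arcs G \<Longrightarrow> 0 < len G e"
    and infinite_tail: "e \<in> arcs G \<Longrightarrow> len G e = \<infinity> \<Longrightarrow> e' \<in> arcs G \<Longrightarrow> tail G e' \<noteq> head G e"
    and infinite_head: "e \<in> arcs G \<Longrightarrow> len G e = \<infinity> \<Longrightarrow> e' \<in> arcs G \<Longrightarrow> e' \<noteq> e \<Longrightarrow>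
      head G e' \<noteq> head G e"
begin

lemma pt_finite:
  \<comment> \<open>A real parameter never reaches the far end of an infinite edge, and the vertex
    at any other end is not a point at infinity, since such a point meets no edge but its
    own.\<close>
  assumes "e \<in> arcs G" "0 \<le> t" "ereal t \<le> len G e"
  shows "pt G e (ereal t) \<in> finite_points G"
proof -
  have *: "Vertex (tail G e) \<in> finite_points G"
    using assms(1) tail_in infinite_tail unfolding finite_points_def points_def by fastforce
  have **: "Vertex (head G e) \<in> finite_points G" if "len G e \<noteq> \<infinity>"
    using assms(1) that head_in infinite_head unfolding finite_points_def points_def by fastforce
  show ?thesis
  proof (cases "t = 0 \<or> ereal t = len G e")
    case True
    then show ?thesis
    proof
      assume "ereal t = len G e"
      then have "len G e = ereal t" by simp
      then show ?thesis using * ** by (cases "t = 0") (auto simp: pt_def zero_ereal_def)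
    qed (use * in \<open>simp add: pt_def zero_ereal_def\<close>)
  next
    case False
    then have "0 < t" "ereal t < len G e" using assms by auto
    then show ?thesis using False assms(1) unfolding finite_points_def points_def pt_def by auto
  qed
qed

lemma finite_pointsE:
  assumes "y \<in> finite_points G"
  obtains v where "y = Vertex v" "v \<in> verts G" |
    e t where "y = Inner e t" "e \<in> arcs G" "0 < t" "ereal t < len G e"
  using assms unfolding finite_points_def points_def by blast

end

section \<open>Balanced curves with linear edges\<close>

text \<open>Edges may be contracted (\<open>w e = 0\<close>), overlap or cross in the image. The
  vector \<open>w e\<close> is a slope including its multiplicity, and the affine formula is
  demanded at finite parameters only.\<close>

locale linear_curve = finite_metric_graph G for G :: "('v, 'e) metric_graph" +
  fixes h :: "('v, 'e) point \<Rightarrow> 'n::finite tp"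
    and c w :: "'e \<Rightarrow> 'n tp"
  assumes linear: "e \<in> arcs G \<Longrightarrow> 0 \<le> t \<Longrightarrow> ereal t \<le> len G e \<Longrightarrow>
      h (pt G e (ereal t)) = c e + t *\<^sub>R w e"
    and w_integral: "e \<in> arcs G \<Longrightarrow> w e \<in> int_vectors"
    and balanced: "x \<in> finite_points G \<Longrightarrow> (\<Sum>d\<in>directions G x. slope G h d) = 0"
begin

section \<open>Half-edges over a point of the image\<close>

definition runs_through :: "'e \<Rightarrow> real \<Rightarrow> 'n tp \<Rightarrow> bool" where
  "runs_through e t x \<longleftrightarrow> e \<in> arcs G \<and> 0 \<le> t \<and> ereal t \<le> len G e \<and> c e + t *\<^sub>R w e = x"

definition continues :: "'e \<Rightarrow> bool \<Rightarrow> real \<Rightarrow> bool" where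
  "continues e s t \<longleftrightarrow> (if s then ereal t < len G e else 0 < t)"

definition dir :: "'e \<Rightarrow> bool \<Rightarrow> 'n tp" where
  "dir e s = sgn_dir s *\<^sub>R prim_dir (w e)"

text \<open>A noncontracted edge passes \<open>x\<close> at most once
  (\<open>runs_through_unique\<close>), so edge and orientation determine the half-edge and no
  parameter is stored. Contracted edges leave \<open>x\<close> in no direction.\<close>

definition germs :: "'n tp \<Rightarrow> ('e \<times> bool) set" where
  "germs x = {(e, s). w e \<noteq> 0 \<and> (\<exists>t. runs_through e t x \<and> continues e s t)}"

definition germs_in :: "'n tp \<Rightarrow> 'n tp \<Rightarrow> ('e \<times> bool) set" where
  "germs_in x v = {(e, s) \<in> germs x. dir e s = v}"

text \<open>The multiplicity of the image near \<open>x\<close> in direction \<open>v\<close>, in a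
  form that makes sense even where the fibre of \<open>x\<close> is infinite.\<close>

definition weight :: "'n tp \<Rightarrow> 'n tp \<Rightarrow> nat" where
  "weight x v = (\<Sum>(e, s)\<in>germs_in x v. lat_length (w e))"

definition vertex_images :: "'n tp set" where
  "vertex_images = h ` (Vertex ` verts G \<inter> finite_points G)"

text \<open>Only transversal meetings count: edges along the same line, in equal or opposite
  directions, may overlap without producing a node.\<close>

definition crossings :: "'n tp set" where
  "crossings = {x. \<exists>e t e' t'. runs_through e t x \<and> runs_through e' t' x \<and> w e \<noteq> 0 \<and> w e' \<noteq> 0 \<and>
     prim_dir (w e') \<noteq> prim_dir (w e) \<and> prim_dir (w e') \<noteq> - prim_dir (w e)}"

definition nodes :: "'n tp set" where
  "nodes = vertex_images \<union> crossings"

lemma germs_subset: "germs x \<subseteq> arcs G \<times> UNIV"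
  unfolding germs_def runs_through_def by auto

lemma finite_germs: "finite (germs x)"
  by (rule finite_subset[OF germs_subset]) (simp add: finite_arcs)

lemma germs_in_subset: "germs_in x v \<subseteq> germs x"
  unfolding germs_in_def by auto

lemma finite_germs_in: "finite (germs_in x v)"
  using finite_subset[OF germs_in_subset finite_germs] .

lemma w_eq_dir:
  assumes "e \<in> arcs G" "w e \<noteq> 0"
  shows "w e = (sgn_dir s * real (lat_length (w e))) *\<^sub>R dir e s" "0 < lat_length (w e)"
    "primitive (dir e s)" "dir e s \<noteq> 0"
proof -
  note * = prim_dir_lat_length[OF w_integral[OF assms(1)] assms(2)]
  show "w e = (sgn_dir s * real (lat_length (w e))) *\<^sub>R dir e s"
    using *(3) unfolding dir_def by (cases s) auto
  show "primitive (dir e s)" using *(1) unfolding dir_def by (cases s) auto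
  then show "dir e s \<noteq> 0" by (rule primitive_not_0)
qed (use prim_dir_lat_length[OF w_integral[OF assms(1)] assms(2)] in simp)

lemma germs_in_primitive: "germs_in x v \<noteq> {} \<Longrightarrow> primitive v"
  unfolding germs_in_def germs_def runs_through_def using w_eq_dir(3) by blast

lemma runs_through_unique:
  "runs_through e t x \<Longrightarrow> runs_through e t' x \<Longrightarrow> w e \<noteq> 0 \<Longrightarrow> t = t'"
  unfolding runs_through_def by (metis add_left_cancel scaleR_cancel_right)

text \<open>Vertex images are listed separately because a vertex without edges lies on no
  edge.\<close>

lemma image_eq: "h ` finite_points G = vertex_images \<union> {x. \<exists>e t. runs_through e t x}"
proof (intro equalityI subsetI)
  fix x assume "x \<in> h ` finite_points G"
  then obtain y where y: "y \<in> finite_points G" "x = h y" by blast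
  from y(1) show "x \<in> vertex_images \<union> {x. \<exists>e t. runs_through e t x}"
  proof (cases rule: finite_pointsE)
    case (1 v)
    then show ?thesis using y unfolding vertex_images_def by blast
  next
    case (2 e t)
    then have "runs_through e t x"
      using linear[of e t] y less_imp_neq[OF 2(4)] unfolding runs_through_def
      by (simp add: pt_def zero_ereal_def less_imp_le)
    then show ?thesis by blast
  qed
next
  fix x assume x: "x \<in> vertex_images \<union> {x. \<exists>e t. runs_through e t x}"
  show "x \<in> h ` finite_points G"
  proof (cases "x \<in> vertex_images")
    case True
    then show ?thesis unfolding vertex_images_def by blast
  next
    case False
    then obtain e t where "runs_through e t x" using x by blast
    then have "x = h (pt G e (ereal t))" "pt G e (ereal t) \<in> finite_points G"
      using pt_finite linear unfolding runs_through_def by auto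
    then show ?thesis by blast
  qed
qed

text \<open>The finite ends of an edge map into \<open>vertex_images\<close>, and a contracted edge
  maps entirely to the image of its tail.\<close>

lemma runs_through_interior:
  assumes "runs_through e t x" "x \<notin> vertex_images"
  shows "0 < t" "ereal t < len G e" "w e \<noteq> 0"
proof -
  have *: "e \<in> arcs G" "0 \<le> t" "ereal t \<le> len G e" "c e + t *\<^sub>R w e = x"
    using assms(1) unfolding runs_through_def by auto
  have fin: "Vertex (tail G e) \<in> finite_points G" using pt_finite[of e 0] * len_pos
    by (auto simp: pt_def zero_ereal_def[symmetric] order_less_imp_le)
  have tail: "c e \<in> vertex_images"
    using linear[of e 0] *(1) len_pos[OF *(1)] fin tail_in[OF *(1)] unfolding vertex_images_def
    by (intro image_eqI[of _ _ "Vertex (tail G e)"])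
      (auto simp: pt_def zero_ereal_def[symmetric] order_less_imp_le)
  have "t \<noteq> 0" using tail * assms(2) by auto
  then show "0 < t" using * by simp
  show "w e \<noteq> 0" using tail * assms(2) by auto
  have "ereal t \<noteq> len G e"
  proof
    assume t: "ereal t = len G e"
    then have "pt G e (ereal t) = Vertex (head G e)"
      using \<open>t \<noteq> 0\<close> by (auto simp: pt_def)
    then have "x \<in> vertex_images"
      using linear[of e t] pt_finite[of e t] * head_in[OF *(1)] unfolding vertex_images_def by auto
    then show False using assms(2) by blast
  qed
  then show "ereal t < len G e" using *(3) by auto
qed

lemma finite_vertex_images: "finite vertex_images"
  unfolding vertex_images_def using finite_verts by auto

text \<open>Two edges of different direction have at most one common image point: the difference of
  two such points would be a nonzero multiple of both slopes. There are finitely many pairs of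
  edges.\<close>

lemma finite_crossings: "finite crossings"
proof -
  let ?C = "\<lambda>(e, e'). {x. \<exists>t t'. runs_through e t x \<and> runs_through e' t' x \<and> w e \<noteq> 0 \<and> w e' \<noteq> 0 \<and>
     prim_dir (w e') \<noteq> prim_dir (w e) \<and> prim_dir (w e') \<noteq> - prim_dir (w e)}"
  have "crossings \<subseteq> (\<Union>p\<in>arcs G \<times> arcs G. ?C p)"
    unfolding crossings_def runs_through_def by blast
  moreover have "finite (?C (e, e'))" if "e \<in> arcs G" "e' \<in> arcs G" for e e'
  proof (cases "\<exists>x. x \<in> ?C (e, e')")
    case True
    then obtain x where x: "x \<in> ?C (e, e')" by blast
    have "y = x" if y: "y \<in> ?C (e, e')" for y
    proof -
      obtain t t' where t: "runs_through e t x" "runs_through e' t' x" using x by auto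
      obtain u u' where u: "runs_through e u y" "runs_through e' u' y" using y by auto
      have neq: "w e \<noteq> 0" "w e' \<noteq> 0" "prim_dir (w e') \<noteq> prim_dir (w e)"
        "prim_dir (w e') \<noteq> - prim_dir (w e)" using x by auto
      have 1: "y - x = (u - t) *\<^sub>R w e" "y - x = (u' - t') *\<^sub>R w e'"
        using t u unfolding runs_through_def
        by (metis add_diff_cancel_left scaleR_diff_left)+
      show "y = x"
      proof (rule ccontr)
        assume "y \<noteq> x"
        then have "y - x \<noteq> 0" by simp
        then have ne: "u' - t' \<noteq> 0" "u - t \<noteq> 0" using 1 by (metis scaleR_zero_left)+
        have "inverse (u' - t') *\<^sub>R (u' - t') *\<^sub>R w e' = inverse (u' - t') *\<^sub>R (u - t) *\<^sub>R w e"
          using 1 by simp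
        then have "w e' = ((u - t) / (u' - t')) *\<^sub>R w e"
          using ne by (simp add: divide_inverse mult.commute)
        also have "\<dots> = ((u - t) / (u' - t') * lat_length (w e)) *\<^sub>R prim_dir (w e)"
          using prim_dir_lat_length(3)[OF w_integral neq(1)] \<open>e \<in> arcs G\<close>
          by (metis scaleR_scaleR)
        finally have "prim_dir (w e') = prim_dir (w e) \<or> prim_dir (w e') = - prim_dir (w e)"
          using prim_dir_lat_length[OF w_integral neq(1)] \<open>e \<in> arcs G\<close> ne
          by (intro prim_dir_parallel[OF w_integral[OF \<open>e' \<in> arcs G\<close>]]) auto
        then show False using neq by blast
      qed
    qed
    then have "?C (e, e') \<subseteq> {x}" by blast
    then show ?thesis by (rule finite_subset) simp
  next
    case False
    then have "?C (e, e') = {}" by blast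
    then show ?thesis by (metis finite.emptyI)
  qed
  ultimately show ?thesis
    using finite_arcs by (elim finite_subset) (auto intro!: finite_UN_I)
qed

lemma finite_nodes: "finite nodes"
  unfolding nodes_def using finite_vertex_images finite_crossings by blast

lemma nodes_subset: "nodes \<subseteq> h ` finite_points G"
  unfolding nodes_def image_eq crossings_def by blast

lemma germs_dir_unique:
  assumes "x \<notin> nodes" "(e, s) \<in> germs x" "(e', s') \<in> germs x"
  shows "dir e' s' = dir e s \<or> dir e' s' = - dir e s"
proof -
  have "prim_dir (w e') = prim_dir (w e) \<or> prim_dir (w e') = - prim_dir (w e)"
    using assms unfolding nodes_def crossings_def germs_def by blast
  then show ?thesis unfolding dir_def by (cases s; cases s') auto
qed

lemma germs_in_unique:
  assumes "x \<notin> nodes" "germs_in x v \<noteq> {}" "germs_in x v' \<noteq> {}"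
  shows "v' = v \<or> v' = - v"
proof -
  obtain e s e' s' where "(e, s) \<in> germs x" "dir e s = v" "(e', s') \<in> germs x" "dir e' s' = v'"
    using assms(2,3) unfolding germs_in_def by auto
  then show ?thesis using germs_dir_unique[OF assms(1)] by blast
qed

text \<open>Off the nodes an edge through \<open>x\<close> is not contracted and passes
  \<open>x\<close> at an inner parameter, so it leaves \<open>x\<close> both ways.\<close>

lemma germs_flip:
  assumes "x \<notin> nodes"
  shows "(e, s) \<in> germs x \<longleftrightarrow> (\<exists>t. runs_through e t x)"
  using runs_through_interior[of e _ x] assms
  unfolding germs_def continues_def nodes_def by (cases s) auto

lemma germs_in_uminus:
  assumes "x \<notin> nodes"
  shows "germs_in x (- v) = (\<lambda>(e, s). (e, \<not> s)) ` germs_in x v"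
proof -
  have *: "(e, s) \<in> germs_in x (- v) \<longleftrightarrow> (e, \<not> s) \<in> germs_in x v" for e s
    unfolding germs_in_def using germs_flip[OF assms, of e] by (auto simp: dir_def)
  show ?thesis
  proof (intro equalityI subsetI)
    fix p assume "p \<in> germs_in x (- v)"
    then show "p \<in> (\<lambda>(e, s). (e, \<not> s)) ` germs_in x v"
      using *[of "fst p" "snd p"] by (intro image_eqI[of _ _ "(fst p, \<not> snd p)"]) auto
  next
    fix p assume "p \<in> (\<lambda>(e, s). (e, \<not> s)) ` germs_in x v"
    then obtain e s where "p = (e, \<not> s)" "(e, s) \<in> germs_in x v" by auto
    then show "p \<in> germs_in x (- v)" using * by auto
  qed
qed

lemma germs_in_pos:
  assumes "germs_in x v \<noteq> {}"
  shows "0 < weight x v"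
proof -
  obtain p where p: "p \<in> germs_in x v" using assms by blast
  then have "0 < lat_length (w (fst p))" 
    using w_eq_dir(2) unfolding germs_in_def germs_def runs_through_def by auto
  also have "\<dots> \<le> weight x v"
    unfolding weight_def using p finite_germs_in
    by (intro order.trans[OF _ member_le_sum[of p]]) (auto simp: case_prod_beta)
  finally show ?thesis .
qed

text \<open>The fibre of \<open>x\<close> may contain whole edges contracted by \<open>h\<close>, so the balancing condition is
  summed over the finitely many points of the fibre at which some direction is not contracted.\<close>

lemma germs_balanced: "(\<Sum>(e, s)\<in>germs x. sgn_dir s *\<^sub>R w e) = 0"
proof -
  define \<tau> where "\<tau> e = (THE t. runs_through e t x)" for e
  have \<tau>: "\<tau> e = t" if "runs_through e t x" "w e \<noteq> 0" for e t
    unfolding \<tau>_def using that runs_through_unique by blast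
  define g where "g = (\<lambda>(e, s::bool). pt G e (ereal (\<tau> e)))"
  have "(\<Sum>(e, s)\<in>germs x. sgn_dir s *\<^sub>R w e) =
    (\<Sum>y\<in>g ` germs x. \<Sum>(e, s)\<in>{p \<in> germs x. g p = y}. sgn_dir s *\<^sub>R w e)"
    using sum.group[of "germs x" "g ` germs x" g "\<lambda>(e, s). sgn_dir s *\<^sub>R w e"] finite_germs by simp
  also have "\<dots> = (\<Sum>y\<in>g ` germs x. 0)"
  proof (rule sum.cong[OF refl])
    fix y assume "y \<in> g ` germs x"
    then obtain e0 s0 where e0: "(e0, s0) \<in> germs x" "y = pt G e0 (ereal (\<tau> e0))"
      unfolding g_def by auto
    then obtain t0 where t0: "runs_through e0 t0 x" "w e0 \<noteq> 0" unfolding germs_def by blast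
    then have y: "y \<in> finite_points G" "h y = x"
      using e0(2) pt_finite linear \<tau> unfolding runs_through_def by auto
    \<comment> \<open>The half-edges starting at \<open>y\<close> are its noncontracted directions.
      The contracted ones have slope 0, so they may be added to complete the balancing sum at
      \<open>y\<close>.\<close>
    let ?D = "{d \<in> directions G y. w (fst d) \<noteq> 0}"
    have slope: "slope G h (e, t, s) = sgn_dir s *\<^sub>R w e" if "(e, t, s) \<in> directions G y" for e t s
      by (rule linear_slope(2)[OF linear that]) (use that in \<open>auto simp: directions_def\<close>)
    have "(\<Sum>(e, s)\<in>{p \<in> germs x. g p = y}. sgn_dir s *\<^sub>R w e) =
      (\<Sum>(e, t, s)\<in>?D. sgn_dir s *\<^sub>R w e)"
    proof (rule sum.reindex_bij_witness[of _ "\<lambda>(e, t, s). (e, s)" "\<lambda>(e, s). (e, ereal (\<tau> e), s)"])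
      fix p assume "p \<in> {p \<in> germs x. g p = y}"
      then obtain e s t where p: "p = (e, s)" "w e \<noteq> 0" "runs_through e t x" "continues e s t"
        "pt G e (ereal (\<tau> e)) = y" unfolding germs_def g_def by auto
      then show "(case p of (e, s) \<Rightarrow> (e, ereal (\<tau> e), s)) \<in> ?D"
        using \<tau>[OF p(3,2)] unfolding directions_def runs_through_def continues_def
        by (auto simp: zero_ereal_def)
    next
      fix d assume "d \<in> ?D"
      then obtain e t s where d: "d = (e, t, s)" "e \<in> arcs G" "0 \<le> t" "t \<le> len G e" "pt G e t = y"
        "if s then t < len G e else 0 < t" "w e \<noteq> 0" unfolding directions_def by auto
      have "t \<noteq> \<infinity>"
      proof
        assume "t = \<infinity>"
        then have "len G e = \<infinity>" "y = Vertex (head G e)" using d by (auto simp: pt_def)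
        then show False using y(1) d(2) unfolding finite_points_def by blast
      qed
      then obtain r where r: "t = ereal r" using d(3) by (cases t) auto
      have "runs_through e r x" using d r linear[OF d(2), of r] y(2) unfolding runs_through_def by auto
      moreover from this have "\<tau> e = r" using \<tau> d(7) by blast
      ultimately show "(case case d of (e, t, s) \<Rightarrow> (e, s) of (e, s) \<Rightarrow> (e, ereal (\<tau> e), s)) = d"
        "(case d of (e, t, s) \<Rightarrow> (e, s)) \<in> {p \<in> germs x. g p = y}"
        using d r unfolding germs_def g_def continues_def by (auto simp: zero_ereal_def split: if_splits)
    qed auto
    also have "\<dots> = (\<Sum>(e, t, s)\<in>directions G y. sgn_dir s *\<^sub>R w e)"
      by (rule sum.mono_neutral_left[OF finite_directions[OF finite_arcs]]) auto
    also have "\<dots> = (\<Sum>d\<in>directions G y. slope G h d)"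
      by (rule sum.cong[OF refl]) (use slope in auto)
    also have "\<dots> = 0" using balanced[OF y(1)] .
    finally show "(\<Sum>(e, s)\<in>{p \<in> germs x. g p = y}. sgn_dir s *\<^sub>R w e) = 0" .
  qed
  finally show ?thesis by simp
qed

text \<open>Regroups \<open>germs_balanced\<close> by direction: a half-edge along \<open>v\<close>
  has slope \<open>lat_length\<close> times \<open>v\<close>, so those along \<open>v\<close> sum to
  \<open>weight x v\<close> times \<open>v\<close>.\<close>

lemma weight_balanced: "(\<Sum>v | germs_in x v \<noteq> {}. real (weight x v) *\<^sub>R v) = 0"
proof -
  let ?d = "\<lambda>(e, s). dir e s"
  have dirs: "{v. germs_in x v \<noteq> {}} = ?d ` germs x"
    unfolding germs_in_def by auto
  have "(\<Sum>v | germs_in x v \<noteq> {}. real (weight x v) *\<^sub>R v) =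
    (\<Sum>v\<in>?d ` germs x. \<Sum>(e, s)\<in>{p \<in> germs x. ?d p = v}. sgn_dir s *\<^sub>R w e)"
    unfolding dirs
  proof (rule sum.cong[OF refl])
    fix v
    have along: "germs_in x v = {p \<in> germs x. ?d p = v}"
      unfolding germs_in_def by auto
    show "real (weight x v) *\<^sub>R v = (\<Sum>(e, s)\<in>{p \<in> germs x. ?d p = v}. sgn_dir s *\<^sub>R w e)"
      unfolding weight_def along[symmetric] of_nat_sum scaleR_sum_left
    proof (rule sum.cong[OF refl])
      fix p assume "p \<in> germs_in x v"
      then obtain e s where p: "p = (e, s)" "e \<in> arcs G" "w e \<noteq> 0" "dir e s = v"
        unfolding germs_in_def germs_def runs_through_def by auto
      have "sgn_dir s *\<^sub>R w e = real (lat_length (w e)) *\<^sub>R v"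
        using arg_cong[OF w_eq_dir(1)[OF p(2,3), of s], of "scaleR (sgn_dir s)"] p(4)
        by (cases s) simp_all
      then show "real (case p of (e, s) \<Rightarrow> lat_length (w e)) *\<^sub>R v =
        (case p of (e, s) \<Rightarrow> sgn_dir s *\<^sub>R w e)" using p(1) by simp
    qed
  qed
  also have "\<dots> = 0"
    using sum.group[of "germs x" "?d ` germs x" ?d "\<lambda>(e, s). sgn_dir s *\<^sub>R w e"] finite_germs
      germs_balanced by simp
  finally show ?thesis .
qed

end


section \<open>Behaviour of the half-edges along a line\<close>

lemma eventually_not_in_finite:
  fixes a :: real
  assumes "finite A"
  shows "\<forall>\<^sub>F t in at a within S. t \<notin> A"
proof -
  have "\<forall>\<^sub>F t in at a within S. \<forall>y\<in>A. t \<noteq> y"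
    using assms by (intro eventually_ball_finite ballI eventually_neq_at_within)
  then show ?thesis by (rule eventually_mono) auto
qed

text \<open>Membership in [0, l) survives small shifts to the right, for points inside and outside
  alike. These are the parameters from which an edge continues forwards;
  \<open>interval_shift_left\<close> is the mirror image for (0, l].\<close>

lemma interval_shift_right:
  fixes t0 :: real and l :: ereal
  shows "\<exists>b>0. \<forall>u. 0 < u \<and> u < b \<longrightarrow> (0 \<le> t0 + u \<and> ereal (t0 + u) < l \<longleftrightarrow> 0 \<le> t0 \<and> ereal t0 < l)"
proof (cases "t0 < 0")
  case True
  then show ?thesis by (intro exI[of _ "- t0"]) auto
next
  case False
  show ?thesis
  proof (cases l)
    case (real r)
    show ?thesis
    proof (cases "t0 < r")
      case True
      then show ?thesis using False real by (intro exI[of _ "r - t0"]) auto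
    qed (use real in \<open>auto intro!: exI[of _ 1]\<close>)
  qed (use False in \<open>auto intro!: exI[of _ 1]\<close>)
qed

lemma interval_shift_left:
  fixes t0 :: real and l :: ereal
  shows "\<exists>b>0. \<forall>u. 0 < u \<and> u < b \<longrightarrow> (0 < t0 - u \<and> ereal (t0 - u) \<le> l \<longleftrightarrow> 0 < t0 \<and> ereal t0 \<le> l)"
proof (cases "0 < t0")
  case True
  show ?thesis
  proof (cases l)
    case (real r)
    show ?thesis
    proof (cases "t0 \<le> r")
      case False
      then show ?thesis using real by (intro exI[of _ "t0 - r"]) auto
    qed (use real True in \<open>auto intro!: exI[of _ t0]\<close>)
  qed (use True in \<open>auto intro!: exI[of _ t0]\<close>)
qed (auto intro!: exI[of _ 1])

context linear_curve
begin

lemma shift_along_edge: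
  assumes "e \<in> arcs G" "w e \<noteq> 0" "dir e s = v"
  shows "(sgn_dir s * (\<epsilon> / real (lat_length (w e)))) *\<^sub>R w e = \<epsilon> *\<^sub>R v"
proof -
  define k where "k = real (lat_length (w e))"
  have k: "w e = (sgn_dir s * k) *\<^sub>R v"
    using w_eq_dir(1)[OF assms(1,2), of s] unfolding assms(3) k_def .
  have k0: "0 < k" using w_eq_dir(2)[OF assms(1,2)] unfolding k_def by simp
  have "(sgn_dir s * (\<epsilon> / k)) *\<^sub>R w e = (sgn_dir s * (\<epsilon> / k)) *\<^sub>R (sgn_dir s * k) *\<^sub>R v"
    by (subst k) (rule refl)
  also have "\<dots> = \<epsilon> *\<^sub>R v" using k0 by (cases s) auto
  finally show ?thesis unfolding k_def .
qed

text \<open>Here \<open>t0\<close> is the parameter at which the line carrying \<open>e\<close>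
  meets \<open>x\<close>; it need not lie on the edge. So edges that start or stop elsewhere on the
  line are covered.\<close>

lemma germs_in_shift_iff:
  assumes "e \<in> arcs G" "w e \<noteq> 0" "dir e s = v" "c e + t0 *\<^sub>R w e = x"
  defines "t \<equiv> \<lambda>\<epsilon>. t0 + sgn_dir s * (\<epsilon> / real (lat_length (w e)))"
  shows "(e, s) \<in> germs_in (x + \<epsilon> *\<^sub>R v) v \<longleftrightarrow>
    0 \<le> t \<epsilon> \<and> ereal (t \<epsilon>) \<le> len G e \<and> continues e s (t \<epsilon>)"
proof -
  have "c e + t \<epsilon> *\<^sub>R w e = x + \<epsilon> *\<^sub>R v"
    using shift_along_edge[OF assms(1-3)] assms(4) unfolding t_def
    by (simp add: scaleR_add_left add.assoc[symmetric])
  then have "runs_through e t' (x + \<epsilon> *\<^sub>R v) \<longleftrightarrow> t' = t \<epsilon> \<and> 0 \<le> t \<epsilon> \<and> ereal (t \<epsilon>) \<le> len G e" for t'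
    using assms(1,2) unfolding runs_through_def by (metis add_left_cancel scaleR_cancel_right)
  then show ?thesis using assms(2,3) unfolding germs_in_def germs_def by auto
qed

lemma germs_in_line:
  assumes "(e, s) \<in> germs_in (x + \<epsilon> *\<^sub>R v) v"
  shows "e \<in> arcs G" "w e \<noteq> 0" "dir e s = v" "\<exists>t0. c e + t0 *\<^sub>R w e = x"
proof -
  obtain t where t: "e \<in> arcs G" "w e \<noteq> 0" "dir e s = v" "c e + t *\<^sub>R w e = x + \<epsilon> *\<^sub>R v"
    using assms unfolding germs_in_def germs_def runs_through_def by auto
  have "c e + (t - sgn_dir s * (\<epsilon> / real (lat_length (w e)))) *\<^sub>R w e = x"
    unfolding scaleR_diff_left shift_along_edge[OF t(1-3)] using t(4) by (metis add_diff_cancel_right' add_diff_eq)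
  then show "e \<in> arcs G" "w e \<noteq> 0" "dir e s = v" "\<exists>t0. c e + t0 *\<^sub>R w e = x" using t by blast+
qed

text \<open>There are finitely many half-edges, so it is enough that each one is eventually decided.
  One whose line misses \<open>x\<close> or has another direction belongs to neither set.\<close>

lemma eventually_germs_in:
  assumes "\<And>e s t0. e \<in> arcs G \<Longrightarrow> w e \<noteq> 0 \<Longrightarrow> dir e s = v \<Longrightarrow> c e + t0 *\<^sub>R w e = x \<Longrightarrow>
      \<forall>\<^sub>F \<epsilon> in F. (e, s) \<in> germs_in (x + \<epsilon> *\<^sub>R v) v \<longleftrightarrow> (e, s) \<in> B"
    and "B \<subseteq> {(e, s). e \<in> arcs G \<and> w e \<noteq> 0 \<and> dir e s = v \<and> (\<exists>t0. c e + t0 *\<^sub>R w e = x)}"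
  shows "\<forall>\<^sub>F \<epsilon> in F. germs_in (x + \<epsilon> *\<^sub>R v) v = B"
proof -
  have "\<forall>\<^sub>F \<epsilon> in F. p \<in> germs_in (x + \<epsilon> *\<^sub>R v) v \<longleftrightarrow> p \<in> B" for p
  proof -
    obtain e s where p: "p = (e, s)" by (cases p)
    show ?thesis
    proof (cases "e \<in> arcs G \<and> w e \<noteq> 0 \<and> dir e s = v \<and> (\<exists>t0. c e + t0 *\<^sub>R w e = x)")
      case True
      then show ?thesis using assms(1) p by blast
    next
      case False
      then have "p \<notin> germs_in (x + \<epsilon> *\<^sub>R v) v" for \<epsilon>
        using germs_in_line[of e s] p by blast
      moreover have "p \<notin> B" using False assms(2) p by blast
      ultimately show ?thesis by simp
    qed
  qed
  then have "\<forall>\<^sub>F \<epsilon> in F. \<forall>p\<in>arcs G \<times> UNIV. p \<in> germs_in (x + \<epsilon> *\<^sub>R v) v \<longleftrightarrow> p \<in> B"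
    using finite_arcs by (intro eventually_ball_finite) auto
  then show ?thesis
  proof (rule eventually_mono)
    fix \<epsilon> assume *: "\<forall>p\<in>arcs G \<times> UNIV. p \<in> germs_in (x + \<epsilon> *\<^sub>R v) v \<longleftrightarrow> p \<in> B"
    have "germs_in (x + \<epsilon> *\<^sub>R v) v \<subseteq> arcs G \<times> UNIV" "B \<subseteq> arcs G \<times> UNIV"
      using germs_in_subset germs_subset assms(2) by blast+
    then show "germs_in (x + \<epsilon> *\<^sub>R v) v = B" using * by blast
  qed
qed

text \<open>Holds at nodes too: the half-edges leaving \<open>x\<close> along \<open>v\<close> are
  exactly those still present a little further on. Data at a node can thus be read off at a nearby
  point of an edge.\<close>

lemma germs_in_right: "\<forall>\<^sub>F \<epsilon> in at_right 0. germs_in (x + \<epsilon> *\<^sub>R v) v = germs_in x v"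
proof (rule eventually_germs_in)
  fix e s t0 assume *: "e \<in> arcs G" "w e \<noteq> 0" "dir e s = v" "c e + t0 *\<^sub>R w e = x"
  define k where "k = real (lat_length (w e))"
  have k: "0 < k" using w_eq_dir(2)[OF *(1,2)] unfolding k_def by simp
  have in_iff: "(e, s) \<in> germs_in (x + \<epsilon> *\<^sub>R v) v \<longleftrightarrow>
    (if s then 0 \<le> t0 + \<epsilon> / k \<and> ereal (t0 + \<epsilon> / k) < len G e
     else 0 < t0 - \<epsilon> / k \<and> ereal (t0 - \<epsilon> / k) \<le> len G e)" for \<epsilon>
    unfolding germs_in_shift_iff[OF *] k_def continues_def by auto
  obtain b where b: "0 < b" "\<And>u. 0 < u \<Longrightarrow> u < b \<Longrightarrow>
    (if s then 0 \<le> t0 + u \<and> ereal (t0 + u) < len G e else 0 < t0 - u \<and> ereal (t0 - u) \<le> len G e) \<longleftrightarrow>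
    (if s then 0 \<le> t0 \<and> ereal t0 < len G e else 0 < t0 \<and> ereal t0 \<le> len G e)"
    using interval_shift_right[of t0 "len G e"] interval_shift_left[of t0 "len G e"]
    by (cases s) auto
  show "\<forall>\<^sub>F \<epsilon> in at_right 0. (e, s) \<in> germs_in (x + \<epsilon> *\<^sub>R v) v \<longleftrightarrow> (e, s) \<in> germs_in x v"
    unfolding eventually_at_right_field
  proof (intro exI[of _ "b * k"] conjI allI impI)
    show "0 < b * k" using b(1) k by simp
    fix \<epsilon> assume \<epsilon>: "0 < \<epsilon>" "\<epsilon> < b * k"
    have "0 < \<epsilon> / k" "\<epsilon> / k < b" using \<epsilon> k by (auto simp: field_simps)
    then show "(e, s) \<in> germs_in (x + \<epsilon> *\<^sub>R v) v \<longleftrightarrow> (e, s) \<in> germs_in x v"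
      using b(2)[of "\<epsilon> / k"] in_iff[of \<epsilon>] in_iff[of 0] by auto
  qed
next
  show "germs_in x v \<subseteq> {(e, s). e \<in> arcs G \<and> w e \<noteq> 0 \<and> dir e s = v \<and> (\<exists>t0. c e + t0 *\<^sub>R w e = x)}"
    using germs_in_line[of _ _ x 0 v] by auto
qed

definition ends_along :: "'n tp \<Rightarrow> 'n tp \<Rightarrow> 'e set" where
  "ends_along q v = {e \<in> arcs G. len G e = \<infinity> \<and> w e \<noteq> 0 \<and> prim_dir (w e) = v \<and>
     (\<exists>t0. c e + t0 *\<^sub>R w e = q)}"

text \<open>Far out along \<open>v\<close> the edges of finite length are exhausted, and an infinite
  edge running against \<open>v\<close> has been left behind at its tail. Only infinite edges
  pointing along \<open>v\<close> remain.\<close>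

lemma germs_in_far:
  "\<forall>\<^sub>F T in at_top. germs_in (q + T *\<^sub>R v) v = ends_along q v \<times> {True}"
proof (rule eventually_germs_in)
  fix e s t0 assume *: "e \<in> arcs G" "w e \<noteq> 0" "dir e s = v" "c e + t0 *\<^sub>R w e = q"
  define k where "k = real (lat_length (w e))"
  have k: "0 < k" using w_eq_dir(2)[OF *(1,2)] unfolding k_def by simp
  have in_iff: "(e, s) \<in> germs_in (q + \<epsilon> *\<^sub>R v) v \<longleftrightarrow>
    (if s then 0 \<le> t0 + \<epsilon> / k \<and> ereal (t0 + \<epsilon> / k) < len G e
     else 0 < t0 - \<epsilon> / k \<and> ereal (t0 - \<epsilon> / k) \<le> len G e)" for \<epsilon>
    unfolding germs_in_shift_iff[OF *] k_def continues_def by auto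
  have ends_iff: "(e, s) \<in> ends_along q v \<times> {True} \<longleftrightarrow> s \<and> len G e = \<infinity>"
    using * unfolding ends_along_def dir_def by auto
  show "\<forall>\<^sub>F \<epsilon> in at_top. (e, s) \<in> germs_in (q + \<epsilon> *\<^sub>R v) v \<longleftrightarrow> (e, s) \<in> ends_along q v \<times> {True}"
    unfolding eventually_at_top_linorder ends_iff
  \<comment> \<open>After division by \<open>k\<close> the bound is at least the distance of
    \<open>t0\<close> from 0 plus a finite length, which is beyond every change of the criterion
    \<open>in_iff\<close>.\<close>
  proof (intro exI[of _ "(\<bar>t0\<bar> + (if len G e = \<infinity> then 0 else real_of_ereal (len G e))) * k"] allI impI)
    fix \<epsilon> assume "\<epsilon> \<ge> (\<bar>t0\<bar> + (if len G e = \<infinity> then 0 else real_of_ereal (len G e))) * k"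
    then have "\<epsilon> / k \<ge> \<bar>t0\<bar> + (if len G e = \<infinity> then 0 else real_of_ereal (len G e))"
      using k by (simp add: field_simps)
    then show "(e, s) \<in> germs_in (q + \<epsilon> *\<^sub>R v) v \<longleftrightarrow> s \<and> len G e = \<infinity>"
      unfolding in_iff using len_pos[OF *(1)] by (cases "len G e") auto
  qed
qed (auto simp: ends_along_def dir_def)

lemma finite_node_parameters:
  assumes "v \<noteq> 0"
  shows "finite {t. x + t *\<^sub>R v \<in> nodes}"
  using assms by (intro finite_vimageI[OF finite_nodes, of "\<lambda>t. x + t *\<^sub>R v", unfolded vimage_def])
    (auto intro!: injI)

lemma eventually_not_node:
  assumes "v \<noteq> 0"
  shows "\<forall>\<^sub>F t in at a within S. x + t *\<^sub>R v \<notin> nodes"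
  using eventually_not_in_finite[OF finite_node_parameters[OF assms]] by simp

text \<open>To the left of \<open>x\<close> this is \<open>germs_in_right\<close> for
  \<open>- v\<close>: off the nodes the half-edges along \<open>- v\<close> are those along
  \<open>v\<close> reversed.\<close>

lemma germs_in_punctured:
  assumes "x \<notin> nodes" "v \<noteq> 0"
  shows "\<forall>\<^sub>F \<epsilon> in at 0. germs_in (x + \<epsilon> *\<^sub>R v) v = germs_in x v"
proof -
  have "\<forall>\<^sub>F \<epsilon> in at_right 0. germs_in (x + (- \<epsilon>) *\<^sub>R v) v = germs_in x v"
    using eventually_conj[OF germs_in_right[of x "- v"] eventually_not_node[of "- v" x 0 "{0<..}"]]
  proof (rule eventually_mono)
    show "- v \<noteq> 0" using assms(2) by simp
  next
    fix \<epsilon> assume *: "germs_in (x + \<epsilon> *\<^sub>R - v) (- v) = germs_in x (- v) \<and>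
      x + \<epsilon> *\<^sub>R - v \<notin> nodes"
    then have "germs_in (x + \<epsilon> *\<^sub>R - v) (- (- v)) = germs_in x (- (- v))"
      using germs_in_uminus assms(1) by metis
    then show "germs_in (x + (- \<epsilon>) *\<^sub>R v) v = germs_in x v" by simp
  qed
  then have "\<forall>\<^sub>F \<epsilon> in at_left 0. germs_in (x + \<epsilon> *\<^sub>R v) v = germs_in x v"
    unfolding eventually_at_left_to_right by simp
  then show ?thesis using germs_in_right[of x v] by (simp add: eventually_at_split)
qed

text \<open>Local constancy at each parameter (\<open>germs_in_punctured\<close>) spreads by
  connectedness of the interval.\<close>

lemma germs_in_const:
  assumes "v \<noteq> 0" "\<And>t. a < t \<Longrightarrow> t < b \<Longrightarrow> q + t *\<^sub>R v \<notin> nodes"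
    and "a < t1" "t1 < b" "a < t2" "t2 < b"
  shows "germs_in (q + t1 *\<^sub>R v) v = germs_in (q + t2 *\<^sub>R v) v"
proof (rule connected_local_const[of "{a<..<b}"])
  show "\<forall>t\<in>{a<..<b}. \<forall>\<^sub>F t' in at t within {a<..<b}.
    germs_in (q + t *\<^sub>R v) v = germs_in (q + t' *\<^sub>R v) v"
  proof
    fix t assume "t \<in> {a<..<b}"
    then have "\<forall>\<^sub>F \<epsilon> in at 0. germs_in (q + t *\<^sub>R v + \<epsilon> *\<^sub>R v) v = germs_in (q + t *\<^sub>R v) v"
      using germs_in_punctured assms(1,2) by auto
    then have "\<forall>\<^sub>F \<epsilon> in at 0. germs_in (q + t *\<^sub>R v) v = germs_in (q + (\<epsilon> + t) *\<^sub>R v) v"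
      by (rule eventually_mono) (simp add: scaleR_add_left add.commute add.left_commute)
    then have "\<forall>\<^sub>F t' in at t. germs_in (q + t *\<^sub>R v) v = germs_in (q + t' *\<^sub>R v) v"
      by (simp add: eventually_at_to_0[where a = t])
    then show "\<forall>\<^sub>F t' in at t within {a<..<b}. germs_in (q + t *\<^sub>R v) v = germs_in (q + t' *\<^sub>R v) v"
      by (rule filter_leD[OF at_le, rotated]) simp
  qed
qed (use assms in \<open>auto simp: connected_Ioo\<close>)


subsection \<open>The polyhedral structure on the image\<close>

text \<open>The strict bound \<open>s < t\<close> still admits the parameter of the nearest node
  beyond \<open>z\<close>, so edges are closed. With no node ahead this is a half-line.\<close>

definition reach :: "'n tp \<Rightarrow> 'n tp \<Rightarrow> real set" where
  "reach z v = {t. 0 \<le> t \<and> (\<forall>s. 0 < s \<and> s < t \<longrightarrow> z + s *\<^sub>R v \<notin> nodes)}"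

definition edge_from :: "'n tp \<Rightarrow> 'n tp \<Rightarrow> 'n tp set" where
  "edge_from z v = (\<lambda>t. z + t *\<^sub>R v) ` reach z v"

definition graph_edges :: "'n tp set set" where
  "graph_edges = {edge_from z v | z v. z \<in> nodes \<and> germs_in z v \<noteq> {}}"

definition cells :: "'n tp set set" where
  "cells = (\<lambda>z. {z}) ` nodes \<union> graph_edges"

text \<open>Describes an edge from one of its interior points, hence independently of the end from which
  it is traversed.\<close>

definition star :: "'n tp \<Rightarrow> 'n tp \<Rightarrow> 'n tp set" where
  "star x v = {x + t *\<^sub>R v | t. \<forall>s. (0 < s \<and> s < t) \<or> (t < s \<and> s < 0) \<longrightarrow> x + s *\<^sub>R v \<notin> nodes}"

lemma is_interval_reach: "is_interval (reach z v)"
  unfolding is_interval_1 reach_def by auto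

lemma closed_reach: "closed (reach z v)"
proof -
  have "reach z v = {0..} \<inter> (\<Inter>s\<in>{s. 0 < s \<and> z + s *\<^sub>R v \<in> nodes}. {..s})"
    unfolding reach_def by (force simp: not_le)
  then show ?thesis by auto
qed

lemma zero_in_reach: "0 \<in> reach z v"
  unfolding reach_def by auto

lemma reach_pos:
  assumes "v \<noteq> 0"
  shows "\<exists>\<tau>>0. \<tau> \<in> reach z v"
  using eventually_not_node[OF assms, of z 0 "{0<..}"]
  unfolding eventually_at_right_field reach_def by (auto intro: less_imp_le)

lemma reach_extend:
  assumes "v \<noteq> 0" "z \<in> nodes" "t \<in> reach z v" "z + t *\<^sub>R v \<notin> nodes"
  shows "0 < t" "\<exists>t'>t. t' \<in> reach z v"
proof -
  show t: "0 < t" using assms(2-4) unfolding reach_def by (cases "t = 0") auto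
  obtain b where b: "t < b" "\<And>y. t < y \<Longrightarrow> y < b \<Longrightarrow> z + y *\<^sub>R v \<notin> nodes"
    using eventually_not_node[OF assms(1), of z t "{t<..}"] unfolding eventually_at_right_field by auto
  have "z + s *\<^sub>R v \<notin> nodes" if "0 < s" "s < b" for s
    using that assms(3,4) b(2)[of s] unfolding reach_def by (cases s t rule: linorder_cases) auto
  then show "\<exists>t'>t. t' \<in> reach z v" using b(1) t unfolding reach_def by (intro exI[of _ b]) auto
qed

text \<open>Close to \<open>z\<close> this is \<open>germs_in_right\<close>, further on
  \<open>germs_in_const\<close>; the two are joined at a small positive parameter.\<close>

lemma germs_edge:
  assumes "v \<noteq> 0" "z \<in> nodes" "t \<in> reach z v" "z + t *\<^sub>R v \<notin> nodes"
  shows "germs_in (z + t *\<^sub>R v) v = germs_in z v"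
proof -
  obtain t' where t': "t < t'" "t' \<in> reach z v" using reach_extend(2)[OF assms] by blast
  obtain b where b: "0 < b" "\<And>\<epsilon>. 0 < \<epsilon> \<Longrightarrow> \<epsilon> < b \<Longrightarrow> germs_in (z + \<epsilon> *\<^sub>R v) v = germs_in z v"
    using germs_in_right[of z v] unfolding eventually_at_right_field by auto
  define \<epsilon> where "\<epsilon> = min b t' / 2"
  have t: "0 < t" using reach_extend(1)[OF assms] .
  have \<epsilon>: "0 < \<epsilon>" "\<epsilon> < b" "\<epsilon> < t'" using b(1) t t'(1) unfolding \<epsilon>_def by auto
  have "germs_in (z + t *\<^sub>R v) v = germs_in (z + \<epsilon> *\<^sub>R v) v"
    by (rule germs_in_const[OF assms(1), of 0 t'])
      (use t t' \<epsilon> in \<open>auto simp: reach_def\<close>)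
  then show ?thesis using b(2) \<epsilon> by simp
qed

lemma star_uminus: "star x (- v) = star x v"
proof -
  have "star x (- v) \<subseteq> star x v" for v
  proof
    fix y assume "y \<in> star x (- v)"
    then obtain t where t: "y = x + t *\<^sub>R - v"
      "\<And>s. (0 < s \<and> s < t) \<or> (t < s \<and> s < 0) \<Longrightarrow> x + s *\<^sub>R - v \<notin> nodes"
      unfolding star_def by blast
    have "x + s *\<^sub>R v \<notin> nodes" if "(0 < s \<and> s < - t) \<or> (- t < s \<and> s < 0)" for s
      using t(2)[of "- s"] that by auto
    then show "y \<in> star x v" unfolding star_def using t(1) by (auto intro!: exI[of _ "- t"])
  qed
  from this[of v] this[of "- v"] show ?thesis by auto
qed

lemma edge_eq_star:
  assumes "z \<in> nodes" "t0 \<in> reach z v" "z + t0 *\<^sub>R v \<notin> nodes"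
  shows "edge_from z v = star (z + t0 *\<^sub>R v) v"
proof -
  have eq: "z + t0 *\<^sub>R v + s *\<^sub>R v = z + (t0 + s) *\<^sub>R v" for s
    by (simp add: scaleR_add_left add.assoc)
  have "t \<in> reach z v \<longleftrightarrow>
    (\<forall>s. (0 < s \<and> s < t - t0) \<or> (t - t0 < s \<and> s < 0) \<longrightarrow> z + (t0 + s) *\<^sub>R v \<notin> nodes)" for t
  proof
    assume t: "t \<in> reach z v"
    show "\<forall>s. (0 < s \<and> s < t - t0) \<or> (t - t0 < s \<and> s < 0) \<longrightarrow> z + (t0 + s) *\<^sub>R v \<notin> nodes"
    proof (intro allI impI)
      fix s assume "(0 < s \<and> s < t - t0) \<or> (t - t0 < s \<and> s < 0)"
      then have "0 < t0 + s \<and> (t0 + s < t \<or> t0 + s < t0)" using t assms(2) unfolding reach_def by auto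
      then show "z + (t0 + s) *\<^sub>R v \<notin> nodes" using t assms(2) unfolding reach_def by blast
    qed
  next
    assume *: "\<forall>s. (0 < s \<and> s < t - t0) \<or> (t - t0 < s \<and> s < 0) \<longrightarrow> z + (t0 + s) *\<^sub>R v \<notin> nodes"
    have **: "z + s *\<^sub>R v \<notin> nodes" if "(t0 < s \<and> s < t) \<or> (t < s \<and> s < t0)" for s
      using *[rule_format, of "s - t0"] that by auto
    have "t0 \<noteq> 0" using assms(1,3) by auto
    then have "0 < t0" using assms(2) unfolding reach_def by auto
    \<comment> \<open>For negative \<open>t\<close> the node \<open>z\<close>, at parameter 0, would
      lie strictly between \<open>t\<close> and \<open>t0\<close>.\<close>
    then have "0 \<le> t" using **[of 0] assms(1) by (auto simp: not_less[symmetric])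
    moreover have "z + s *\<^sub>R v \<notin> nodes" if "0 < s" "s < t" for s
      using that assms(2,3) **[of s] unfolding reach_def by (cases s t0 rule: linorder_cases) auto
    ultimately show "t \<in> reach z v" unfolding reach_def by auto
  qed
  note reach_iff = this
  show ?thesis
  proof (intro equalityI subsetI)
    fix y assume "y \<in> edge_from z v"
    then obtain t where t: "y = z + t *\<^sub>R v" "t \<in> reach z v" unfolding edge_from_def by blast
    then have "y = z + t0 *\<^sub>R v + (t - t0) *\<^sub>R v" unfolding eq by simp
    then show "y \<in> star (z + t0 *\<^sub>R v) v" unfolding star_def eq
      using t(2)[unfolded reach_iff] by blast
  next
    fix y assume "y \<in> star (z + t0 *\<^sub>R v) v"
    then obtain t where t: "y = z + (t0 + t) *\<^sub>R v"
      "\<forall>s. (0 < s \<and> s < t) \<or> (t < s \<and> s < 0) \<longrightarrow> z + (t0 + s) *\<^sub>R v \<notin> nodes"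
      unfolding star_def eq by blast
    then show "y \<in> edge_from z v" unfolding edge_from_def using reach_iff[of "t0 + t"] by auto
  qed
qed

lemma graph_edgesE:
  assumes "C \<in> graph_edges"
  obtains z v where "z \<in> nodes" "germs_in z v \<noteq> {}" "C = edge_from z v" "primitive v" "v \<noteq> 0"
  using assms germs_in_primitive primitive_not_0 unfolding graph_edges_def by blast

lemma edge_from_germs:
  assumes "z \<in> nodes" "germs_in z u \<noteq> {}" "x \<in> edge_from z u" "x \<notin> nodes"
  shows "germs_in x u = germs_in z u" "edge_from z u = star x u"
proof -
  have u: "u \<noteq> 0" using germs_in_primitive primitive_not_0 assms(2) by blast
  obtain t where t: "t \<in> reach z u" "x = z + t *\<^sub>R u" using assms(3) unfolding edge_from_def by blast
  show "germs_in x u = germs_in z u" "edge_from z u = star x u"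
    using germs_edge[OF u assms(1) t(1)] edge_eq_star[OF assms(1) t(1)] assms(4) t(2) by auto
qed

lemma graph_edge_eq_star:
  assumes "C \<in> graph_edges" "x \<in> C" "x \<notin> nodes" "germs_in x v \<noteq> {}"
  shows "C = star x v"
  using assms(1)
proof (cases rule: graph_edgesE)
  case (1 z u)
  have "x \<in> edge_from z u" using assms(2) 1(3) by simp
  note * = edge_from_germs[OF 1(1,2) this assms(3)]
  have "germs_in x u \<noteq> {}" using 1(2) unfolding *(1) .
  then have "u = v \<or> u = - v" using germs_in_unique[OF assms(3,4)] by blast
  then show ?thesis using *(2) 1(3) star_uminus by auto
qed

lemma graph_edge_unique:
  assumes "C \<in> graph_edges" "C' \<in> graph_edges" "x \<in> C" "x \<in> C'" "x \<notin> nodes"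
  shows "C = C'"
  using assms(1)
proof (cases rule: graph_edgesE)
  case (1 z u)
  have "x \<in> edge_from z u" using assms(3) 1(3) by simp
  note * = edge_from_germs[OF 1(1,2) this assms(5)]
  have "germs_in x u \<noteq> {}" using 1(2) unfolding *(1) .
  then show ?thesis using graph_edge_eq_star assms by blast
qed

lemma rational_graph_edge:
  assumes "C \<in> graph_edges"
  shows "rational_edge C"
  using assms
proof (cases rule: graph_edgesE)
  case (1 z u)
  obtain \<tau> where "0 < \<tau>" "\<tau> \<in> reach z u" using reach_pos 1(5) by blast
  then show ?thesis
    unfolding rational_edge_def 1(3) edge_from_def
    using 1(4) is_interval_reach closed_reach zero_in_reach by blast
qed

lemma vertex_image_of_tail:
  assumes "e \<in> arcs G"
  shows "c e \<in> vertex_images"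
proof (rule ccontr)
  assume "c e \<notin> vertex_images"
  moreover have "runs_through e 0 (c e)"
    using assms len_pos unfolding runs_through_def by (auto simp: zero_ereal_def[symmetric] less_imp_le)
  ultimately show False using runs_through_interior(1) by blast
qed

text \<open>Going backwards along an edge through \<open>x\<close> meets a node, at the latest the
  image of its tail. The nearest such node is where the sought cell starts.\<close>

lemma edge_through:
  assumes "x \<notin> nodes" "germs_in x v \<noteq> {}"
  shows "\<exists>C\<in>graph_edges. x \<in> C"
proof -
  obtain e s where es: "(e, s) \<in> germs x" "dir e s = v"
    using assms(2) unfolding germs_in_def by blast
  then obtain t where t: "runs_through e t x" "w e \<noteq> 0" unfolding germs_def by blast
  have e: "e \<in> arcs G" using t(1) unfolding runs_through_def by blast
  define u where "u = dir e True"
  have "(e, True) \<in> germs_in x u"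
    using germs_flip[OF assms(1), of e] t(1) unfolding u_def germs_in_def by auto
  then have u: "germs_in x u \<noteq> {}" "u \<noteq> 0"
    using germs_in_primitive primitive_not_0 by blast+
  define \<Theta> where "\<Theta> = {\<tau>. 0 < \<tau> \<and> x - \<tau> *\<^sub>R u \<in> nodes}"
  have "finite \<Theta>"
    by (rule rev_finite_subset[OF finite_node_parameters[of "- u" x]]) (use u(2) in \<open>auto simp: \<Theta>_def\<close>)
  have "0 < t" using runs_through_interior(1)[OF t(1)] assms(1) unfolding nodes_def by blast
  moreover have "x - (t * lat_length (w e)) *\<^sub>R u = c e"
    using t(1) w_eq_dir(1)[OF e t(2), of True] unfolding runs_through_def u_def
    by (metis add_diff_cancel_right' mult_1 scaleR_scaleR sgn_dir_simps(1))
  ultimately have "t * lat_length (w e) \<in> \<Theta>"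
    using vertex_image_of_tail[OF e] w_eq_dir(2)[OF e t(2)] unfolding \<Theta>_def nodes_def by auto
  with \<open>finite \<Theta>\<close> have Min: "Min \<Theta> \<in> \<Theta>" "\<And>\<tau>. \<tau> \<in> \<Theta> \<Longrightarrow> Min \<Theta> \<le> \<tau>"
    by (auto intro: Min_in)
  define z where "z = x - Min \<Theta> *\<^sub>R u"
  have z: "z \<in> nodes" "0 < Min \<Theta>" "z + Min \<Theta> *\<^sub>R u = x" using Min(1) unfolding \<Theta>_def z_def by auto
  have "Min \<Theta> \<in> reach z u" unfolding reach_def
  proof (intro CollectI conjI allI impI)
    fix s assume s: "0 < s \<and> s < Min \<Theta>"
    have "z + s *\<^sub>R u = x - (Min \<Theta> - s) *\<^sub>R u" unfolding z_def by (simp add: scaleR_diff_left)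
    then show "z + s *\<^sub>R u \<notin> nodes" using Min(2)[of "Min \<Theta> - s"] s unfolding \<Theta>_def by auto
  qed (use z in auto)
  then have "germs_in z u = germs_in x u" "x \<in> edge_from z u"
    using germs_edge[OF u(2) z(1)] z(3) assms(1) unfolding edge_from_def by auto
  then show ?thesis using u(1) z(1) unfolding graph_edges_def by blast
qed

lemma Union_cells: "\<Union>cells = h ` finite_points G"
proof (intro equalityI subsetI)
  fix x assume x: "x \<in> h ` finite_points G"
  show "x \<in> \<Union>cells"
  proof (cases "x \<in> nodes")
    case True
    then show ?thesis unfolding cells_def by blast
  next
    case False
    then obtain e t where "runs_through e t x" using x unfolding image_eq nodes_def by blast
    then have "(e, True) \<in> germs_in x (dir e True)"
      using germs_flip[OF False] unfolding germs_in_def by auto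
    then show ?thesis using edge_through[OF False] unfolding cells_def by blast
  qed
next
  fix x assume x: "x \<in> \<Union>cells"
  show "x \<in> h ` finite_points G"
  proof (cases "x \<in> nodes")
    case True
    then show ?thesis using nodes_subset by blast
  next
    case False
    then obtain C where C: "C \<in> graph_edges" "x \<in> C" using x unfolding cells_def by blast
    from C(1) obtain u where "germs_in x u \<noteq> {}"
      by (cases rule: graph_edgesE) (use edge_from_germs False C(2) in metis)
    then show ?thesis unfolding image_eq germs_in_def germs_def by blast
  qed
qed

lemma finite_cells: "finite cells"
proof -
  have "graph_edges \<subseteq> (\<lambda>(z, (e, s)). edge_from z (dir e s)) ` (nodes \<times> (arcs G \<times> UNIV))"
  proof
    fix C assume "C \<in> graph_edges"
    then obtain z v where z: "z \<in> nodes" "germs_in z v \<noteq> {}" "C = edge_from z v"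
      by (cases rule: graph_edgesE)
    then obtain e s where "(e, s) \<in> germs z" "dir e s = v" unfolding germs_in_def by blast
    then show "C \<in> (\<lambda>(z, (e, s)). edge_from z (dir e s)) ` (nodes \<times> (arcs G \<times> UNIV))"
      using z germs_subset by (intro image_eqI[of _ _ "(z, (e, s))"]) auto
  qed
  moreover have "finite \<dots>" using finite_nodes finite_arcs by simp
  ultimately show ?thesis unfolding cells_def using finite_nodes finite_subset by blast
qed

text \<open>A point strictly between two points of the edge has a positive parameter smaller than
  one in \<open>reach\<close>. Nodes therefore occur only at the ends of an edge.\<close>

lemma graph_edge_between:
  assumes "C \<in> graph_edges" "a \<in> C" "b \<in> C" "x \<in> open_segment a b"
  shows "x \<notin> nodes"
  using assms(1)
proof (cases rule: graph_edgesE)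
  case (1 z u)
  obtain s t where st: "a = z + s *\<^sub>R u" "s \<in> reach z u" "b = z + t *\<^sub>R u" "t \<in> reach z u"
    using assms(2,3) 1(3) unfolding edge_from_def by blast
  obtain r where r: "0 < r" "r < 1" "x = (1 - r) *\<^sub>R a + r *\<^sub>R b" "a \<noteq> b"
    using assms(4) by (auto simp: in_segment)
  define p where "p = (1 - r) * s + r * t"
  have x: "x = z + p *\<^sub>R u" unfolding r(3) st p_def by (simp add: algebra_simps)
  have "s \<noteq> t" using r(4) st by auto
  have d: "p - s = r * (t - s)" "p - t = (1 - r) * (s - t)" unfolding p_def by (simp_all add: algebra_simps)
  have "0 < p \<and> p < max s t"
  proof (cases "s < t")
    case True
    then have "0 < p - s" "p - t < 0" using r(1,2) unfolding d by (auto simp: mult_pos_neg)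
    then show ?thesis using st unfolding reach_def by auto
  next
    case False
    then have "0 < p - t" "p - s < 0" using r(1,2) \<open>s \<noteq> t\<close> unfolding d by (auto simp: mult_pos_neg)
    then show ?thesis using st unfolding reach_def by auto
  qed
  then show ?thesis unfolding x using st(2,4) unfolding reach_def by (auto simp: less_max_iff_disj)
qed

end


section \<open>Edges as convex sets, and multiplicities at smooth points\<close>

lemma uminus_eq_self_iff:
  fixes v :: "'a::real_vector"
  shows "- v = v \<longleftrightarrow> v = 0"
  using scaleR_cancel_right[of "- 1" v 1] by simp

lemma on_line_open_segment:
  fixes v :: "'a::real_vector"
  assumes "v \<noteq> 0" "s < r" "r < t"
  shows "p + r *\<^sub>R v \<in> open_segment (p + s *\<^sub>R v) (p + t *\<^sub>R v)"
proof -
  define u where "u = (r - s) / (t - s)"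
  have "u * (t - s) = r - s" using assms(2,3) unfolding u_def by simp
  then have "(1 - u) * s + u * t = r" by (simp add: algebra_simps)
  moreover have "0 < u" "u < 1" using assms(2,3) unfolding u_def by auto
  ultimately have u: "0 < u" "u < 1" "(1 - u) * s + u * t = r" by blast+
  have "p + r *\<^sub>R v = (1 - u) *\<^sub>R (p + s *\<^sub>R v) + u *\<^sub>R (p + t *\<^sub>R v)"
    unfolding u(3)[symmetric] by (simp add: algebra_simps)
  moreover have "p + s *\<^sub>R v \<noteq> p + t *\<^sub>R v" using assms by simp
  ultimately show ?thesis using u(1,2) unfolding in_segment by blast
qed

lemma on_line_open_segment':
  fixes v :: "'a::real_vector"
  assumes "v \<noteq> 0" "(s < r \<and> r < t) \<or> (t < r \<and> r < s)"
  shows "p + r *\<^sub>R v \<in> open_segment (p + s *\<^sub>R v) (p + t *\<^sub>R v)"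
  using on_line_open_segment[OF assms(1), of s r t p] on_line_open_segment[OF assms(1), of t r s p]
    assms(2) open_segment_commute by blast

lemma convex_rational_edge:
  assumes "rational_edge C"
  shows "convex C"
proof -
  obtain p v I where I: "is_interval (I::real set)" "C = (\<lambda>t. p + t *\<^sub>R v) ` I"
    using assms unfolding rational_edge_def by blast
  show ?thesis
  proof (rule convexI)
    fix x y a b assume *: "x \<in> C" "y \<in> C" "0 \<le> (a::real)" "0 \<le> b" "a + b = 1"
    then obtain s t where st: "s \<in> I" "x = p + s *\<^sub>R v" "t \<in> I" "y = p + t *\<^sub>R v"
      unfolding I(2) by blast
    have "a *\<^sub>R x + b *\<^sub>R y = (a + b) *\<^sub>R p + (a * s + b * t) *\<^sub>R v"
      unfolding st by (simp add: algebra_simps)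
    moreover have "a * s + b * t \<in> I"
      using convexD[OF _ st(1,3) *(3-5)] I(1) by (simp add: is_interval_convex_1)
    ultimately show "a *\<^sub>R x + b *\<^sub>R y \<in> C" unfolding I(2) using *(5) by (intro image_eqI) auto
  qed
qed

lemma rational_edge_not_singleton:
  assumes "rational_edge C"
  shows "C \<noteq> {x}"
proof -
  obtain p v and I :: "real set" and a b where
    "primitive v" "a \<in> I" "b \<in> I" "a < b" "C = (\<lambda>t. p + t *\<^sub>R v) ` I"
    using assms unfolding rational_edge_def by blast
  then have "p + a *\<^sub>R v \<in> C" "p + b *\<^sub>R v \<in> C" "p + a *\<^sub>R v \<noteq> p + b *\<^sub>R v"
    using primitive_not_0 by auto
  then show ?thesis by (metis singletonD)
qed

text \<open>\<open>point_mult\<close> is a definite description, so uniqueness is the issue: the two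
  slopes at the point are \<open>real m *\<^sub>R v\<close> and its negative, and either has lattice
  length \<open>m\<close>.\<close>

lemma point_mult_eq:
  assumes "smooth_at G h (Inner e t) m v" "e \<in> arcs G" "0 < t" "ereal t < len G e"
  shows "point_mult G h (Inner e t) = m"
  unfolding point_mult_def
proof (rule the_equality)
  show "\<exists>v. smooth_at G h (Inner e t) m v" using assms(1) by blast
  fix m' assume "\<exists>v. smooth_at G h (Inner e t) m' v"
  then obtain v' where s': "smooth_at G h (Inner e t) m' v'" by blast
  obtain d d' where d: "directions G (Inner e t) = {d, d'}" "has_slope G h d (real m *\<^sub>R v)"
    "has_slope G h d' (- (real m *\<^sub>R v))" "0 < m" "primitive v"
    using assms(1) unfolding smooth_at_def by blast
  obtain c c' where c: "directions G (Inner e t) = {c, c'}" "has_slope G h c (real m' *\<^sub>R v')"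
    "has_slope G h c' (- (real m' *\<^sub>R v'))" "0 < m'" "primitive v'"
    using s' unfolding smooth_at_def by blast
  have uniq: "w = w'" if "has_slope G h a w" "has_slope G h a w'" "a \<in> directions G (Inner e t)" for a w w'
  proof -
    have "a = (e, ereal t, True) \<or> a = (e, ereal t, False)"
      using that(3) directions_Inner[OF assms(2-4)] by simp
    then show ?thesis
    proof
      assume a: "a = (e, ereal t, True)"
      show ?thesis by (rule has_slope_unique[OF that(1,2)[unfolded a]]) simp
    next
      assume a: "a = (e, ereal t, False)"
      show ?thesis by (rule has_slope_unique[OF that(1,2)[unfolded a]]) (use assms(3) in simp)
    qed
  qed
  have c_in: "c \<in> directions G (Inner e t)" unfolding c(1) by simp
  then have "c = d \<or> c = d'" unfolding d(1) by simp
  then have "real m' *\<^sub>R v' = real m *\<^sub>R v \<or> real m' *\<^sub>R v' = real m *\<^sub>R (- v)"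
  proof
    assume "c = d"
    then show ?thesis using uniq[OF c(2) _ c_in] d(2) by blast
  next
    assume "c = d'"
    then have "real m' *\<^sub>R v' = - (real m *\<^sub>R v)" using uniq[OF c(2) _ c_in] d(3) by blast
    then show ?thesis by simp
  qed
  moreover have "m' = m" if "real m' *\<^sub>R v' = real m *\<^sub>R u" "primitive u" for u
  proof -
    have "real m' *\<^sub>R v' \<in> int_vectors"
      using c(5) integral_scale_nat primitive_integral by blast
    then have "real (lat_length (real m' *\<^sub>R v')) = real m'"
      "real (lat_length (real m' *\<^sub>R v')) = real m"
      using prim_dir_eqI(2)[OF _ c(5) refl] prim_dir_eqI(2)[OF _ that(2,1)] c(4) d(4) by auto
    then show ?thesis by simp
  qed
  ultimately show "m' = m" using d(5) primitive_uminus by blast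
qed

section \<open>Faces, intersections and multiplicities of the cells\<close>

context linear_curve
begin

lemma convex_graph_edge: "C \<in> graph_edges \<Longrightarrow> convex C"
  using convex_rational_edge rational_graph_edge by blast

lemma graph_edge_extend:
  assumes "C \<in> graph_edges" "x \<in> C" "x \<notin> nodes" "y \<in> C" "y \<noteq> x"
  shows "\<exists>y'\<in>C. x \<in> open_segment y y'"
  using assms(1)
proof (cases rule: graph_edgesE)
  case (1 z u)
  obtain s t where st: "y = z + s *\<^sub>R u" "s \<in> reach z u" "x = z + t *\<^sub>R u" "t \<in> reach z u"
    using assms(2,4) 1(3) unfolding edge_from_def by blast
  obtain t' where t': "0 < t" "t < t'" "t' \<in> reach z u"
    using reach_extend[OF 1(5,1) st(4)] assms(3) st(3) by blast
  have "s \<noteq> t" using assms(5) st by auto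
  then have "(s < t \<and> t < t') \<or> (0 < t \<and> t < s)" using t' by auto
  then show ?thesis
  proof
    assume "s < t \<and> t < t'"
    then have "x \<in> open_segment y (z + t' *\<^sub>R u)"
      unfolding st using on_line_open_segment'[OF 1(5)] by blast
    then show ?thesis using t'(3) unfolding 1(3) edge_from_def by blast
  next
    assume "0 < t \<and> t < s"
    then have "x \<in> open_segment y (z + 0 *\<^sub>R u)"
      unfolding st using on_line_open_segment'[OF 1(5)] by blast
    then show ?thesis using zero_in_reach unfolding 1(3) edge_from_def by blast
  qed
qed

text \<open>The midpoint of two distinct nodes in \<open>A\<close> would be a node strictly inside
  the edge.\<close>

lemma convex_nodes_in_edge:
  assumes "C \<in> graph_edges" "A \<subseteq> C" "convex A" "A \<subseteq> nodes" "A \<noteq> {}"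
  obtains z where "z \<in> nodes" "A = {z}"
proof -
  obtain z where z: "z \<in> A" using assms(5) by blast
  have "y = z" if y: "y \<in> A" for y
  proof (rule ccontr)
    assume ne: "y \<noteq> z"
    define x where "x = (1 / 2) *\<^sub>R y + (1 / 2) *\<^sub>R z"
    have "x \<in> A" unfolding x_def using convexD[OF assms(3) y z] by simp
    moreover have "x \<in> open_segment y z"
      unfolding in_segment x_def using ne by (auto intro!: exI[of _ "1/2"])
    then have "x \<notin> nodes" using graph_edge_between assms(1,2) y z by blast
    ultimately show False using assms(4) by blast
  qed
  then have "A = {z}" using z by blast
  then show ?thesis using that assms(4) by blast
qed

lemma node_face_of_edge:
  assumes "C \<in> graph_edges" "z \<in> nodes" "z \<in> C"
  shows "{z} face_of C"
  unfolding face_of_def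
proof (intro conjI ballI impI)
  fix a b x assume *: "a \<in> C" "b \<in> C" "x \<in> {z}" "x \<in> open_segment a b"
  then have False using graph_edge_between[OF assms(1) *(1,2,4)] assms(2) by blast
  then show "a \<in> {z}" "b \<in> {z}" by blast+
qed (use assms in auto)

text \<open>By \<open>graph_edge_extend\<close>, \<open>x\<close> lies strictly between any other
  point of the edge and a further one; a face containing \<open>x\<close> contains both.\<close>

lemma face_of_graph_edge:
  assumes "C \<in> graph_edges" "A face_of C" "x \<in> A" "x \<notin> nodes"
  shows "A = C"
proof
  show "A \<subseteq> C" using assms(2) face_of_imp_subset by blast
  show "C \<subseteq> A"
  proof
    fix y assume y: "y \<in> C"
    show "y \<in> A"
    proof (cases "y = x")
      case False
      then obtain y' where "y' \<in> C" "x \<in> open_segment y y'"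
        using graph_edge_extend[OF assms(1) _ assms(4) y] assms(2,3) face_of_imp_subset by blast
      then show ?thesis using face_ofD[OF assms(2)] y assms(3) by blast
    qed (use assms(3) in simp)
  qed
qed

text \<open>Edges that share a point off the nodes coincide. Otherwise the intersection is a convex
  set of nodes, so it is empty or a single end.\<close>

lemma graph_edges_Int:
  assumes "C \<in> graph_edges" "C' \<in> graph_edges"
  shows "(C \<inter> C') face_of C"
proof (cases "C \<inter> C' \<subseteq> nodes")
  case False
  then have "C \<inter> C' = C" using graph_edge_unique[OF assms] by blast
  then show ?thesis using face_of_refl[OF convex_graph_edge[OF assms(1)]] by simp
next
  case True
  show ?thesis
  proof (cases "C \<inter> C' = {}")
    case False
    obtain z where "z \<in> nodes" "C \<inter> C' = {z}"
      using convex_nodes_in_edge[OF assms(1) _ _ True False] convex_graph_edge assms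
      by (metis Int_lower1 convex_Int)
    then show ?thesis using node_face_of_edge[OF assms(1)] by auto
  qed simp
qed

lemma edges_cells: "edges cells = graph_edges"
  unfolding edges_def cells_def using rational_graph_edge rational_edge_not_singleton by blast

lemma rational_complex_cells: "rational_complex cells"
  unfolding rational_complex_def
proof (intro conjI ballI allI impI)
  show "finite cells" by (rule finite_cells)
next
  fix C assume "C \<in> cells"
  then show "(\<exists>p. C = {p}) \<or> rational_edge C"
    unfolding cells_def using rational_graph_edge by blast
next
  fix C A assume *: "C \<in> cells" "A face_of C \<and> A \<noteq> {}"
  then have A: "A \<subseteq> C" "convex A" "A \<noteq> {}" using face_of_imp_subset face_of_imp_convex by auto
  from *(1) consider z where "z \<in> nodes" "C = {z}" | "C \<in> graph_edges" unfolding cells_def by blast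
  then show "A \<in> cells"
  proof cases
    case 1
    then have "A = C" using A by blast
    then show ?thesis using *(1) by simp
  next
    case 2
    show ?thesis
    proof (cases "A \<subseteq> nodes")
      case True
      then show ?thesis using convex_nodes_in_edge[OF 2 A(1,2) True A(3)] unfolding cells_def by blast
    next
      case False
      then have "A = C" using face_of_graph_edge[OF 2] *(2) by blast
      then show ?thesis using *(1) by simp
    qed
  qed
next
  have *: "(C \<inter> C') face_of C" if C: "C \<in> cells" and C': "C' \<in> cells" for C C'
  proof -
    from C consider z where "z \<in> nodes" "C = {z}" | "C \<in> graph_edges" unfolding cells_def by blast
    then show ?thesis
    proof cases
      case 1
      then have "C \<inter> C' = {} \<or> C \<inter> C' = {z}" by blast
      then show ?thesis using 1(2) face_of_refl[of "{z}"] by (elim disjE) simp_all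
    next
      case 2
      from C' consider z where "z \<in> nodes" "C' = {z}" | "C' \<in> graph_edges" unfolding cells_def by blast
      then show ?thesis
      proof cases
        case 1
        then have "C \<inter> C' = {} \<or> (C \<inter> C' = {z} \<and> z \<in> C)" by blast
        then show ?thesis using node_face_of_edge[OF 2 1(1)] by auto
      qed (use graph_edges_Int[OF 2] in blast)
    qed
  qed
  fix C C' assume "C \<in> cells" "C' \<in> cells"
  then show "(C \<inter> C') face_of C" "(C \<inter> C') face_of C'" using *[of C C'] *[of C' C] by (auto simp: Int_commute)
qed

text \<open>Each edge through \<open>x\<close> contributes one inner point to the fibre and, since
  exactly one of its two directions is \<open>v\<close>, one element of \<open>germs_in x v\<close>.
  The multiplicity of that point is the lattice length of the slope.\<close>

lemma generic_fiber:
  assumes "x \<notin> nodes" "germs_in x v \<noteq> {}"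
  shows "finite (fiber G h x)" "\<forall>y\<in>fiber G h x. \<exists>m u. smooth_at G h y m u"
    "(\<Sum>y\<in>fiber G h x. point_mult G h y) = weight x v"
proof -
  define \<tau> where "\<tau> e = (THE t. runs_through e t x)" for e
  have through: "w e \<noteq> 0" "\<tau> e = t" "0 < t" "ereal t < len G e" "e \<in> arcs G" if "runs_through e t x" for e t
  proof -
    note * = runs_through_interior[OF that] assms(1)
    show "w e \<noteq> 0" "0 < t" "ereal t < len G e" "e \<in> arcs G"
      using * that unfolding nodes_def runs_through_def by auto
    then show "\<tau> e = t" unfolding \<tau>_def using that runs_through_unique by blast
  qed
  have fiber: "fiber G h x = (\<lambda>(e, s). Inner e (\<tau> e)) ` germs_in x v" (is "_ = ?R")
  proof (intro equalityI subsetI)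
    fix y assume "y \<in> fiber G h x"
    then have y: "y \<in> finite_points G" "h y = x" unfolding fiber_def by auto
    from y(1) show "y \<in> ?R"
    proof (cases rule: finite_pointsE)
      case (1 u)
      then have "x \<in> vertex_images" using y unfolding vertex_images_def by blast
      then show ?thesis using assms(1) unfolding nodes_def by blast
    next
      case (2 e t)
      then have r: "runs_through e t x"
        using linear[of e t] y less_imp_neq[OF 2(4)] unfolding runs_through_def
        by (simp add: pt_def zero_ereal_def less_imp_le)
      obtain e' s' where e': "(e', s') \<in> germs x" "dir e' s' = v"
        using assms(2) unfolding germs_in_def by blast
      have in_germs: "(e, s) \<in> germs x" for s using germs_flip[OF assms(1)] r by blast
      have "dir e True = v \<or> dir e True = - v"
        using germs_dir_unique[OF assms(1) e'(1) in_germs[of True]] e'(2) by blast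
      then have "dir e True = v \<or> dir e False = v" unfolding dir_def by auto
      then obtain s where "(e, s) \<in> germs_in x v" using in_germs unfolding germs_in_def by blast
      then show ?thesis using 2(1) through(2)[OF r] by (intro image_eqI[of _ _ "(e, s)"]) auto
    qed
  next
    fix y assume "y \<in> ?R"
    then obtain e s where "(e, s) \<in> germs x" "y = Inner e (\<tau> e)" unfolding germs_in_def by auto
    then obtain t where t: "runs_through e t x" "y = Inner e t"
      using through(2) unfolding germs_def by blast
    have pt: "pt G e (ereal t) = y" using through(3,4)[OF t(1)] t(2) by (auto simp: pt_def)
    show "y \<in> fiber G h x"
      using t(1) pt_finite[of e t] linear[of e t] unfolding fiber_def runs_through_def pt by auto
  qed
  have smooth: "smooth_at G h (Inner e (\<tau> e)) (lat_length (w e)) (prim_dir (w e))"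
    "point_mult G h (Inner e (\<tau> e)) = lat_length (w e)"
    if "(e, s) \<in> germs_in x v" for e s
  proof -
    obtain t where t: "runs_through e t x" using \<open>(e, s) \<in> germs_in x v\<close>
      unfolding germs_in_def germs_def by blast
    note * = through[OF t]
    have slopes: "has_slope G h (e, ereal t, True) (w e)" "has_slope G h (e, ereal t, False) (- w e)"
      using linear_slope(1)[OF linear, of e "ereal t" True] linear_slope(1)[OF linear, of e "ereal t" False]
        directions_Inner[OF *(5,3,4)] *(5) by auto
    have *: "\<tau> e = t" "directions G (Inner e t) = {(e, ereal t, True), (e, ereal t, False)}"
      using * directions_Inner[OF *(5,3,4)] by auto
    show 1: "smooth_at G h (Inner e (\<tau> e)) (lat_length (w e)) (prim_dir (w e))"
      unfolding smooth_at_def *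
      using prim_dir_lat_length[OF w_integral[OF through(5)[OF t]] through(1)[OF t]] slopes
      by (intro conjI exI[of _ "(e, ereal t, True)"] exI[of _ "(e, ereal t, False)"]) simp_all
    show "point_mult G h (Inner e (\<tau> e)) = lat_length (w e)"
      using point_mult_eq[OF 1] through[OF t] by auto
  qed
  show "finite (fiber G h x)" unfolding fiber using finite_germs_in by simp
  show "\<forall>y\<in>fiber G h x. \<exists>m u. smooth_at G h y m u" unfolding fiber using smooth(1) by auto
  have "inj_on (\<lambda>(e, s). Inner e (\<tau> e)) (germs_in x v)"
  proof (rule inj_onI)
    fix p q assume *: "p \<in> germs_in x v" "q \<in> germs_in x v"
      "(case p of (e, s) \<Rightarrow> Inner e (\<tau> e)) = (case q of (e, s) \<Rightarrow> Inner e (\<tau> e))"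
    obtain e s s' where p: "p = (e, s)" "q = (e, s')" using *(3) by (cases p; cases q) auto
    have "e \<in> arcs G" "w e \<noteq> 0" "dir e s = v" "dir e s' = v"
      using *(1,2) p unfolding germs_in_def germs_def runs_through_def by auto
    then have "s = s'" using w_eq_dir(4)[of e True] unfolding dir_def
      by (cases s; cases s') (auto simp: uminus_eq_self_iff dest: sym)
    then show "p = q" using p by simp
  qed
  then show "(\<Sum>y\<in>fiber G h x. point_mult G h y) = weight x v"
    unfolding fiber weight_def by (subst sum.reindex) (auto intro!: sum.cong simp: smooth(2))
qed

text \<open>The sample point is arbitrary: along an edge the weight, and with it the sum over the
  fibre, is constant off the nodes (\<open>mult_eq\<close>).\<close>

definition mult :: "'n tp set \<Rightarrow> nat" where
  "mult C = (\<Sum>y\<in>fiber G h (SOME p. p \<in> C - nodes). point_mult G h y)"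

lemma graph_edge_germs:
  assumes "C \<in> graph_edges"
  obtains v k where "primitive v" "0 < k" "\<And>p. p \<in> C \<Longrightarrow> p \<notin> nodes \<Longrightarrow> germs_in p v \<noteq> {} \<and> weight p v = k"
  using assms
proof (cases rule: graph_edgesE)
  case (1 z u)
  show ?thesis
  proof (rule that[OF 1(4) germs_in_pos[OF 1(2)]])
    fix p assume "p \<in> C" "p \<notin> nodes"
    then have "germs_in p u = germs_in z u" using edge_from_germs(1)[OF 1(1,2)] 1(3) by blast
    then show "germs_in p u \<noteq> {} \<and> weight p u = weight z u" using 1(2) unfolding weight_def by simp
  qed
qed

lemma graph_edge_not_nodes:
  assumes "C \<in> graph_edges"
  shows "\<exists>p. p \<in> C - nodes"
proof (rule ccontr)
  assume "\<nexists>p. p \<in> C - nodes"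
  moreover have "C \<noteq> {}" using rational_graph_edge[OF assms] unfolding rational_edge_def by blast
  ultimately obtain z where "C = {z}"
    using convex_nodes_in_edge[OF assms _ convex_graph_edge[OF assms]] by blast
  then show False using rational_edge_not_singleton rational_graph_edge[OF assms] by blast
qed

lemma mult_eq:
  assumes "C \<in> graph_edges" "p \<in> C" "p \<notin> nodes"
  shows "mult C = (\<Sum>y\<in>fiber G h p. point_mult G h y)" "0 < mult C"
    "germs_in p v \<noteq> {} \<Longrightarrow> mult C = weight p v"
proof -
  obtain u k where u: "primitive u" "0 < k"
    "\<And>p. p \<in> C \<Longrightarrow> p \<notin> nodes \<Longrightarrow> germs_in p u \<noteq> {} \<and> weight p u = k"
    using graph_edge_germs[OF assms(1)] by metis
  have sum: "(\<Sum>y\<in>fiber G h p. point_mult G h y) = k" if "p \<in> C" "p \<notin> nodes" for p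
    using generic_fiber(3)[of p u] u(3)[OF that] that(2) by auto
  have mult: "mult C = k" unfolding mult_def
    by (rule sum) (use someI_ex[OF graph_edge_not_nodes[OF assms(1)]] in auto)
  then show "mult C = (\<Sum>y\<in>fiber G h p. point_mult G h y)" "0 < mult C"
    using mult sum assms(2,3) u(2) by auto
  show "mult C = weight p v" if "germs_in p v \<noteq> {}"
    using generic_fiber(3)[OF assms(3) that] mult sum assms(2,3) by simp
qed

text \<open>A little beyond \<open>x\<close> the edge consists of points off the nodes, where its
  multiplicity is the weight in direction \<open>v\<close>; \<open>germs_in_right\<close> transports
  this back to \<open>x\<close>, which may itself be a node.\<close>

lemma edge_direction_germs:
  assumes "(C, v) \<in> edge_directions cells x"
  shows "C \<in> graph_edges" "germs_in x v \<noteq> {}" "mult C = weight x v"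
    "\<forall>\<^sub>F t in at_right 0. x + t *\<^sub>R v \<in> C \<and> x + t *\<^sub>R v \<notin> nodes"
proof -
  obtain \<epsilon> where C: "C \<in> graph_edges" "primitive v" "0 < \<epsilon>" "\<And>t. t \<in> {0..\<epsilon>} \<Longrightarrow> x + t *\<^sub>R v \<in> C"
    using assms unfolding edge_directions_def edges_cells by blast
  have v: "v \<noteq> 0" using primitive_not_0 C(2) by blast
  have "\<forall>\<^sub>F t in at_right 0. t \<in> {0<..<\<epsilon>}" using C(3) by (rule eventually_at_right_real)
  then have "\<forall>\<^sub>F t in at_right 0. x + t *\<^sub>R v \<in> C"
    by (rule eventually_mono) (use C(4) in auto)
  then show ev: "\<forall>\<^sub>F t in at_right 0. x + t *\<^sub>R v \<in> C \<and> x + t *\<^sub>R v \<notin> nodes"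
    using eventually_not_node[OF v, of x 0 "{0<..}"] by (rule eventually_conj)
  then have "\<forall>\<^sub>F t in at_right 0. 0 < t \<and> x + t *\<^sub>R v \<in> C \<and> x + t *\<^sub>R v \<notin> nodes \<and>
    germs_in (x + t *\<^sub>R v) v = germs_in x v"
    using germs_in_right[of x v] eventually_at_right_less[of "0::real"] by eventually_elim blast
  then obtain t where t: "0 < t" "x + t *\<^sub>R v \<in> C" "x + t *\<^sub>R v \<notin> nodes"
    "germs_in (x + t *\<^sub>R v) v = germs_in x v"
    using eventually_happens[of _ "at_right (0::real)"] by (auto simp: trivial_limit_at_right_real)
  have along: "germs_in (x + t *\<^sub>R v) v \<noteq> {}"
    using C(1)
  proof (cases rule: graph_edgesE)
    case (1 z u)
    have "x \<in> C" using C(4)[of 0] C(3) by simp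
    \<comment> \<open>Both \<open>x\<close> and the nearby point lie on the line of the edge, so the
      primitive vectors \<open>v\<close> and \<open>u\<close> agree up to sign.\<close>
    then obtain a b where ab: "x = z + a *\<^sub>R u" "x + t *\<^sub>R v = z + b *\<^sub>R u"
      using t(2) unfolding 1(3) edge_from_def by blast
    have "t *\<^sub>R v = (b - a) *\<^sub>R u" using ab by (metis add_diff_cancel_left' add_diff_cancel_left scaleR_diff_left)
    then have "v = ((b - a) / t) *\<^sub>R u" using t(1)
      by (metis divide_inverse less_irrefl mult.commute left_inverse scaleR_one scaleR_scaleR)
    then have "v = u \<or> v = - u" using primitive_unique[OF 1(4) C(2)] by blast
    moreover have "germs_in (x + t *\<^sub>R v) u \<noteq> {}"
      using edge_from_germs(1)[OF 1(1,2)] t(2,3) 1(2,3) by simp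
    ultimately show ?thesis using germs_in_uminus[OF t(3), of u] by auto
  qed
  then show "germs_in x v \<noteq> {}" using t(4) by simp
  show "mult C = weight x v" using mult_eq(3)[OF C(1) t(2,3) along] t(4) unfolding weight_def by simp
  show "C \<in> graph_edges" by (rule C(1))
qed

text \<open>Two edges leaving \<open>x\<close> along the same \<open>v\<close> share points off the
  nodes and hence coincide. Conversely, a half-edge at a node starts a cell there; off the nodes it
  lies in a cell that extends to both sides of \<open>x\<close>.\<close>

lemma snd_edge_directions:
  "bij_betw snd (edge_directions cells x) {v. germs_in x v \<noteq> {}}"
  unfolding bij_betw_def
proof (intro conjI equalityI subsetI)
  show "inj_on snd (edge_directions cells x)"
  proof (rule inj_onI)
    fix p q assume *: "p \<in> edge_directions cells x" "q \<in> edge_directions cells x" "snd p = snd q"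
    then obtain C C' v where p: "p = (C, v)" "q = (C', v)" by (cases p; cases q) auto
    note dC = edge_direction_germs(1,4)[OF *(1)[unfolded p]]
    note dC' = edge_direction_germs(1,4)[OF *(2)[unfolded p]]
    obtain t where "x + t *\<^sub>R v \<in> C \<and> x + t *\<^sub>R v \<notin> nodes" "x + t *\<^sub>R v \<in> C' \<and> x + t *\<^sub>R v \<notin> nodes"
      using eventually_happens[OF eventually_conj[OF dC(2) dC'(2)]]
      by (auto simp: trivial_limit_at_right_real)
    then show "p = q" using p graph_edge_unique[OF dC(1) dC'(1)] by blast
  qed
  show "v \<in> {v. germs_in x v \<noteq> {}}" if "v \<in> snd ` edge_directions cells x" for v
    using that edge_direction_germs(2) by fastforce
next
  fix v assume "v \<in> {v. germs_in x v \<noteq> {}}"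
  then have v: "germs_in x v \<noteq> {}" "primitive v" "v \<noteq> 0"
    using germs_in_primitive primitive_not_0 by blast+
  have "\<exists>C\<in>graph_edges. \<exists>\<epsilon>>0. \<forall>t\<in>{0..\<epsilon>}. x + t *\<^sub>R v \<in> C"
  proof (cases "x \<in> nodes")
    case True
    obtain \<tau> where \<tau>: "0 < \<tau>" "\<tau> \<in> reach x v" using reach_pos[OF v(3)] by blast
    have "\<forall>t\<in>{0..\<tau>}. x + t *\<^sub>R v \<in> edge_from x v"
      using \<tau>(2) unfolding edge_from_def reach_def by auto
    then show ?thesis using \<tau>(1) True v(1) unfolding graph_edges_def by blast
  next
    case False
    obtain C where C: "C \<in> graph_edges" "x \<in> C" using edge_through[OF False v(1)] by blast
    have star: "C = star x v" by (rule graph_edge_eq_star[OF C False v(1)])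
    obtain b where b: "0 < b" "\<And>t. 0 < t \<Longrightarrow> t < b \<Longrightarrow> x + t *\<^sub>R v \<notin> nodes"
      using eventually_not_node[OF v(3), of x 0 "{0<..}"] unfolding eventually_at_right_field by auto
    have "x + t *\<^sub>R v \<in> C" if "t \<in> {0..b}" for t
      unfolding star star_def using that b(2) by auto
    then show ?thesis using b(1) C(1) by blast
  qed
  then obtain C where "(C, v) \<in> edge_directions cells x"
    using v(2) unfolding edge_directions_def edges_cells by blast
  then show "v \<in> snd ` edge_directions cells x" by force
qed

text \<open>Edges leaving \<open>x\<close> correspond to directions of half-edges at
  \<open>x\<close>, with multiplicity equal to weight, so balancing is
  \<open>weight_balanced\<close>.\<close>

theorem image_tropical_curve_cells: "image_tropical_curve G h cells mult"
  unfolding image_tropical_curve_def embedded_tropical_curve_def edges_cells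
proof (intro conjI ballI impI)
  show "rational_complex cells" by (rule rational_complex_cells)
  show "\<Union>cells = h ` finite_points G" by (rule Union_cells)
  show "0 < mult C" if "C \<in> graph_edges" for C
    using mult_eq(2)[OF that] graph_edge_not_nodes[OF that] by blast
  fix x
  have "(\<Sum>(C, v)\<in>edge_directions cells x. real (mult C) *\<^sub>R v) =
    (\<Sum>p\<in>edge_directions cells x. real (weight x (snd p)) *\<^sub>R snd p)"
    by (rule sum.cong[OF refl]) (auto simp: edge_direction_germs(3))
  also have "\<dots> = (\<Sum>v | germs_in x v \<noteq> {}. real (weight x v) *\<^sub>R v)"
    by (rule sum.reindex_bij_betw[OF snd_edge_directions])
  finally show "(\<Sum>(C, v)\<in>edge_directions cells x. real (mult C) *\<^sub>R v) = 0"
    using weight_balanced by simp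
next
  fix C p assume *: "C \<in> graph_edges" "p \<in> C" "{p} \<notin> cells \<and> finite (fiber G h p) \<and>
    (\<forall>y\<in>fiber G h p. \<exists>m' v. smooth_at G h y m' v)"
  then have "p \<notin> nodes" unfolding cells_def by blast
  then show "mult C = (\<Sum>y\<in>fiber G h p. point_mult G h y)" using mult_eq(1) *(1,2) by blast
qed

end


subsection \<open>The degree in terms of unbounded edges\<close>

lemma convex_on_line:
  fixes v :: "'a::real_vector"
  assumes "convex C" "p + s *\<^sub>R v \<in> C" "p + t *\<^sub>R v \<in> C" "s \<le> r" "r \<le> t" "v \<noteq> 0"
  shows "p + r *\<^sub>R v \<in> C"
proof (cases "r = s \<or> r = t")
  case False
  then have "p + r *\<^sub>R v \<in> open_segment (p + s *\<^sub>R v) (p + t *\<^sub>R v)"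
    using assms(4-6) by (intro on_line_open_segment) auto
  then show ?thesis using assms(1-3) convex_contains_open_segment by blast
qed (use assms in auto)

lemma rational_edge_on_line:
  assumes "rational_edge E" "p + s *\<^sub>R w \<in> E" "p + t *\<^sub>R w \<in> E" "s \<noteq> t" "w \<noteq> 0" "z \<in> E"
  shows "\<exists>r. z = p + r *\<^sub>R w"
proof -
  obtain q u and I :: "real set" where E: "E = (\<lambda>t. q + t *\<^sub>R u) ` I"
    using assms(1) unfolding rational_edge_def by blast
  obtain a b d where abd: "p + s *\<^sub>R w = q + a *\<^sub>R u" "p + t *\<^sub>R w = q + b *\<^sub>R u" "z = q + d *\<^sub>R u"
    using assms(2,3,6) unfolding E by blast
  have tw: "(t - s) *\<^sub>R w = (b - a) *\<^sub>R u"
  proof -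
    have "(p + t *\<^sub>R w) - (p + s *\<^sub>R w) = (q + b *\<^sub>R u) - (q + a *\<^sub>R u)" unfolding abd ..
    then show ?thesis by (simp add: scaleR_diff_left)
  qed
  then have "b - a \<noteq> 0" using assms(4,5) by force
  then have "u = inverse (b - a) *\<^sub>R (b - a) *\<^sub>R u" by simp
  then have u: "u = ((t - s) / (b - a)) *\<^sub>R w" unfolding tw[symmetric] by (simp add: divide_inverse mult.commute)
  have "z - (p + s *\<^sub>R w) = (d - a) *\<^sub>R u" unfolding abd by (simp add: scaleR_diff_left)
  then have "z = p + s *\<^sub>R w + (d - a) *\<^sub>R u" by (simp add: algebra_simps)
  also have "\<dots> = p + (s + (d - a) * ((t - s) / (b - a))) *\<^sub>R w"
    by (subst u) (simp add: scaleR_add_left add.assoc)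
  finally show ?thesis by blast
qed

lemma eventually_at_top_not_in_finite:
  fixes A :: "real set"
  assumes "finite A"
  shows "\<forall>\<^sub>F t in at_top. t \<notin> A"
proof -
  have "\<forall>\<^sub>F t in at_top. \<forall>y\<in>A. t \<noteq> y"
  proof (intro eventually_ball_finite assms ballI)
    fix y :: real show "\<forall>\<^sub>F t in at_top. t \<noteq> y"
      using eventually_gt_at_top[of y] by (rule eventually_mono) auto
  qed
  then show ?thesis by (rule eventually_mono) auto
qed

context linear_curve
begin

definition ends :: "'e set" where
  "ends = {e \<in> arcs G. len G e = \<infinity> \<and> w e \<noteq> 0}"

text \<open>Only a final part of \<open>e\<close> has to lie in \<open>E\<close>: an arbitrary
  complex may cut the image of \<open>e\<close> anywhere.\<close>

definition ends_in :: "'e \<Rightarrow> 'n tp set \<Rightarrow> bool" where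
  "ends_in e E \<longleftrightarrow> (\<exists>t0. \<forall>t\<ge>t0. c e + t *\<^sub>R w e \<in> E)"

lemma finite_ends: "finite ends"
  unfolding ends_def using finite_arcs by auto

text \<open>Infinitely many of the points at integral parameters lie in one of the finitely many
  cells of \<open>K\<close>. This cell has two points, so it is an edge, and convexity fills the
  gaps.\<close>

lemma ends_in_exists:
  assumes "rational_complex K" "\<Union>K = h ` finite_points G" "e \<in> ends"
  shows "\<exists>E\<in>edges K. ends_in e E"
proof -
  have e: "e \<in> arcs G" "len G e = \<infinity>" "w e \<noteq> 0" using assms(3) unfolding ends_def by auto
  have "\<exists>C\<in>K. c e + real n *\<^sub>R w e \<in> C" for n
  proof -
    have "runs_through e (real n) (c e + real n *\<^sub>R w e)"
      using e unfolding runs_through_def by auto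
    then show ?thesis using assms(2) unfolding image_eq by blast
  qed
  then obtain f where f: "\<And>n. f n \<in> K" "\<And>n. c e + real n *\<^sub>R w e \<in> f n" by metis
  have "finite (range f)"
    using f(1) assms(1) unfolding rational_complex_def by (meson finite_subset image_subsetI)
  then obtain n0 where n0: "infinite {n. f n = f n0}"
    using pigeonhole_infinite[of "UNIV :: nat set" f] by auto
  define C where "C = f n0"
  have unbounded: "\<exists>n>k. c e + real n *\<^sub>R w e \<in> C" for k :: nat
    using n0 f(2) unfolding C_def infinite_nat_iff_unbounded by force
  obtain n1 where n1: "n0 < n1" "c e + real n1 *\<^sub>R w e \<in> C" using unbounded by blast
  have "C \<noteq> {x}" for x
  proof
    assume "C = {x}"
    then have "c e + real n1 *\<^sub>R w e = c e + real n0 *\<^sub>R w e" using n1(2) f(2)[of n0] unfolding C_def by simp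
    then show False using n1(1) e(3) by simp
  qed
  moreover have "\<forall>C\<in>K. (\<exists>p. C = {p}) \<or> rational_edge C"
    using assms(1) unfolding rational_complex_def by (elim conjE)
  moreover have "C \<in> K" using f(1) unfolding C_def .
  ultimately have C: "C \<in> edges K" unfolding edges_def by blast
  then have "convex C" using convex_rational_edge unfolding edges_def by blast
  have "c e + t *\<^sub>R w e \<in> C" if t: "real n0 \<le> t" for t
  proof -
    obtain n2 where "nat \<lceil>t\<rceil> < n2" "c e + real n2 *\<^sub>R w e \<in> C" using unbounded by blast
    moreover have "c e + real n0 *\<^sub>R w e \<in> C" using f(2) unfolding C_def .
    moreover have "t \<le> real n2" using calculation(1) by linarith
    ultimately show ?thesis using convex_on_line[OF \<open>convex C\<close>] t e(3) by blast
  qed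
  then show ?thesis using C unfolding ends_in_def by blast
qed

text \<open>The intersection is a face of \<open>E\<close>. A point \<open>y\<close> of
  \<open>E\<close> outside the common final part still lies on its line, so a common point lies
  strictly between \<open>y\<close> and another common point, and the face contains
  \<open>y\<close>.\<close>

lemma ends_in_subset:
  assumes "rational_complex K" "e \<in> ends" "E \<in> edges K" "E' \<in> edges K" "ends_in e E" "ends_in e E'"
  shows "E \<subseteq> E'"
proof
  fix y assume y: "y \<in> E"
  have w0: "w e \<noteq> 0" using assms(2) unfolding ends_def by blast
  obtain s s' where "\<And>t. t \<ge> s \<Longrightarrow> c e + t *\<^sub>R w e \<in> E" "\<And>t. t \<ge> s' \<Longrightarrow> c e + t *\<^sub>R w e \<in> E'"
    using assms(5,6) unfolding ends_in_def by blast
  then obtain T where T: "\<And>t. t \<ge> T \<Longrightarrow> c e + t *\<^sub>R w e \<in> E \<inter> E'"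
    by (metis IntI max.bounded_iff)
  have face: "(E \<inter> E') face_of E"
    using assms(1,3,4) unfolding rational_complex_def edges_def by blast
  obtain r where r: "y = c e + r *\<^sub>R w e"
    using rational_edge_on_line[of E "c e" T "w e" "T + 1" y] T[of T] T[of "T + 1"] y w0 assms(3)
    unfolding edges_def by auto
  show "y \<in> E'"
  proof (cases "T \<le> r")
    case True
    then show ?thesis using T r by blast
  next
    case False
    then have "c e + T *\<^sub>R w e \<in> open_segment y (c e + (T + 1) *\<^sub>R w e)"
      unfolding r using on_line_open_segment[OF w0] by simp
    then show ?thesis using face_ofD[OF face _ y] T[of T] T[of "T + 1"] by auto
  qed
qed

lemma ends_along_eq:
  assumes "rational_edge E" "primitive v" "\<And>t. 0 \<le> t \<Longrightarrow> q + t *\<^sub>R v \<in> E"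
  shows "ends_along q v = {e \<in> ends. prim_dir (w e) = v \<and> ends_in e E}"
proof (intro equalityI subsetI)
  fix e assume "e \<in> ends_along q v"
  then obtain t0 where e: "e \<in> ends" "e \<in> arcs G" "prim_dir (w e) = v" "w e \<noteq> 0" "c e + t0 *\<^sub>R w e = q"
    unfolding ends_along_def ends_def by blast
  have w: "w e = real (lat_length (w e)) *\<^sub>R v"
    using prim_dir_lat_length(3)[OF w_integral[OF e(2)] e(4)] e(3) by simp
  have "c e + t *\<^sub>R w e \<in> E" if "t0 \<le> t" for t
  proof -
    have "c e + t *\<^sub>R w e = q + (t - t0) *\<^sub>R w e" unfolding e(5)[symmetric] by (simp add: scaleR_diff_left)
    also have "\<dots> = q + ((t - t0) * real (lat_length (w e))) *\<^sub>R v" by (subst w) simp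
    finally show ?thesis using assms(3) that by simp
  qed
  then show "e \<in> {e \<in> ends. prim_dir (w e) = v \<and> ends_in e E}"
    using e unfolding ends_in_def by blast
next
  fix e assume "e \<in> {e \<in> ends. prim_dir (w e) = v \<and> ends_in e E}"
  then obtain t0 where e: "e \<in> arcs G" "len G e = \<infinity>" "w e \<noteq> 0" "prim_dir (w e) = v" "c e + t0 *\<^sub>R w e \<in> E"
    unfolding ends_def ends_in_def by blast
  define k where "k = real (lat_length (w e))"
  have k: "w e = k *\<^sub>R v" "0 < k"
    using prim_dir_lat_length[OF w_integral[OF e(1)] e(3)] e(4) unfolding k_def by simp_all
  obtain r where r: "c e + t0 *\<^sub>R w e = q + r *\<^sub>R v"
    using rational_edge_on_line[OF assms(1) assms(3)[of 0] assms(3)[of 1] _ _ e(5)] primitive_not_0[OF assms(2)]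
    by auto
  have "(r / k) *\<^sub>R w e = r *\<^sub>R v" unfolding k(1) using k(2) by simp
  then have "c e + (t0 - r / k) *\<^sub>R w e = q"
    unfolding scaleR_diff_left using r by (metis add_diff_cancel_right' add_diff_eq)
  then show "e \<in> ends_along q v" using e unfolding ends_along_def by blast
qed

text \<open>Finitely many edges cover infinitely many points of the ray, so one of them passes
  through two such points and is parallel to \<open>v\<close>.\<close>

lemma unbounded_line_germs:
  assumes "primitive v" "\<And>t. T0 \<le> t \<Longrightarrow> q + t *\<^sub>R v \<in> h ` finite_points G - nodes"
  shows "\<exists>t\<ge>T0. germs_in (q + t *\<^sub>R v) v \<noteq> {}"
proof -
  let ?x = "\<lambda>n::nat. q + (T0 + real n) *\<^sub>R v"
  have "\<exists>e t. runs_through e t (?x n)" for n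
    using assms(2)[of "T0 + real n"] unfolding image_eq nodes_def by auto
  then obtain f g where fg: "\<And>n. runs_through (f n) (g n) (?x n)" by metis
  have "range f \<subseteq> arcs G" using fg unfolding runs_through_def by blast
  then have "finite (range f)" using finite_arcs finite_subset by blast
  then obtain n0 where "infinite {n. f n = f n0}"
    using pigeonhole_infinite[of "UNIV :: nat set" f] by auto
  then obtain n1 where n1: "n0 < n1" "f n1 = f n0" unfolding infinite_nat_iff_unbounded by force
  define e where "e = f n0"
  have r: "runs_through e (g n0) (?x n0)" "runs_through e (g n1) (?x n1)"
    using fg[of n0] fg[of n1] n1(2) unfolding e_def by auto
  have x: "?x n0 \<notin> nodes" using assms(2)[of "T0 + real n0"] by simp
  have e: "e \<in> arcs G" "w e \<noteq> 0"
    using r(1) runs_through_interior(3)[OF r(1)] x unfolding runs_through_def nodes_def by auto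
  have "?x n1 - ?x n0 = (g n1 - g n0) *\<^sub>R w e"
    using r unfolding runs_through_def by (metis add_diff_cancel_left scaleR_diff_left)
  then have "(real n1 - real n0) *\<^sub>R v = (g n1 - g n0) *\<^sub>R w e" by (simp add: scaleR_diff_left[symmetric])
  then have "inverse (real n1 - real n0) *\<^sub>R (real n1 - real n0) *\<^sub>R v =
      inverse (real n1 - real n0) *\<^sub>R (g n1 - g n0) *\<^sub>R w e" by simp
  then have "v = ((g n1 - g n0) / (real n1 - real n0)) *\<^sub>R w e"
    using n1(1) by (simp add: divide_inverse mult.commute)
  also have "\<dots> = ((g n1 - g n0) / (real n1 - real n0) * real (lat_length (w e))) *\<^sub>R dir e True"
    by (subst w_eq_dir(1)[OF e, of True]) simp
  finally have "v = dir e True \<or> v = - dir e True"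
    using primitive_unique[OF w_eq_dir(3)[OF e] assms(1)] by blast
  then have "v = dir e True \<or> v = dir e False" unfolding dir_def by simp
  moreover have "(e, s) \<in> germs (?x n0)" for s using germs_flip[OF x] r(1) by blast
  ultimately have "germs_in (?x n0) v \<noteq> {}" unfolding germs_in_def by blast
  then show ?thesis by (intro exI[of _ "T0 + real n0"]) auto
qed

text \<open>Here \<open>K\<close> and \<open>m\<close> are arbitrary. The multiplicity is evaluated
  on the ray beyond all nodes and all vertices of \<open>K\<close>, so far out that the half-edges
  along \<open>v\<close> are precisely those of the infinite edges in
  \<open>ends_along\<close>.\<close>

lemma ray_mult:
  assumes K: "image_tropical_curve G h K m"
    and ray: "E \<in> edges K" "primitive v" "\<And>t. 0 \<le> t \<Longrightarrow> q + t *\<^sub>R v \<in> E"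
  shows "m E = (\<Sum>e\<in>ends_along q v. lat_length (w e))" "ends_along q v \<noteq> {}"
proof -
  have v: "v \<noteq> 0" using primitive_not_0 ray(2) by blast
  have image: "\<Union>K = h ` finite_points G" and mult: "\<And>p. p \<in> E \<Longrightarrow> {p} \<notin> K \<Longrightarrow> finite (fiber G h p) \<Longrightarrow>
      \<forall>y\<in>fiber G h p. \<exists>m' v. smooth_at G h y m' v \<Longrightarrow> m E = (\<Sum>y\<in>fiber G h p. point_mult G h y)"
    using K ray(1) unfolding image_tropical_curve_def by simp_all
  have "E \<in> K" using ray(1) unfolding edges_def by simp
  have "finite {t. {q + t *\<^sub>R v} \<in> K}"
    using K v unfolding image_tropical_curve_def embedded_tropical_curve_def rational_complex_def
    by (intro finite_vimageI[of K "\<lambda>t. {q + t *\<^sub>R v}", unfolded vimage_def]) (auto intro!: injI)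
  then have "\<forall>\<^sub>F t in at_top. {q + t *\<^sub>R v} \<notin> K"
    using eventually_at_top_not_in_finite by force
  moreover have "\<forall>\<^sub>F t in at_top. q + t *\<^sub>R v \<notin> nodes"
    using eventually_at_top_not_in_finite[OF finite_node_parameters[OF v, of q]] by simp
  ultimately have "\<forall>\<^sub>F t in at_top. 0 \<le> t \<and> {q + t *\<^sub>R v} \<notin> K \<and> q + t *\<^sub>R v \<notin> nodes \<and>
      germs_in (q + t *\<^sub>R v) v = ends_along q v \<times> {True}"
    using germs_in_far[of q v] eventually_ge_at_top[of "0::real"] by eventually_elim blast
  then obtain T0 where T0: "\<And>t. T0 \<le> t \<Longrightarrow> 0 \<le> t \<and> {q + t *\<^sub>R v} \<notin> K \<and> q + t *\<^sub>R v \<notin> nodes \<and>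
      germs_in (q + t *\<^sub>R v) v = ends_along q v \<times> {True}"
    unfolding eventually_at_top_linorder by blast
  have "q + t *\<^sub>R v \<in> h ` finite_points G - nodes" if "T0 \<le> t" for t
    using T0[OF that] ray(3) \<open>E \<in> K\<close> image by blast
  then obtain t where t: "T0 \<le> t" "germs_in (q + t *\<^sub>R v) v \<noteq> {}"
    using unbounded_line_germs[OF ray(2)] by blast
  define p where "p = q + t *\<^sub>R v"
  have p: "p \<in> E" "{p} \<notin> K" "p \<notin> nodes" "germs_in p v = ends_along q v \<times> {True}" "germs_in p v \<noteq> {}"
    using T0[OF t(1)] ray(3) t(2) unfolding p_def by auto
  show "ends_along q v \<noteq> {}" using p(4,5) by auto
  have "m E = (\<Sum>y\<in>fiber G h p. point_mult G h y)"
    by (rule mult[OF p(1,2) generic_fiber(1,2)[OF p(3,5)]])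
  also have "\<dots> = weight p v" by (rule generic_fiber(3)[OF p(3,5)])
  also have "\<dots> = (\<Sum>e\<in>ends_along q v. lat_length (w e))"
    unfolding weight_def p(4) by (rule sum.reindex_bij_witness[of _ "\<lambda>e. (e, True)" fst]) auto
  finally show "m E = (\<Sum>e\<in>ends_along q v. lat_length (w e))" .
qed

text \<open>Every noncontracted infinite edge finally runs in exactly one edge of \<open>K\<close>.
  Grouped by that edge and by direction, these edges yield the rays of \<open>K\<close>, and each
  group sums to the multiplicity times the primitive representative. The right-hand side is the same
  for all \<open>K\<close>.\<close>

theorem sum_rays:
  assumes K: "image_tropical_curve G h K m"
  shows "(\<Sum>(E, v)\<in>rays K. int (m E) *s nonpos_rep v) =
    (\<Sum>e | e \<in> arcs G \<and> len G e = \<infinity>. nonpos_rep (w e))"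
proof -
  have complex: "rational_complex K" and image: "\<Union>K = h ` finite_points G"
    using K unfolding image_tropical_curve_def embedded_tropical_curve_def by auto
  define cell where "cell e = (SOME E. E \<in> edges K \<and> ends_in e E)" for e
  have cell: "cell e \<in> edges K" "ends_in e (cell e)" if "e \<in> ends" for e
    using someI_ex[of "\<lambda>E. E \<in> edges K \<and> ends_in e E"] ends_in_exists[OF complex image that]
    unfolding cell_def by auto
  have cell_eq: "ends_in e E \<longleftrightarrow> cell e = E" if "e \<in> ends" "E \<in> edges K" for e E
    using ends_in_subset[OF complex that(1)] cell[OF that(1)] that(2) by blast
  \<comment> \<open>The direction is recorded with the edge because an edge that is a whole line
    carries two rays.\<close>
  define g where "g e = (cell e, prim_dir (w e))" for e
  have ray: "int (m E) *s nonpos_rep v = (\<Sum>e\<in>{e \<in> ends. g e = (E, v)}. nonpos_rep (w e))"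
    "{e \<in> ends. g e = (E, v)} \<noteq> {}" if Ev: "(E, v) \<in> rays K" for E v
  proof -
    obtain q where q: "E \<in> edges K" "primitive v" "\<And>t. 0 \<le> t \<Longrightarrow> q + t *\<^sub>R v \<in> E"
      using Ev unfolding rays_def by blast
    have set_eq: "{e \<in> ends. g e = (E, v)} = ends_along q v"
      using ends_along_eq[of E v q] q cell_eq unfolding g_def edges_def by auto
    show "{e \<in> ends. g e = (E, v)} \<noteq> {}" unfolding set_eq by (rule ray_mult(2)[OF K q])
    have mE: "int (m E) = (\<Sum>e\<in>ends_along q v. int (lat_length (w e)))"
      by (subst ray_mult(1)[OF K q]) simp_all
    have "int (m E) *s nonpos_rep v = (\<Sum>e\<in>ends_along q v. int (lat_length (w e)) *s nonpos_rep v)"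
      unfolding mE by (simp add: vec_eq_iff sum_distrib_right)
    also have "\<dots> = (\<Sum>e\<in>ends_along q v. nonpos_rep (w e))"
    proof (rule sum.cong[OF refl])
      fix e assume "e \<in> ends_along q v"
      then show "int (lat_length (w e)) *s nonpos_rep v = nonpos_rep (w e)"
        using nonpos_rep_lat_length[of "w e"] w_integral unfolding ends_along_def by simp
    qed
    finally show "int (m E) *s nonpos_rep v = (\<Sum>e\<in>{e \<in> ends. g e = (E, v)}. nonpos_rep (w e))"
      unfolding set_eq .
  qed
  have g_rays: "g e \<in> rays K" if e: "e \<in> ends" for e
  proof -
    have e': "e \<in> arcs G" "w e \<noteq> 0" using e unfolding ends_def by auto
    note pl = prim_dir_lat_length[OF w_integral[OF e'(1)] e'(2)]
    obtain t0 where t0: "\<And>t. t0 \<le> t \<Longrightarrow> c e + t *\<^sub>R w e \<in> cell e"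
      using cell(2)[OF e] unfolding ends_in_def by blast
    have "(c e + t0 *\<^sub>R w e) + t *\<^sub>R prim_dir (w e) \<in> cell e" if "0 \<le> t" for t
    proof -
      have eq: "(c e + t0 *\<^sub>R w e) + t *\<^sub>R prim_dir (w e) =
        c e + (t0 + t / real (lat_length (w e))) *\<^sub>R w e"
      proof -
        have "(t / real (lat_length (w e))) *\<^sub>R w e = t *\<^sub>R prim_dir (w e)"
          by (subst pl(3)[symmetric]) (use pl(2) in simp)
        then show ?thesis by (simp add: scaleR_add_left add.assoc)
      qed
      show ?thesis unfolding eq using that by (intro t0) simp
    qed
    then show ?thesis using cell(1)[OF e] pl(1) unfolding g_def rays_def by blast
  qed
  have "rays K \<subseteq> g ` ends"
  proof
    fix r assume r: "r \<in> rays K"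
    obtain E v where Ev: "r = (E, v)" by (cases r)
    obtain e where "e \<in> ends" "g e = r" using ray(2)[of E v] r unfolding Ev by blast
    then show "r \<in> g ` ends" by blast
  qed
  then have rays: "rays K = g ` ends" using g_rays by blast
  have "(\<Sum>(E, v)\<in>rays K. int (m E) *s nonpos_rep v) =
    (\<Sum>r\<in>g ` ends. \<Sum>e\<in>{e \<in> ends. g e = r}. nonpos_rep (w e))"
    unfolding rays[symmetric] by (rule sum.cong[OF refl]) (auto simp: ray(1))
  also have "\<dots> = (\<Sum>e\<in>ends. nonpos_rep (w e))"
    by (rule sum.group) (auto simp: finite_ends)
  \<comment> \<open>Contracted infinite edges are put back; each contributes
    \<open>nonpos_rep 0\<close>, which is 0.\<close>
  also have "\<dots> = (\<Sum>e | e \<in> arcs G \<and> len G e = \<infinity>. nonpos_rep (w e))"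
    by (rule sum.mono_neutral_left) (auto simp: ends_def finite_arcs nonpos_rep_0)
  finally show ?thesis .
qed

end


section \<open>Piecewise linear functions\<close>

lemma interval_avoiding_right:
  assumes "finite (S::real set)" "ereal t < l"
  shows "\<exists>b>t. ereal b \<le> l \<and> {t<..<b} \<inter> S = {}"
proof -
  obtain b where b: "t < b" "\<And>y. t < y \<Longrightarrow> y < b \<Longrightarrow> y \<notin> S"
    using eventually_not_in_finite[OF assms(1), of t "{t<..}"] unfolding eventually_at_right_field by auto
  obtain b' where b': "t < b'" "ereal b' \<le> l"
    using assms(2) by (cases l) (auto intro: that[of "t + 1"])
  have "ereal (min b b') \<le> l" using b'(2) by (meson ereal_less_eq(3) min.cobounded2 order_trans)
  then show ?thesis using b b'(1) by (intro exI[of _ "min b b'"]) auto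
qed

lemma interval_avoiding_left:
  assumes "finite (S::real set)" "0 < t"
  shows "\<exists>a<t. 0 \<le> a \<and> {a<..<t} \<inter> S = {}"
proof -
  obtain a where a: "a < t" "\<And>y. a < y \<Longrightarrow> y < t \<Longrightarrow> y \<notin> S"
    using eventually_not_in_finite[OF assms(1), of t "{..<t}"] unfolding eventually_at_left_field by auto
  then show ?thesis using assms(2) by (intro exI[of _ "max a 0"]) auto
qed

lemma affine_germ_unique:
  fixes c c' k k' :: "'a::real_vector"
  assumes "\<forall>\<^sub>F s in nhds (t::real). c + s *\<^sub>R k = c' + s *\<^sub>R k'"
  shows "c = c'" "k = k'"
proof -
  obtain \<epsilon> where \<epsilon>: "0 < \<epsilon>" "\<And>s. dist s t < \<epsilon> \<Longrightarrow> c + s *\<^sub>R k = c' + s *\<^sub>R k'"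
    using assms unfolding eventually_nhds_metric by blast
  have 1: "c + t *\<^sub>R k = c' + t *\<^sub>R k'" using \<epsilon> by simp
  have 2: "c + (t + \<epsilon> / 2) *\<^sub>R k = c' + (t + \<epsilon> / 2) *\<^sub>R k'"
    using \<epsilon> by (intro \<epsilon>(2)) (simp add: dist_real_def)
  have "(c + (t + \<epsilon> / 2) *\<^sub>R k) - (c + t *\<^sub>R k) = (c' + (t + \<epsilon> / 2) *\<^sub>R k') - (c' + t *\<^sub>R k')"
    unfolding 1 2 ..
  then have "(\<epsilon> / 2) *\<^sub>R k = (\<epsilon> / 2) *\<^sub>R k'" by (simp add: scaleR_add_left)
  then show "k = k'" using \<epsilon>(1) by simp
  then show "c = c'" using 1 by simp
qed

text \<open>The affine germ of \<open>g\<close> at a point is unique and locally constant on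
  \<open>A\<close>, hence constant because \<open>A\<close> is connected.\<close>

lemma locally_affine_imp_affine:
  fixes g :: "real \<Rightarrow> 'a::real_vector"
  assumes "is_interval A" "\<And>t. t \<in> A \<Longrightarrow> \<exists>c k. \<forall>\<^sub>F s in nhds t. g s = c + s *\<^sub>R k"
  shows "\<exists>c k. \<forall>t\<in>A. g t = c + t *\<^sub>R k"
proof (cases "A = {}")
  case False
  then obtain t0 where t0: "t0 \<in> A" by blast
  define germ where "germ t = (SOME p. \<forall>\<^sub>F s in nhds t. g s = fst p + s *\<^sub>R snd p)" for t
  have germ: "\<forall>\<^sub>F s in nhds t. g s = fst (germ t) + s *\<^sub>R snd (germ t)" if t: "t \<in> A" for t
    unfolding germ_def
  proof (rule someI_ex)
    obtain c k where "\<forall>\<^sub>F s in nhds t. g s = c + s *\<^sub>R k" using assms(2)[OF t] by blast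
    then show "\<exists>p. \<forall>\<^sub>F s in nhds t. g s = fst p + s *\<^sub>R snd p" by (intro exI[of _ "(c, k)"]) simp
  qed
  have germ_const: "germ t = germ t0" if t: "t \<in> A" for t
  proof (rule connected_local_const[OF is_interval_connected_1[THEN iffD1, OF assms(1)] t t0], intro ballI)
    fix a assume a: "a \<in> A"
    have "\<forall>\<^sub>F b in nhds a. \<forall>\<^sub>F s in nhds b. g s = fst (germ a) + s *\<^sub>R snd (germ a)"
      using germ[OF a] unfolding eventually_eventually .
    then have "\<forall>\<^sub>F b in nhds a. b \<in> A \<longrightarrow> germ a = germ b"
    proof (rule eventually_mono, intro impI)
      fix b assume ev: "\<forall>\<^sub>F s in nhds b. g s = fst (germ a) + s *\<^sub>R snd (germ a)" and b: "b \<in> A"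
      have "\<forall>\<^sub>F s in nhds b. fst (germ a) + s *\<^sub>R snd (germ a) = fst (germ b) + s *\<^sub>R snd (germ b)"
        using ev germ[OF b] by eventually_elim simp
      then show "germ a = germ b" using affine_germ_unique by (intro prod_eqI) blast+
    qed
    then show "\<forall>\<^sub>F b in at a within A. germ a = germ b"
      unfolding eventually_at_filter by (rule eventually_mono) blast
  qed
  have "g t = fst (germ t0) + t *\<^sub>R snd (germ t0)" if "t \<in> A" for t
    using eventually_nhds_x_imp_x[OF germ[OF that]] germ_const[OF that] by simp
  then show ?thesis by blast
qed simp

lemma two_point_slope:
  fixes c c' k k' :: "'a::real_vector"
  assumes "c + s *\<^sub>R k = c' + s *\<^sub>R k'" "c + t *\<^sub>R k = c' + t *\<^sub>R k'" "s \<noteq> t"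
  shows "k = k'" "c = c'"
proof -
  have "(c + s *\<^sub>R k) - (c + t *\<^sub>R k) = (c' + s *\<^sub>R k') - (c' + t *\<^sub>R k')" unfolding assms ..
  then have "(s - t) *\<^sub>R k = (s - t) *\<^sub>R k'" by (simp add: scaleR_diff_left)
  then show "k = k'" using assms(3) by simp
  then show "c = c'" using assms(1) by simp
qed

text \<open>The common form of \<open>ord_at\<close> and \<open>imbalance\<close>, so that real
  functions and maps to tropical projective space are treated at once.\<close>

definition jump :: "('v, 'e) metric_graph \<Rightarrow> (('v, 'e) point \<Rightarrow> 'a::real_vector) \<Rightarrow>
    ('v, 'e) point \<Rightarrow> 'a" where
  "jump G g x = (\<Sum>d\<in>directions G x. slope G g d)"

text \<open>\<open>W\<close> is the set of admissible slopes: the integers or the integral vectors,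
  closed under negation since backward directions change the sign. Stating the formula on closed
  intervals encodes continuity.\<close>

locale piecewise_linear = finite_metric_graph G for G :: "('v, 'e) metric_graph" +
  fixes g :: "('v, 'e) point \<Rightarrow> 'a::real_vector" and W :: "'a set"
  assumes W_uminus: "k \<in> W \<Longrightarrow> - k \<in> W"
    and breaks: "e \<in> arcs G \<Longrightarrow> \<exists>S. finite S \<and> (\<forall>a b. 0 \<le> a \<and> a < b \<and> ereal b \<le> len G e \<and>
      {a<..<b} \<inter> S = {} \<longrightarrow> (\<exists>c. \<exists>k\<in>W. \<forall>s\<in>{a..b}. g (pt G e (ereal s)) = c + s *\<^sub>R k))"
begin

lemma affine_right:
  assumes "e \<in> arcs G" "0 \<le> t" "ereal t < len G e"
  obtains c k b where "k \<in> W" "t < b" "ereal b \<le> len G e"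
    "\<And>s. s \<in> {t..b} \<Longrightarrow> g (pt G e (ereal s)) = c + s *\<^sub>R k"
proof -
  obtain S where S: "finite S" "\<And>a b. 0 \<le> a \<Longrightarrow> a < b \<Longrightarrow> ereal b \<le> len G e \<Longrightarrow>
      {a<..<b} \<inter> S = {} \<Longrightarrow> \<exists>c. \<exists>k\<in>W. \<forall>s\<in>{a..b}. g (pt G e (ereal s)) = c + s *\<^sub>R k"
    using breaks[OF assms(1)] by blast
  obtain b where b: "t < b" "ereal b \<le> len G e" "{t<..<b} \<inter> S = {}"
    using interval_avoiding_right[OF S(1) assms(3)] by blast
  show ?thesis using S(2)[OF assms(2) b] that b(1,2) by blast
qed

lemma affine_left:
  assumes "e \<in> arcs G" "0 < t" "ereal t \<le> len G e"
  obtains c k a where "k \<in> W" "a < t" "0 \<le> a"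
    "\<And>s. s \<in> {a..t} \<Longrightarrow> g (pt G e (ereal s)) = c + s *\<^sub>R k"
proof -
  obtain S where S: "finite S" "\<And>a b. 0 \<le> a \<Longrightarrow> a < b \<Longrightarrow> ereal b \<le> len G e \<Longrightarrow>
      {a<..<b} \<inter> S = {} \<Longrightarrow> \<exists>c. \<exists>k\<in>W. \<forall>s\<in>{a..b}. g (pt G e (ereal s)) = c + s *\<^sub>R k"
    using breaks[OF assms(1)] by blast
  obtain a where a: "a < t" "0 \<le> a" "{a<..<t} \<inter> S = {}"
    using interval_avoiding_left[OF S(1) assms(2)] by blast
  show ?thesis using S(2)[OF a(2,1) assms(3) a(3)] that a(1,2) by blast
qed

lemma slope_right:
  assumes "0 \<le> t" "ereal t < b"
    and "\<And>s. t < s \<Longrightarrow> ereal s < b \<Longrightarrow> g (pt G e (ereal s)) = c + s *\<^sub>R k"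
  shows "has_slope G g (e, ereal t, True) k" "slope G g (e, ereal t, True) = k"
proof -
  show *: "has_slope G g (e, ereal t, True) k"
    by (rule has_slope_right[of "ereal t" b _ _ _ c]) (use assms in auto)
  show "slope G g (e, ereal t, True) = k" by (rule slope_eqI[OF *]) simp
qed

lemma slope_left:
  assumes "0 \<le> a" "ereal a < t"
    and "\<And>s. a < s \<Longrightarrow> ereal s < t \<Longrightarrow> g (pt G e (ereal s)) = c + s *\<^sub>R k"
  shows "has_slope G g (e, t, False) (- k)" "slope G g (e, t, False) = - k"
proof -
  show *: "has_slope G g (e, t, False) (- k)"
    by (rule has_slope_left[of "ereal a" t _ _ _ c]) (use assms in auto)
  have "0 < t" using assms(1,2) by (metis ereal_less_eq(5) order.strict_trans1)
  then show "slope G g (e, t, False) = - k" by (intro slope_eqI[OF *]) simp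
qed

lemma jump_Inner:
  assumes "e \<in> arcs G" "0 < t" "ereal t < len G e"
  shows "jump G g (Inner e t) = slope G g (e, ereal t, True) + slope G g (e, ereal t, False)"
  unfolding jump_def directions_Inner[OF assms] by simp

lemma jump_0_locally_affine:
  assumes "e \<in> arcs G" "0 < t" "ereal t < len G e" "jump G g (Inner e t) = 0"
  shows "\<exists>c k. \<forall>\<^sub>F s in nhds t. g (pt G e (ereal s)) = c + s *\<^sub>R k"
proof -
  obtain c k b where R: "t < b" "\<And>s. s \<in> {t..b} \<Longrightarrow> g (pt G e (ereal s)) = c + s *\<^sub>R k"
    using affine_right[OF assms(1) less_imp_le[OF assms(2)] assms(3)] by metis
  obtain c' k' a where L: "a < t" "0 \<le> a" "\<And>s. s \<in> {a..t} \<Longrightarrow> g (pt G e (ereal s)) = c' + s *\<^sub>R k'"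
    using affine_left[OF assms(1,2) less_imp_le[OF assms(3)]] by metis
  have "slope G g (e, ereal t, True) = k"
    by (rule slope_right(2)[of _ "ereal b" _ c]) (use R assms(2) in auto)
  moreover have "slope G g (e, ereal t, False) = - k'"
    by (rule slope_left(2)[of a _ _ c']) (use L in auto)
  ultimately have "k = k'" using assms(4) unfolding jump_Inner[OF assms(1-3)] by simp
  moreover from this have "c = c'" using R(2)[of t] L(3)[of t] R(1) L(1) by auto
  ultimately have "g (pt G e (ereal s)) = c + s *\<^sub>R k" if "s \<in> {a<..<b}" for s
    using R(2)[of s] L(3)[of s] that by (cases "s \<le> t") auto
  moreover have "\<forall>\<^sub>F s in nhds t. s \<in> {a<..<b}"
    using R(1) L(1) by (intro eventually_nhds_in_open) auto
  ultimately show ?thesis by (intro exI) (auto elim: eventually_mono)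
qed

text \<open>Without jumps the function is affine on the open interval. The one-sided pieces at the
  ends agree with it at two nearby points and so extend the formula to the ends; the piece at
  \<open>a\<close> also puts the slope into \<open>W\<close>. The end \<open>b\<close> may be
  infinite.\<close>

lemma affine_piece:
  assumes e: "e \<in> arcs G" and ab: "0 \<le> a" "ereal a < b" "b \<le> len G e"
    and jumps: "\<And>t. a < t \<Longrightarrow> ereal t < b \<Longrightarrow> jump G g (Inner e t) = 0"
  obtains c k where "k \<in> W" "\<And>t. a \<le> t \<Longrightarrow> ereal t \<le> b \<Longrightarrow> g (pt G e (ereal t)) = c + t *\<^sub>R k"
proof -
  let ?I = "{t. a < t \<and> ereal t < b}"
  have interval: "is_interval ?I" unfolding is_interval_1
    by (auto intro: order.strict_trans1 simp: order.strict_trans1[of "ereal _" "ereal _"])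
  have len: "ereal t < len G e" if "ereal t < b" for t using that ab(3) by (rule order.strict_trans2)
  have "\<exists>c k. \<forall>t\<in>?I. g (pt G e (ereal t)) = c + t *\<^sub>R k"
    by (rule locally_affine_imp_affine[OF interval])
      (use jump_0_locally_affine[OF e] jumps len ab(1) in auto)
  then obtain c k where ck: "\<And>t. a < t \<Longrightarrow> ereal t < b \<Longrightarrow> g (pt G e (ereal t)) = c + t *\<^sub>R k" by blast
  obtain c' k' d where R: "k' \<in> W" "a < d" "ereal d \<le> len G e"
    "\<And>s. s \<in> {a..d} \<Longrightarrow> g (pt G e (ereal s)) = c' + s *\<^sub>R k'"
    using affine_right[OF e ab(1) len[OF ab(2)]] by metis
  obtain d' where d': "a < d'" "d' \<le> d" "ereal d' < b"
  proof -
    obtain r where "ereal a < ereal r" "ereal r < b" using ereal_dense2[OF ab(2)] by blast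
    then show ?thesis using that[of "min r d"] R(2)
      by (metis ereal_less_eq(3) less_ereal.simps(1) min.cobounded1 min.cobounded2 min_less_iff_conj order.strict_trans1)
  qed
  define d'' where "d'' = (a + d') / 2"
  have d'': "a < d''" "d'' < d'" using d'(1) unfolding d''_def by auto
  have "ereal d'' < b" using d''(2) d'(3) by (meson less_ereal.simps(1) less_trans)
  have "k = k' \<and> c = c'"
    using two_point_slope[of c d' k c' k' d''] ck[of d'] ck[of d''] R(4)[of d'] R(4)[of d''] d' d''
      \<open>ereal d'' < b\<close> by auto
  then have kW: "k \<in> W" and at_a: "g (pt G e (ereal a)) = c + a *\<^sub>R k" using R by auto
  have at_b: "g (pt G e (ereal t)) = c + t *\<^sub>R k" if t: "ereal t = b" for t
  proof -
    have t0: "0 < t" "a < t" using ab(1,2) t by auto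
    obtain c1 k1 a1 where L: "a1 < t" "\<And>s. s \<in> {a1..t} \<Longrightarrow> g (pt G e (ereal s)) = c1 + s *\<^sub>R k1"
      using affine_left[OF e t0(1)] ab(3) t by metis
    define m where "m = max a a1"
    have m: "m < t" "a \<le> m" "a1 \<le> m" using t0 L(1) unfolding m_def by auto
    have eq: "c + s *\<^sub>R k = c1 + s *\<^sub>R k1" if s: "m < s" "s < t" for s
    proof -
      have "ereal s < b" unfolding t[symmetric] using s by simp
      then show ?thesis using ck[of s] L(2)[of s] s m by auto
    qed
    have "k = k1 \<and> c = c1"
      using two_point_slope[OF eq[of "(m + t) / 2"] eq[of "(m + 2 * t) / 3"]] m(1) by auto
    then show ?thesis using L by auto
  qed
  show ?thesis
  proof (rule that[OF kW])
    fix t assume "a \<le> t" "ereal t \<le> b"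
    then show "g (pt G e (ereal t)) = c + t *\<^sub>R k"
      using ck[of t] at_a at_b[of t] by (cases "t = a"; cases "ereal t = b") auto
  qed
qed

lemma finite_jumps: "finite {x. jump G g x \<noteq> 0 \<and> (\<exists>e\<in>arcs G. \<exists>t. x = Inner e t \<and> 0 < t \<and> ereal t < len G e)}"
proof -
  obtain S where S: "\<And>e. e \<in> arcs G \<Longrightarrow> finite (S e)" "\<And>e a b. e \<in> arcs G \<Longrightarrow> 0 \<le> a \<Longrightarrow> a < b \<Longrightarrow>
    ereal b \<le> len G e \<Longrightarrow> {a<..<b} \<inter> S e = {} \<Longrightarrow>
    \<exists>c. \<exists>k\<in>W. \<forall>s\<in>{a..b}. g (pt G e (ereal s)) = c + s *\<^sub>R k"
    using breaks by metis
  have "{x. jump G g x \<noteq> 0 \<and> (\<exists>e\<in>arcs G. \<exists>t. x = Inner e t \<and> 0 < t \<and> ereal t < len G e)} \<subseteq>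
    (\<Union>e\<in>arcs G. Inner e ` S e)"
  proof
    fix x assume "x \<in> {x. jump G g x \<noteq> 0 \<and> (\<exists>e\<in>arcs G. \<exists>t. x = Inner e t \<and> 0 < t \<and> ereal t < len G e)}"
    then obtain e t where x: "jump G g x \<noteq> 0" "x = Inner e t" "e \<in> arcs G" "0 < t" "ereal t < len G e" by blast
    have "t \<in> S e"
    proof (rule ccontr)
      assume "t \<notin> S e"
      obtain b where b: "t < b" "ereal b \<le> len G e" "{t<..<b} \<inter> S e = {}"
        using interval_avoiding_right[OF S(1)[OF x(3)] x(5)] by blast
      obtain a where a: "a < t" "0 \<le> a" "{a<..<t} \<inter> S e = {}"
        using interval_avoiding_left[OF S(1)[OF x(3)] x(4)] by blast
      have "{a<..<b} \<inter> S e = {}"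
      proof -
        have "s = t \<or> s \<in> {a<..<t} \<or> s \<in> {t<..<b}" if "s \<in> {a<..<b}" for s using that by auto
        then show ?thesis using a(3) b(3) \<open>t \<notin> S e\<close> by blast
      qed
      then obtain c k where ck: "\<And>s. s \<in> {a..b} \<Longrightarrow> g (pt G e (ereal s)) = c + s *\<^sub>R k"
        using S(2)[OF x(3) a(2) _ b(2)] a(1) b(1) by force
      have "slope G g (e, ereal t, True) = k"
        by (rule slope_right(2)[of _ "ereal b" _ c]) (use ck a b x(4) in auto)
      moreover have "slope G g (e, ereal t, False) = - k"
        by (rule slope_left(2)[of a _ _ c]) (use ck a b in auto)
      ultimately show False using x(1) jump_Inner[OF x(3-5)] x(2) by simp
    qed
    then show "x \<in> (\<Union>e\<in>arcs G. Inner e ` S e)" using x(2,3) by blast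
  qed
  then show ?thesis using S(1) finite_arcs by (elim finite_subset) auto
qed

lemma has_slope_direction:
  assumes "d \<in> directions G x"
  shows "has_slope G g d (slope G g d)" "slope G g d \<in> W"
proof -
  obtain e t s where d: "d = (e, t, s)" "e \<in> arcs G" "0 \<le> t" "t \<le> len G e"
    "if s then t < len G e else 0 < t"
    using assms unfolding directions_def by auto
  have "\<exists>k\<in>W. has_slope G g d k \<and> slope G g d = k"
  proof (cases s)
    case True
    then have "t \<noteq> \<infinity>" using d(5) by auto
    then obtain r where r: "t = ereal r" using d(3) by (cases t) auto
    have r0: "0 \<le> r" "ereal r < len G e" using d(3,5) r True by (auto simp: zero_ereal_def)
    obtain c k b where R: "k \<in> W" "r < b" "\<And>s. s \<in> {r..b} \<Longrightarrow> g (pt G e (ereal s)) = c + s *\<^sub>R k"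
      using affine_right[OF d(2) r0] by metis
    have "has_slope G g (e, ereal r, True) k" "slope G g (e, ereal r, True) = k"
      by (rule slope_right[of _ "ereal b" _ c]; use R d(3) r in \<open>auto simp: zero_ereal_def\<close>)+
    moreover have "d = (e, ereal r, True)" using d(1) r True by simp
    ultimately show ?thesis using R(1) by blast
  next
    case False
    show ?thesis
    proof (cases "t = \<infinity>")
      case True
      have "finite {r. Inner e r \<in> {x. jump G g x \<noteq> 0 \<and>
          (\<exists>e\<in>arcs G. \<exists>t. x = Inner e t \<and> 0 < t \<and> ereal t < len G e)}}"
        by (rule finite_vimageI[OF finite_jumps, of "Inner e", unfolded vimage_def]) (auto intro: injI)
      then have "finite {r. jump G g (Inner e r) \<noteq> 0 \<and> 0 < r}"
        by (rule rev_finite_subset) (use d(2,4) True in auto)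
      then have "\<forall>\<^sub>F r in at_top. r \<notin> {r. jump G g (Inner e r) \<noteq> 0 \<and> 0 < r}"
        by (rule eventually_at_top_not_in_finite)
      then obtain T where T: "\<And>r. T \<le> r \<Longrightarrow> r \<notin> {r. jump G g (Inner e r) \<noteq> 0 \<and> 0 < r}"
        unfolding eventually_at_top_linorder by blast
      \<comment> \<open>An edge carries finitely many jumps, so beyond \<open>M\<close> the function
        is affine and has a slope at the infinite end.\<close>
      define M where "M = max 0 T"
      have M: "0 \<le> M" unfolding M_def by simp
      have no_jump: "jump G g (Inner e r) = 0" if "M < r" for r
        using T[of r] that unfolding M_def by auto
      obtain c k where ck: "k \<in> W" "\<And>r. M \<le> r \<Longrightarrow> ereal r \<le> \<infinity> \<Longrightarrow> g (pt G e (ereal r)) = c + r *\<^sub>R k"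
        by (rule affine_piece[OF d(2) M, of \<infinity>]) (use no_jump d(4) True in auto)
      have "has_slope G g (e, t, False) (- k)" "slope G g (e, t, False) = - k"
        by (rule slope_left[of M _ _ c]; use ck M True in auto)+
      moreover have "d = (e, t, False)" using d(1) False by simp
      ultimately show ?thesis using W_uminus[OF ck(1)] by blast
    next
      case fin: False
      then obtain r where r: "t = ereal r" using d(3) by (cases t) auto
      have r0: "0 < r" "ereal r \<le> len G e" using d(4,5) r False by (auto simp: zero_ereal_def)
      obtain c k a where L: "k \<in> W" "a < r" "0 \<le> a" "\<And>s. s \<in> {a..r} \<Longrightarrow> g (pt G e (ereal s)) = c + s *\<^sub>R k"
        using affine_left[OF d(2) r0] by metis
      have "has_slope G g (e, ereal r, False) (- k)" "slope G g (e, ereal r, False) = - k"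
        by (rule slope_left[of a _ _ c]; use L in auto)+
      moreover have "d = (e, ereal r, False)" using d(1) r False by simp
      ultimately show ?thesis using W_uminus[OF L(1)] by blast
    qed
  qed
  then show "has_slope G g d (slope G g d)" "slope G g d \<in> W" by auto
qed

end


subsection \<open>Rational functions are piecewise linear\<close>

lemma tropical_curve_finite_metric_graph:
  assumes "tropical_curve G"
  shows "finite_metric_graph G"
proof -
  interpret fin_digraph "pre_digraph.truncate G"
    using assms unfolding tropical_curve_def by blast
  show ?thesis
  proof
    show "finite (verts G)" "finite (arcs G)"
      using finite_verts finite_arcs by (simp_all add: pre_digraph.truncate_def)
    show "tail G e \<in> verts G" "head G e \<in> verts G" if "e \<in> arcs G" for e
      using tail_in_verts[of e] head_in_verts[of e] that by (simp_all add: pre_digraph.truncate_def)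
    show "0 < len G e" if "e \<in> arcs G" for e
      using assms that unfolding tropical_curve_def by blast
    show "tail G e' \<noteq> head G e" if "e \<in> arcs G" "len G e = \<infinity>" "e' \<in> arcs G" for e e'
      using assms that unfolding tropical_curve_def by metis
    show "head G e' \<noteq> head G e" if "e \<in> arcs G" "len G e = \<infinity>" "e' \<in> arcs G" "e' \<noteq> e" for e e'
      using assms that unfolding tropical_curve_def by metis
  qed
qed

lemma pt_interior:
  assumes "0 < t" "ereal t < len G e"
  shows "pt G e (ereal t) = Inner e t"
  using assms by (auto simp: pt_def)

text \<open>The affine formula is given on open intervals; continuity carries it to their ends,
  where \<open>pt\<close> may be a vertex.\<close>

lemma rational_function_breaks:
  assumes "rational_function G f" "e \<in> arcs G"
  shows "\<exists>S. finite S \<and> (\<forall>a b. 0 \<le> a \<and> a < b \<and> ereal b \<le> len G e \<and> {a<..<b} \<inter> S = {} \<longrightarrow>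
    (\<exists>c. \<exists>k\<in>\<int>. \<forall>s\<in>{a..b}. real_of_ereal (f (pt G e (ereal s))) = c + s *\<^sub>R k))"
proof -
  note * = assms(1)[unfolded rational_function_def, THEN conjunct2, THEN conjunct2]
  obtain S :: "real set" where "finite S \<and> (\<forall>a b. 0 \<le> a \<and> a < b \<and> ereal b \<le> len G e \<and>
      {a<..<b} \<inter> S = {} \<longrightarrow>
      (\<exists>(k::int) (c::real). \<forall>t\<in>{a<..<b}. f (Inner e t) = ereal (c + of_int k * t)))"
    using bspec[OF *[THEN conjunct2] assms(2)] by (elim exE)
  then have S: "finite S" "\<And>a b. 0 \<le> a \<Longrightarrow> a < b \<Longrightarrow> ereal b \<le> len G e \<Longrightarrow>
      {a<..<b} \<inter> S = {} \<Longrightarrow> \<exists>(k::int) (c::real). \<forall>t\<in>{a<..<b}. f (Inner e t) = ereal (c + of_int k * t)"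
    by simp_all
  note cont = bspec[OF *[THEN conjunct1] assms(2)]
  have "\<exists>c. \<exists>k\<in>\<int>. \<forall>s\<in>{a..b}. real_of_ereal (f (pt G e (ereal s))) = c + s *\<^sub>R k"
    if ab: "0 \<le> a" "a < b" "ereal b \<le> len G e" "{a<..<b} \<inter> S = {}" for a b
  proof -
    obtain k :: int and c :: real where kc: "\<And>t. t \<in> {a<..<b} \<Longrightarrow> f (Inner e t) = ereal (c + of_int k * t)"
      using S(2)[OF ab] by blast
    \<comment> \<open>The function paired with its affine formula. On the open interval the pair
      lies on the diagonal, which is closed, so it does on the closure as well.\<close>
    let ?p = "\<lambda>s. (f (pt G e (ereal s)), ereal (c + of_int k * s))"
    have le: "ereal s \<le> len G e" if "s \<le> b" for s
      by (rule order.trans[OF _ ab(3)]) (use that in simp)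
    have "ereal ` {a..b} \<subseteq> {0..len G e}"
      using ab(1) le by auto
    then have "continuous_on {a..b} (\<lambda>s. f (pt G e (ereal s)))"
      by (intro continuous_on_compose2[OF cont] continuous_intros)
    then have "continuous_on (closure {a<..<b}) ?p"
      using ab(2) by (auto intro!: continuous_on_Pair continuous_intros)
    moreover have "?p ` {a<..<b} \<subseteq> {y. \<exists>x. y = (x, x)}"
    proof
      fix y assume "y \<in> ?p ` {a<..<b}"
      then obtain s where "y = ?p s" "s \<in> {a<..<b}" by blast
      then have s: "y = ?p s" "a < s" "s < b" by simp_all
      have "pt G e (ereal s) = Inner e s"
        by (rule pt_interior[OF _ order.strict_trans2[OF _ ab(3)]]) (use s ab(1) in auto)
      then show "y \<in> {y. \<exists>x. y = (x, x)}" using kc[of s] s by auto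
    qed
    ultimately have sub: "?p ` closure {a<..<b} \<subseteq> {y. \<exists>x. y = (x, x)}"
      by (intro image_closure_subset closed_diagonal)
    have "f (pt G e (ereal s)) = ereal (c + of_int k * s)" if "s \<in> {a..b}" for s
    proof -
      have "s \<in> closure {a<..<b}" using that ab(2) by simp
      from subsetD[OF sub imageI[OF this]] show ?thesis by simp
    qed
    then show ?thesis by (intro exI[of _ c] bexI[of _ "real_of_int k"]) auto
  qed
  then show ?thesis using S(1) by blast
qed

lemma (in finite_metric_graph) piecewise_linear_rational:
  assumes "rational_function G f"
  shows "piecewise_linear G (\<lambda>x. real_of_ereal (f x)) \<int>"
  using rational_function_breaks[OF assms] by unfold_locales auto

lemma (in finite_metric_graph) piecewise_linear_tropical_map:
  fixes f :: "'n::finite \<Rightarrow> ('v, 'e) point \<Rightarrow> ereal"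
  assumes "\<And>i. rational_function G (f i)"
  shows "piecewise_linear G (tropical_map f) int_vectors"
proof
  show "- k \<in> int_vectors" if "k \<in> int_vectors" for k :: "'n tp"
    by (rule integral_uminus[OF that])
  fix e assume e: "e \<in> arcs G"
  obtain S where S: "\<And>i. finite (S i)" "\<And>i a b. 0 \<le> a \<Longrightarrow> a < b \<Longrightarrow> ereal b \<le> len G e \<Longrightarrow>
      {a<..<b} \<inter> S i = {} \<Longrightarrow> \<exists>c. \<exists>k\<in>\<int>. \<forall>s\<in>{a..b}. real_of_ereal (f i (pt G e (ereal s))) = c + s *\<^sub>R k"
    using rational_function_breaks[OF assms e] by metis
  show "\<exists>S. finite S \<and> (\<forall>a b. 0 \<le> a \<and> a < b \<and> ereal b \<le> len G e \<and> {a<..<b} \<inter> S = {} \<longrightarrow>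
    (\<exists>c. \<exists>k\<in>int_vectors. \<forall>s\<in>{a..b}. tropical_map f (pt G e (ereal s)) = c + s *\<^sub>R k))"
  proof (intro exI[of _ "\<Union>i. S i"] conjI allI impI)
    show "finite (\<Union>i. S i)" using S(1) by simp
    fix a b assume ab: "0 \<le> a \<and> a < b \<and> ereal b \<le> len G e \<and> {a<..<b} \<inter> (\<Union>i. S i) = {}"
    then have "\<exists>c. \<exists>k\<in>\<int>. \<forall>s\<in>{a..b}. real_of_ereal (f i (pt G e (ereal s))) = c + s *\<^sub>R k" for i
      using S(2)[of a b i] by blast
    then obtain c k where ck: "\<And>i. k i \<in> \<int>"
      "\<And>i s. s \<in> {a..b} \<Longrightarrow> real_of_ereal (f i (pt G e (ereal s))) = c i + s *\<^sub>R k i" by metis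
    have "tropical_map f (pt G e (ereal s)) = tp (\<chi> i. c i) + s *\<^sub>R tp (\<chi> i. k i)" if "s \<in> {a..b}" for s
      unfolding tropical_map_def ck(2)[OF that] tp_scaleR tp_add
      by (rule arg_cong[of _ _ tp]) (simp add: vec_eq_iff)
    moreover have "tp (\<chi> i. k i) = tp_of_int (\<chi> i. \<lfloor>k i\<rfloor>)"
      unfolding tp_of_int_def using ck(1) by (intro arg_cong[of _ _ tp]) (simp add: vec_eq_iff)
    ultimately show "\<exists>c. \<exists>k\<in>int_vectors. \<forall>s\<in>{a..b}. tropical_map f (pt G e (ereal s)) = c + s *\<^sub>R k"
      by (metis rangeI)
  qed
qed

lemma ord_at_eq_jump: "ord_at G f x = jump G (\<lambda>y. real_of_ereal (f y)) x"
  unfolding ord_at_def jump_def ..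

lemma imbalance_eq_jump: "imbalance G h x = jump G h x"
  unfolding imbalance_def jump_def ..

lemma has_slope_tropical_map:
  fixes f :: "'n::finite \<Rightarrow> ('v, 'e) point \<Rightarrow> ereal"
  assumes "\<And>i. has_slope G (\<lambda>y. real_of_ereal (f i y)) d (k i)"
  shows "has_slope G (tropical_map f) d (tp (\<chi> i. k i))"
proof -
  obtain e t s where d: "d = (e, t, s)" by (cases d)
  let ?F = "if s then at_right t else at_left t"
  let ?\<sigma> = "if s then 1 else - 1 :: real"
  have "\<exists>c. \<forall>\<^sub>F r in ?F. real_of_ereal (f i (pt G e r)) = c + (?\<sigma> * real_of_ereal r) *\<^sub>R k i" for i
    using assms[of i] unfolding d by simp
  then obtain c where "\<And>i. \<forall>\<^sub>F r in ?F. real_of_ereal (f i (pt G e r)) = c i + (?\<sigma> * real_of_ereal r) *\<^sub>R k i"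
    by metis
  then have "\<forall>\<^sub>F r in ?F. \<forall>i. real_of_ereal (f i (pt G e r)) = c i + (?\<sigma> * real_of_ereal r) *\<^sub>R k i"
    by (rule eventually_all_finite)
  then have "\<forall>\<^sub>F r in ?F. tropical_map f (pt G e r) = tp (\<chi> i. c i) + (?\<sigma> * real_of_ereal r) *\<^sub>R tp (\<chi> i. k i)"
  proof (rule eventually_mono)
    fix r assume *: "\<forall>i. real_of_ereal (f i (pt G e r)) = c i + (?\<sigma> * real_of_ereal r) *\<^sub>R k i"
    show "tropical_map f (pt G e r) = tp (\<chi> i. c i) + (?\<sigma> * real_of_ereal r) *\<^sub>R tp (\<chi> i. k i)"
      unfolding tropical_map_def *[rule_format] tp_scaleR tp_add
      by (rule arg_cong[of _ _ tp]) (simp add: vec_eq_iff)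
  qed
  then show ?thesis unfolding d by auto
qed

text \<open>Slopes depend on nearby parameters and not on the value at the point. They can therefore
  be taken coordinatewise even at a point at infinity, where the functions may be infinite.\<close>

lemma (in finite_metric_graph) jump_tropical_map:
  fixes f :: "'n::finite \<Rightarrow> ('v, 'e) point \<Rightarrow> ereal"
  assumes "\<And>i. rational_function G (f i)"
  shows "jump G (tropical_map f) x = tp (\<chi> i. ord_at G (f i) x)"
proof -
  have slope: "slope G (tropical_map f) d = tp (\<chi> i. slope G (\<lambda>y. real_of_ereal (f i y)) d)"
    if d: "d \<in> directions G x" for d
  proof -
    have "has_slope G (\<lambda>y. real_of_ereal (f i y)) d (slope G (\<lambda>y. real_of_ereal (f i y)) d)" for i
      using piecewise_linear.has_slope_direction(1)[OF piecewise_linear_rational[OF assms] d] .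
    then have *: "has_slope G (tropical_map f) d (tp (\<chi> i. slope G (\<lambda>y. real_of_ereal (f i y)) d))"
      by (rule has_slope_tropical_map)
    obtain e t s where [simp]: "d = (e, t, s)" by (cases d)
    show ?thesis using * d unfolding directions_def
      by (auto intro!: slope_eqI simp del: has_slope.simps split: if_splits)
  qed
  have "jump G (tropical_map f) x = tp (\<Sum>d\<in>directions G x. \<chi> i. slope G (\<lambda>y. real_of_ereal (f i y)) d)"
    unfolding jump_def tp_sum[symmetric] by (rule sum.cong[OF refl slope])
  also have "(\<Sum>d\<in>directions G x. \<chi> i. slope G (\<lambda>y. real_of_ereal (f i y)) d) = (\<chi> i. ord_at G (f i) x)"
    unfolding ord_at_def by (simp add: vec_eq_iff)
  finally show ?thesis .
qed


section \<open>Subdivisions\<close>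

text \<open>Index set of the arcs \<open>Piece e a b\<close> of \<open>attach_leaves\<close>, kept
  apart from the constructor so that \<open>G\<close> itself can be subdivided at any finite
  set.\<close>

definition pieces :: "('v, 'e) metric_graph \<Rightarrow> ('v, 'e) point set \<Rightarrow> ('e \<times> ereal \<times> ereal) set" where
  "pieces G P = {(e, a, b). e \<in> arcs G \<and> a \<in> cuts G P e \<and> b \<in> cuts G P e \<and> a < b \<and>
     cuts G P e \<inter> {a<..<b} = {}}"

context finite_metric_graph
begin

lemma finite_cuts:
  assumes "finite P"
  shows "finite (cuts G P e)"
proof -
  have "{ereal t | t. Inner e t \<in> P} = ereal ` (Inner e -` P)" by auto
  then show ?thesis unfolding cuts_def using assms by (auto intro!: finite_vimageI injI)
qed

lemma cutsE:
  assumes "a \<in> cuts G P e" "P \<subseteq> points G"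
  obtains "a = 0" | "a = len G e" |
    t where "a = ereal t" "0 < t" "ereal t < len G e" "Inner e t \<in> P" "a \<noteq> 0" "a \<noteq> len G e"
  using assms unfolding cuts_def points_def by fastforce

lemma cuts_bounds:
  assumes "a \<in> cuts G P e" "P \<subseteq> points G" "e \<in> arcs G"
  shows "0 \<le> a" "a \<le> len G e" "pt G e a \<in> Vertex ` verts G \<union> P"
  using assms(1,2)
  by (cases rule: cutsE; use len_pos[OF assms(3)] tail_in[OF assms(3)] head_in[OF assms(3)] in
      \<open>auto simp: pt_def\<close>)+

lemma pt_in_cuts:
  assumes "pt G e t \<in> Vertex ` V \<union> P" "0 \<le> t" "t \<le> len G e"
  shows "t \<in> cuts G P e"
proof (cases "t = 0 \<or> t = len G e")
  case False
  then obtain r where "t = ereal r" using assms(2,3) by (cases t) auto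
  then show ?thesis using assms(1) False unfolding cuts_def pt_def by auto
qed (auto simp: cuts_def)

lemma next_cut:
  assumes "finite P" "P \<subseteq> points G" "e \<in> arcs G" "a \<in> cuts G P e" "a < len G e"
  shows "\<exists>b. (e, a, b) \<in> pieces G P"
proof -
  let ?B = "{b \<in> cuts G P e. a < b}"
  have fin: "finite ?B" "?B \<noteq> {}" using finite_cuts[OF assms(1)] assms(5) unfolding cuts_def by auto
  have "Min ?B \<in> ?B" by (rule Min_in[OF fin])
  moreover have "cuts G P e \<inter> {a<..<Min ?B} = {}"
    using Min_le[OF fin(1)] by (auto simp: not_le[symmetric])
  ultimately have "(e, a, Min ?B) \<in> pieces G P" using assms(3,4) unfolding pieces_def by blast
  then show ?thesis by blast
qed

lemma prev_cut:
  assumes "finite P" "P \<subseteq> points G" "e \<in> arcs G" "b \<in> cuts G P e" "0 < b"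
  shows "\<exists>a. (e, a, b) \<in> pieces G P"
proof -
  let ?B = "{a \<in> cuts G P e. a < b}"
  have fin: "finite ?B" "?B \<noteq> {}" using finite_cuts[OF assms(1)] assms(5) unfolding cuts_def by auto
  have "Max ?B \<in> ?B" by (rule Max_in[OF fin])
  moreover have "cuts G P e \<inter> {Max ?B<..<b} = {}"
    using Max_ge[OF fin(1)] by (auto simp: not_le[symmetric])
  ultimately have "(e, Max ?B, b) \<in> pieces G P" using assms(3,4) unfolding pieces_def by blast
  then show ?thesis by blast
qed

lemma pieces_unique:
  assumes "(e, a, b) \<in> pieces G P" "(e, a', b') \<in> pieces G P"
  shows "a = a' \<longleftrightarrow> b = b'"
proof
  assume "a = a'"
  then have "\<not> b < b'" "\<not> b' < b" using assms unfolding pieces_def by auto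
  then show "b = b'" by simp
next
  assume "b = b'"
  then have "\<not> a < a'" "\<not> a' < a" using assms unfolding pieces_def by auto
  then show "a = a'" by simp
qed

lemma finite_pieces:
  assumes "finite P"
  shows "finite (pieces G P)"
proof -
  have "pieces G P \<subseteq> (\<Union>e\<in>arcs G. {e} \<times> cuts G P e \<times> cuts G P e)" unfolding pieces_def by auto
  then show ?thesis using finite_subset finite_arcs finite_cuts[OF assms] by (meson finite.emptyI finite_SigmaI finite_UN_I finite_insert)
qed

text \<open>Since \<open>x\<close> is a subdivision point, every direction at \<open>x\<close> sits
  at a cut. A forward direction enters exactly one piece at its left end, a backward one exactly one
  piece at its right end.\<close>

lemma sum_directions:
  fixes \<gamma> :: "_ \<Rightarrow> 'b::comm_monoid_add"
  assumes "finite P" "P \<subseteq> points G" "x \<in> Vertex ` verts G \<union> P"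
  shows "(\<Sum>d\<in>directions G x. \<gamma> d) =
    (\<Sum>(e, a, b)\<in>{(e, a, b) \<in> pieces G P. pt G e a = x}. \<gamma> (e, a, True)) +
    (\<Sum>(e, a, b)\<in>{(e, a, b) \<in> pieces G P. pt G e b = x}. \<gamma> (e, b, False))"
proof -
  let ?T = "{(e, a, b) \<in> pieces G P. pt G e a = x}" and ?F = "{(e, a, b) \<in> pieces G P. pt G e b = x}"
  let ?t = "\<lambda>(e, a, b::ereal). (e, a, True)" and ?f = "\<lambda>(e, a::ereal, b). (e, b, False)"
  have T: "?t ` ?T = {(e, t, s) \<in> directions G x. s}"
  proof (intro equalityI subsetI)
    fix d assume "d \<in> ?t ` ?T"
    then obtain e a b where *: "d = (e, a, True)" "(e, a, b) \<in> pieces G P" "pt G e a = x" by auto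
    then have p: "e \<in> arcs G" "a \<in> cuts G P e" "b \<in> cuts G P e" "a < b" unfolding pieces_def by auto
    have "0 \<le> a" "a < len G e" using cuts_bounds[OF p(2) assms(2) p(1)] cuts_bounds[OF p(3) assms(2) p(1)] p(4) by auto
    then show "d \<in> {(e, t, s) \<in> directions G x. s}" using * p(1) unfolding directions_def by auto
  next
    fix d assume "d \<in> {(e, t, s) \<in> directions G x. s}"
    then obtain e t where *: "d = (e, t, True)" "e \<in> arcs G" "0 \<le> t" "t < len G e" "pt G e t = x"
      unfolding directions_def by auto
    then have "t \<in> cuts G P e" using assms(3) by (intro pt_in_cuts) auto
    then obtain b where "(e, t, b) \<in> pieces G P" using next_cut[OF assms(1,2) *(2)] *(4) by blast
    then show "d \<in> ?t ` ?T" using * by force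
  qed
  have F: "?f ` ?F = {(e, t, s) \<in> directions G x. \<not> s}"
  proof (intro equalityI subsetI)
    fix d assume "d \<in> ?f ` ?F"
    then obtain e a b where *: "d = (e, b, False)" "(e, a, b) \<in> pieces G P" "pt G e b = x" by auto
    then have p: "e \<in> arcs G" "a \<in> cuts G P e" "b \<in> cuts G P e" "a < b" unfolding pieces_def by auto
    have "0 < b" "b \<le> len G e" using cuts_bounds[OF p(2) assms(2) p(1)] cuts_bounds[OF p(3) assms(2) p(1)] p(4) by auto
    then show "d \<in> {(e, t, s) \<in> directions G x. \<not> s}" using * p(1) unfolding directions_def by auto
  next
    fix d assume "d \<in> {(e, t, s) \<in> directions G x. \<not> s}"
    then obtain e t where *: "d = (e, t, False)" "e \<in> arcs G" "0 < t" "t \<le> len G e" "pt G e t = x"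
      unfolding directions_def by auto
    then have "t \<in> cuts G P e" using assms(3) by (intro pt_in_cuts) auto
    then obtain a where "(e, a, t) \<in> pieces G P" using prev_cut[OF assms(1,2) *(2)] *(3) by blast
    then show "d \<in> ?f ` ?F" using * by force
  qed
  have "inj_on ?t ?T" "inj_on ?f ?F" by (rule inj_onI, clarsimp, metis pieces_unique)+
  have dirs: "directions G x = ?t ` ?T \<union> ?f ` ?F" unfolding T F by auto
  have "(\<Sum>d\<in>directions G x. \<gamma> d) = (\<Sum>d\<in>?t ` ?T. \<gamma> d) + (\<Sum>d\<in>?f ` ?F. \<gamma> d)"
    unfolding dirs using finite_directions[OF finite_arcs, of x] dirs
    by (intro sum.union_disjoint) auto
  also have "(\<Sum>d\<in>?t ` ?T. \<gamma> d) = (\<Sum>(e, a, b)\<in>?T. \<gamma> (e, a, True))"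
    by (subst sum.reindex[OF \<open>inj_on ?t ?T\<close>]) (auto intro!: sum.cong)
  also have "(\<Sum>d\<in>?f ` ?F. \<gamma> d) = (\<Sum>(e, a, b)\<in>?F. \<gamma> (e, b, False))"
    by (subst sum.reindex[OF \<open>inj_on ?f ?F\<close>]) (auto intro!: sum.cong)
  finally show ?thesis .
qed

text \<open>Double counting: each piece is seen once from each of its two ends.\<close>

lemma sum_all_directions:
  fixes \<gamma> :: "_ \<Rightarrow> 'b::comm_monoid_add"
  assumes "finite P" "P \<subseteq> points G"
  shows "(\<Sum>x\<in>Vertex ` verts G \<union> P. \<Sum>d\<in>directions G x. \<gamma> d) =
    (\<Sum>(e, a, b)\<in>pieces G P. \<gamma> (e, a, True) + \<gamma> (e, b, False))"
proof -
  let ?V = "Vertex ` verts G \<union> P"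
  have "(\<Sum>x\<in>?V. \<Sum>d\<in>directions G x. \<gamma> d) =
    (\<Sum>x\<in>?V. \<Sum>(e, a, b)\<in>{p \<in> pieces G P. (case p of (e, a, b) \<Rightarrow> pt G e a) = x}. \<gamma> (e, a, True)) +
    (\<Sum>x\<in>?V. \<Sum>(e, a, b)\<in>{p \<in> pieces G P. (case p of (e, a, b) \<Rightarrow> pt G e b) = x}. \<gamma> (e, b, False))"
    unfolding sum.distrib[symmetric]
    by (rule sum.cong[OF refl], subst sum_directions[OF assms])
      (auto intro!: arg_cong2[of _ _ _ _ "(+)"] sum.cong)
  also have "\<dots> = (\<Sum>(e, a, b)\<in>pieces G P. \<gamma> (e, a, True)) + (\<Sum>(e, a, b)\<in>pieces G P. \<gamma> (e, b, False))"
  proof -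
    have fin: "finite (pieces G P)" "finite ?V" using finite_pieces[OF assms(1)] assms(1) finite_verts by auto
    have img: "(\<lambda>(e, a, b). pt G e a) ` pieces G P \<subseteq> ?V" "(\<lambda>(e, a, b). pt G e b) ` pieces G P \<subseteq> ?V"
      using cuts_bounds(3)[OF _ assms(2)] unfolding pieces_def by auto
    show ?thesis unfolding sum.group[OF fin img(1)] sum.group[OF fin img(2)] ..
  qed
  also have "\<dots> = (\<Sum>(e, a, b)\<in>pieces G P. \<gamma> (e, a, True) + \<gamma> (e, b, False))"
    by (simp add: sum.distrib[symmetric] case_prod_beta)
  finally show ?thesis .
qed

end

context piecewise_linear
begin

lemma affine_on_pieces:
  assumes "P \<subseteq> points G" "(e, a, b) \<in> pieces G P"
    and "\<And>t. 0 < t \<Longrightarrow> ereal t < len G e \<Longrightarrow> jump G g (Inner e t) \<noteq> 0 \<Longrightarrow> Inner e t \<in> P"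
  obtains c k r where "k \<in> W" "a = ereal r" "0 \<le> r"
    "\<And>t. r \<le> t \<Longrightarrow> ereal t \<le> b \<Longrightarrow> g (pt G e (ereal t)) = c + t *\<^sub>R k"
    "slope G g (e, a, True) = k" "slope G g (e, b, False) = - k"
proof -
  have p: "e \<in> arcs G" "a \<in> cuts G P e" "b \<in> cuts G P e" "a < b" "cuts G P e \<inter> {a<..<b} = {}"
    using assms(2) unfolding pieces_def by auto
  note bd = cuts_bounds[OF p(2) assms(1) p(1)] cuts_bounds[OF p(3) assms(1) p(1)]
  obtain r where r: "a = ereal r" using bd(1) p(4) by (cases a) auto
  have r0: "0 \<le> r" using bd(1) r by simp
  have "jump G g (Inner e t) = 0" if "r < t" "ereal t < b" for t
  proof (rule ccontr)
    assume "jump G g (Inner e t) \<noteq> 0"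
    moreover have "ereal t < len G e" using that(2) bd(5) by (rule order.strict_trans2)
    ultimately have "ereal t \<in> cuts G P e" using assms(3)[of t] that(1) r0 unfolding cuts_def by auto
    then show False using p(5) that r by auto
  qed
  then obtain c k where ck: "k \<in> W" "\<And>t. r \<le> t \<Longrightarrow> ereal t \<le> b \<Longrightarrow> g (pt G e (ereal t)) = c + t *\<^sub>R k"
    using affine_piece[OF p(1) r0 p(4)[unfolded r] bd(5)] by metis
  show ?thesis
  proof (rule that[OF ck(1) r r0 ck(2)])
    show "slope G g (e, a, True) = k" unfolding r
      by (rule slope_right(2)[of _ b _ c]) (use r0 p(4) r ck(2) in auto)
    show "slope G g (e, b, False) = - k"
      by (rule slope_left(2)[of r _ _ c]) (use r0 p(4) r ck(2) in auto)
  qed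
qed

text \<open>The degree of a principal divisor vanishes: each piece contributes its slope at one end
  and the negative at the other. Infinite pieces have their second end at a point at infinity, which
  is a vertex and so belongs to \<open>Q\<close>.\<close>

lemma sum_jumps:
  assumes "finite Q" "Vertex ` verts G \<subseteq> Q" "Q \<subseteq> points G"
    and "\<And>e t. e \<in> arcs G \<Longrightarrow> 0 < t \<Longrightarrow> ereal t < len G e \<Longrightarrow> jump G g (Inner e t) \<noteq> 0 \<Longrightarrow> Inner e t \<in> Q"
  shows "(\<Sum>x\<in>Q. jump G g x) = 0"
proof -
  have "Vertex ` verts G \<union> Q = Q" using assms(2) by blast
  then have "(\<Sum>x\<in>Q. jump G g x) = (\<Sum>(e, a, b)\<in>pieces G Q. slope G g (e, a, True) + slope G g (e, b, False))"
    using sum_all_directions[OF assms(1,3), of "slope G g"] unfolding jump_def by simp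
  also have "\<dots> = 0"
  proof (rule sum.neutral, intro ballI)
    fix p assume p: "p \<in> pieces G Q"
    obtain e a b where e: "p = (e, a, b)" by (cases p)
    have "e \<in> arcs G" using p e unfolding pieces_def by simp
    then obtain k where "slope G g (e, a, True) = k" "slope G g (e, b, False) = - k"
      using affine_on_pieces[OF assms(3) p[unfolded e]] assms(4) by metis
    then show "(case p of (e, a, b) \<Rightarrow> slope G g (e, a, True) + slope G g (e, b, False)) = 0"
      using e by simp
  qed
  finally show ?thesis .
qed

end


section \<open>The balanced curve\<close>

lemma directions_Vertex:
  assumes "\<And>e. e \<in> arcs G \<Longrightarrow> 0 < len G e"
  shows "directions G (Vertex v) = (\<lambda>e. (e, 0, True)) ` {e \<in> arcs G. tail G e = v} \<union>
    (\<lambda>e. (e, len G e, False)) ` {e \<in> arcs G. head G e = v}"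
proof (intro equalityI subsetI)
  fix d assume "d \<in> directions G (Vertex v)"
  then obtain e t s where d: "d = (e, t, s)" "e \<in> arcs G" "pt G e t = Vertex v"
    "if s then t < len G e else 0 < t" unfolding directions_def by auto
  from d(3,4) have "(t = 0 \<and> s \<and> tail G e = v) \<or> (t = len G e \<and> \<not> s \<and> head G e = v)"
    by (auto simp: pt_def split: if_splits)
  then show "d \<in> (\<lambda>e. (e, 0, True)) ` {e \<in> arcs G. tail G e = v} \<union>
    (\<lambda>e. (e, len G e, False)) ` {e \<in> arcs G. head G e = v}"
    using d(1,2) by (cases s) auto
next
  fix d assume "d \<in> (\<lambda>e. (e, 0, True)) ` {e \<in> arcs G. tail G e = v} \<union>
    (\<lambda>e. (e, len G e, False)) ` {e \<in> arcs G. head G e = v}"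
  then consider e where "e \<in> arcs G" "tail G e = v" "d = (e, 0, True)" |
    e where "e \<in> arcs G" "head G e = v" "d = (e, len G e, False)" by blast
  then show "d \<in> directions G (Vertex v)"
  proof cases
    case (1 e)
    then show ?thesis using assms[of e] unfolding directions_def by (simp add: pt_def less_imp_le)
  next
    case (2 e)
    then show ?thesis using assms[of e] unfolding directions_def by (auto simp: pt_def less_imp_le)
  qed
qed

lemma (in finite_metric_graph) directions_infinite_head:
  assumes "e \<in> arcs G" "len G e = \<infinity>"
  shows "directions G (Vertex (head G e)) = {(e, \<infinity>, False)}"
proof -
  have tails: "{e' \<in> arcs G. tail G e' = head G e} = {}" using infinite_tail[OF assms] by blast
  have heads: "{e' \<in> arcs G. head G e' = head G e} = {e}" using infinite_head[OF assms] assms(1) by blast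
  have "directions G (Vertex (head G e)) = (\<lambda>e. (e, 0, True)) ` {e' \<in> arcs G. tail G e' = head G e} \<union>
    (\<lambda>e. (e, len G e, False)) ` {e' \<in> arcs G. head G e' = head G e}"
    by (rule directions_Vertex) (rule len_pos)
  then show ?thesis unfolding tails heads using assms(2) by simp
qed

lemma image_case_prod:
  "(\<lambda>(x, y, z). F x y z) ` {(x, y, z). Q x y z} = {F x y z | x y z. Q x y z}"
  by (auto simp: image_def)

lemma Piece_in_image [simp]:
  "Piece e a b \<in> (\<lambda>(e, a, b). Piece e a b) ` S \<longleftrightarrow> (e, a, b) \<in> S"
  "Leaf x \<notin> (\<lambda>(e, a, b). Piece e a b) ` S"
  by (force, auto)

lemma integral_sum: "(\<And>a. a \<in> A \<Longrightarrow> F a \<in> int_vectors) \<Longrightarrow> (\<Sum>a\<in>A. F a) \<in> int_vectors"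
  by (induction A rule: infinite_finite_induct) (auto intro: integral_add)

locale tropical_map_graph = piecewise_linear G h int_vectors
  for G :: "('v, 'e) metric_graph" and h :: "('v, 'e) point \<Rightarrow> 'n::finite tp"
begin

definition leaf_pts :: "('v, 'e) point set" where
  "leaf_pts = {x \<in> finite_points G. imbalance G h x \<noteq> 0}"

text \<open>Together with \<open>leaf_slope\<close> this supplies the constants \<open>c\<close> and
  \<open>w\<close> of \<open>linear_curve\<close>, for pieces as well as for leaves. A piece is
  parametrized from 0, so its base is the value at its own left end.\<close>

definition leaf_base :: "('v, 'e) attached_arc \<Rightarrow> 'n tp" where
  "leaf_base \<alpha> = (case \<alpha> of Piece e a b \<Rightarrow> h (pt G e a) | Leaf x \<Rightarrow> h x)"

definition leaf_slope :: "('v, 'e) attached_arc \<Rightarrow> 'n tp" where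
  "leaf_slope \<alpha> = (case \<alpha> of Piece e a b \<Rightarrow> slope G h (e, a, True) | Leaf x \<Rightarrow> - imbalance G h x)"

abbreviation "B \<equiv> balanced_curve G h"

lemma leaf_pts_subset: "leaf_pts \<subseteq> points G"
  unfolding leaf_pts_def finite_points_def by blast

lemma finite_leaf_pts: "finite leaf_pts"
proof -
  have "leaf_pts \<subseteq> Vertex ` verts G \<union>
    {x. jump G h x \<noteq> 0 \<and> (\<exists>e\<in>arcs G. \<exists>t. x = Inner e t \<and> 0 < t \<and> ereal t < len G e)}"
  proof
    fix x assume "x \<in> leaf_pts"
    then have x: "x \<in> finite_points G" "jump G h x \<noteq> 0"
      unfolding leaf_pts_def imbalance_eq_jump by auto
    from x(1) show "x \<in> Vertex ` verts G \<union>
      {x. jump G h x \<noteq> 0 \<and> (\<exists>e\<in>arcs G. \<exists>t. x = Inner e t \<and> 0 < t \<and> ereal t < len G e)}"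
      by (cases rule: finite_pointsE) (use x(2) in blast)+
  qed
  then show ?thesis using finite_jumps finite_verts by (meson finite_UnI finite_imageI finite_subset)
qed

lemma balanced_curve_eq: "B = attach_leaves G leaf_pts"
  unfolding balanced_curve_def leaf_pts_def ..

lemma B_simps:
  "verts B = Old ` (Vertex ` verts G \<union> leaf_pts) \<union> Leaf_End ` leaf_pts"
  "arcs B = (\<lambda>(e, a, b). Piece e a b) ` pieces G leaf_pts \<union> Leaf ` leaf_pts"
  "tail B (Piece e a b) = Old (pt G e a)" "tail B (Leaf x) = Old x"
  "head B (Piece e a b) = Old (pt G e b)" "head B (Leaf x) = Leaf_End x"
  "len B (Piece e a b) = b - a" "len B (Leaf x) = \<infinity>"
  unfolding balanced_curve_eq attach_leaves_def pieces_def image_case_prod by simp_all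

lemma arcs_B_cases:
  assumes "\<alpha> \<in> arcs B"
  obtains e a b where "\<alpha> = Piece e a b" "(e, a, b) \<in> pieces G leaf_pts" |
    x where "\<alpha> = Leaf x" "x \<in> leaf_pts"
  using assms unfolding B_simps by auto

lemma pieceD:
  assumes "(e, a, b) \<in> pieces G leaf_pts"
  shows "e \<in> arcs G" "0 \<le> a" "a < b" "b \<le> len G e" "a < len G e" "a \<noteq> \<infinity>"
    "pt G e a \<in> Vertex ` verts G \<union> leaf_pts" "pt G e b \<in> Vertex ` verts G \<union> leaf_pts"
    "(e, a, True) \<in> directions G (pt G e a)" "b = \<infinity> \<longleftrightarrow> len G e = \<infinity> \<and> b = len G e"
proof -
  have p: "e \<in> arcs G" "a \<in> cuts G leaf_pts e" "b \<in> cuts G leaf_pts e" "a < b"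
    using assms unfolding pieces_def by auto
  note bd = cuts_bounds[OF p(2) leaf_pts_subset p(1)] cuts_bounds[OF p(3) leaf_pts_subset p(1)]
  show "e \<in> arcs G" "0 \<le> a" "a < b" "b \<le> len G e" using p bd by auto
  show "a < len G e" using p(4) bd(5) by (rule order.strict_trans2)
  then show "(e, a, True) \<in> directions G (pt G e a)" using p(1) bd unfolding directions_def by auto
  show "a \<noteq> \<infinity>" using p(4) by auto
  show "b = \<infinity> \<longleftrightarrow> len G e = \<infinity> \<and> b = len G e" using bd(5) by auto
  show "pt G e a \<in> Vertex ` verts G \<union> leaf_pts" "pt G e b \<in> Vertex ` verts G \<union> leaf_pts"
    using bd by auto
qed

lemma leaf_pts_jumps:
  assumes "e \<in> arcs G" "0 < t" "ereal t < len G e" "jump G h (Inner e t) \<noteq> 0"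
  shows "Inner e t \<in> leaf_pts"
  using pt_finite[OF assms(1), of t] assms unfolding leaf_pts_def imbalance_eq_jump
  by (auto simp: pt_interior less_imp_le)

lemma piece_linear:
  assumes "(e, a, b) \<in> pieces G leaf_pts"
  obtains c r where "a = ereal r" "0 \<le> r"
    "\<And>t. r \<le> t \<Longrightarrow> ereal t \<le> b \<Longrightarrow> h (pt G e (ereal t)) = c + t *\<^sub>R slope G h (e, a, True)"
    "slope G h (e, b, False) = - slope G h (e, a, True)"
  using affine_on_pieces[OF leaf_pts_subset assms] leaf_pts_jumps[OF pieceD(1)[OF assms]] by metis

text \<open>The parameter of a piece is that of \<open>e\<close> shifted by \<open>r\<close>. At the
  two ends \<open>pt\<close> yields vertices of the subdivided curve instead of inner points, and
  \<open>balanced_map\<close> takes the matching values there.\<close>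

lemma pt_Piece:
  assumes "(e, a, b) \<in> pieces G leaf_pts" "a = ereal r" "0 \<le> t" "ereal t \<le> b - a"
  shows "balanced_map G h (pt B (Piece e a b) (ereal t)) = h (pt G e (ereal (r + t)))"
proof -
  consider "t = 0" | "t \<noteq> 0" "ereal t = b - a" | "t \<noteq> 0" "ereal t \<noteq> b - a" by blast
  then show ?thesis
  proof cases
    case 1
    then show ?thesis using assms(2) by (simp add: pt_def B_simps zero_ereal_def)
  next
    case 2
    then have "b - a \<noteq> 0" by (metis zero_ereal_def ereal.inject)
    then have "pt B (Piece e a b) (ereal t) = Vertex (Old (pt G e b))"
      using 2 by (simp add: pt_def[of B] B_simps)
    moreover have "b = ereal (r + t)" using 2(2) assms(2) by (cases b) auto
    ultimately show ?thesis by simp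
  next
    case 3
    then show ?thesis using assms(2) by (simp add: pt_def[of B] B_simps)
  qed
qed

lemma B_linear:
  assumes "\<alpha> \<in> arcs B" "0 \<le> t" "ereal t \<le> len B \<alpha>"
  shows "balanced_map G h (pt B \<alpha> (ereal t)) = leaf_base \<alpha> + t *\<^sub>R leaf_slope \<alpha>"
  using assms(1)
proof (cases rule: arcs_B_cases)
  case (1 e a b)
  let ?k = "slope G h (e, a, True)"
  obtain c r where r: "a = ereal r" "0 \<le> r"
    "\<And>t. r \<le> t \<Longrightarrow> ereal t \<le> b \<Longrightarrow> h (pt G e (ereal t)) = c + t *\<^sub>R ?k"
    using piece_linear[OF 1(2)] by metis
  have t: "ereal t \<le> b - a" using assms(3) 1(1) B_simps by simp
  then have "ereal (r + t) \<le> b" using r(1) by (cases b) auto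
  then have "h (pt G e (ereal (r + t))) = c + (r + t) *\<^sub>R ?k" using r assms(2) by simp
  moreover have "h (pt G e a) = c + r *\<^sub>R ?k" using r(3)[of r] pieceD(3)[OF 1(2)] r(1) by simp
  ultimately show ?thesis
    unfolding 1(1) pt_Piece[OF 1(2) r(1) assms(2) t] leaf_base_def leaf_slope_def
    by (simp add: scaleR_add_left add.assoc)
next
  case (2 x)
  then show ?thesis unfolding leaf_base_def leaf_slope_def
    by (cases "t = 0") (auto simp: pt_def B_simps zero_ereal_def)
qed

lemma B_graph: "finite_metric_graph B"
proof
  show "finite (verts B)" unfolding B_simps using finite_verts finite_leaf_pts by simp
  show "finite (arcs B)" unfolding B_simps using finite_pieces[OF finite_leaf_pts] finite_leaf_pts by simp
next
  fix \<alpha> assume \<alpha>: "\<alpha> \<in> arcs B"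
  show "tail B \<alpha> \<in> verts B" "head B \<alpha> \<in> verts B"
    using \<alpha> by (cases rule: arcs_B_cases; use pieceD(7,8) in \<open>force simp: B_simps\<close>)+
  show "0 < len B \<alpha>" using \<alpha>
  proof (cases rule: arcs_B_cases)
    case (1 e a b)
    then show ?thesis using pieceD(2,3,6)[OF 1(2)] by (cases a; cases b) (auto simp: B_simps)
  qed (simp add: B_simps)
next
  fix \<alpha> \<beta> assume \<alpha>: "\<alpha> \<in> arcs B" "len B \<alpha> = \<infinity>" and \<beta>: "\<beta> \<in> arcs B"
  \<comment> \<open>A piece of infinite length is the last piece of an infinite edge, so its head is
    an old point at infinity.\<close>
  have inf: "len G e = \<infinity>" "b = \<infinity>" "head B (Piece e a b) = Old (Vertex (head G e))"
    if p: "(e, a, b) \<in> pieces G leaf_pts" "len B (Piece e a b) = \<infinity>" for e a b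
  proof -
    have "b = \<infinity>" using p pieceD(2,6)[OF p(1)] unfolding B_simps by (cases a; cases b) auto
    then show "b = \<infinity>" "len G e = \<infinity>" "head B (Piece e a b) = Old (Vertex (head G e))"
      using pieceD(10)[OF p(1)] by (auto simp: B_simps pt_def)
  qed
  \<comment> \<open>Leaves are attached at finite points only, so an old point at infinity keeps a
    single edge.\<close>
  have not_leaf: "Vertex (head G e) \<notin> leaf_pts" if "e \<in> arcs G" "len G e = \<infinity>" for e
    using that unfolding leaf_pts_def finite_points_def by blast
  show "tail B \<beta> \<noteq> head B \<alpha>"
    using \<alpha>(1)
  proof (cases rule: arcs_B_cases)
    case (1 e a b)
    note e = pieceD(1)[OF 1(2)] inf[OF 1(2) \<alpha>(2)[unfolded 1(1)]]
    show ?thesis using \<beta>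
    proof (cases rule: arcs_B_cases)
      case p: (1 e' a' b')
      have "pt G e' a' \<noteq> Vertex (head G e)"
        using infinite_tail[OF e(1,2) pieceD(1)[OF p(2)]] pieceD(5)[OF p(2)] by (auto simp: pt_def)
      then show ?thesis using e(4) 1(1) p(1) by (simp add: B_simps)
    next
      case (2 x)
      then show ?thesis using e(4) 1(1) not_leaf[OF e(1,2)] by (auto simp: B_simps)
    qed
  next
    case (2 x)
    from \<beta> show ?thesis by (cases rule: arcs_B_cases) (auto simp: 2 B_simps)
  qed
  show "head B \<beta> \<noteq> head B \<alpha>" if "\<beta> \<noteq> \<alpha>"
    using \<alpha>(1)
  proof (cases rule: arcs_B_cases)
    case (1 e a b)
    note e = pieceD(1)[OF 1(2)] inf[OF 1(2) \<alpha>(2)[unfolded 1(1)]]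
    show ?thesis using \<beta>
    proof (cases rule: arcs_B_cases)
      case p: (1 e' a' b')
      have "pt G e' b' \<noteq> Vertex (head G e)"
      proof
        assume *: "pt G e' b' = Vertex (head G e)"
        have "b' \<noteq> 0" using pieceD(2,3)[OF p(2)] by auto
        then have "b' = len G e'" "head G e' = head G e" using * by (auto simp: pt_def split: if_splits)
        then have "e' = e" "b' = b" using infinite_head[OF e(1,2) pieceD(1)[OF p(2)]] e by auto
        then show False using pieces_unique[of e a b _ a' b'] 1 p \<open>\<beta> \<noteq> \<alpha>\<close> by auto
      qed
      then show ?thesis using e(4) 1(1) p(1) by (simp add: B_simps)
    qed (use 1(1) in \<open>simp add: B_simps\<close>)
  next
    case (2 x)
    from \<beta> show ?thesis by (cases rule: arcs_B_cases) (use that in \<open>auto simp: 2 B_simps\<close>)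
  qed
qed

lemma slope_integral: "d \<in> directions G x \<Longrightarrow> slope G h d \<in> int_vectors"
  by (rule has_slope_direction(2))

lemma leaf_slope_integral:
  assumes "\<alpha> \<in> arcs B"
  shows "leaf_slope \<alpha> \<in> int_vectors"
  using assms
proof (cases rule: arcs_B_cases)
  case (1 e a b)
  then show ?thesis using slope_integral[OF pieceD(9)[OF 1(2)]] unfolding leaf_slope_def by simp
next
  case (2 x)
  then show ?thesis unfolding leaf_slope_def imbalance_def
    by (auto intro!: integral_sum slope_integral)
qed

text \<open>At an old point \<open>x\<close> the pieces that start or end there contribute the
  slopes of \<open>h\<close>, in total the imbalance by \<open>sum_directions\<close>, and the leaf
  contributes its negative. At an inner point of an arc the two slopes are opposite.\<close>

lemma B_balanced:
  assumes y: "y \<in> finite_points B"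
  shows "(\<Sum>d\<in>directions B y. slope B (balanced_map G h) d) = 0"
proof -
  interpret B: finite_metric_graph B by (rule B_graph)
  have slope: "slope B (balanced_map G h) (\<alpha>, t, s) = sgn_dir s *\<^sub>R leaf_slope \<alpha>"
    if "(\<alpha>, t, s) \<in> directions B z" for \<alpha> t s z
    by (rule linear_slope(2)[OF B_linear that]) (use that in \<open>auto simp: directions_def\<close>)
  from y show ?thesis
  proof (cases rule: B.finite_pointsE)
    case (2 \<alpha> t)
    have "(\<alpha>, ereal t, s) \<in> directions B y" for s
      unfolding 2(1) directions_Inner[OF 2(2-4)] by (cases s) auto
    note slope = slope[OF this]
    show ?thesis unfolding 2(1) directions_Inner[OF 2(2-4)] by (simp add: slope)
  next
    case (1 u)
    have "\<exists>x. u = Old x \<and> x \<in> finite_points G \<and> x \<in> Vertex ` verts G \<union> leaf_pts"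
    proof -
      have not_end: "u \<noteq> head B \<alpha>" if "\<alpha> \<in> arcs B" "len B \<alpha> = \<infinity>" for \<alpha>
        using y 1(1) that unfolding finite_points_def by blast
      have "u \<noteq> Leaf_End x" if "x \<in> leaf_pts" for x
        using not_end[of "Leaf x"] that by (auto simp: B_simps)
      then obtain x where x: "u = Old x" "x \<in> Vertex ` verts G \<union> leaf_pts"
        using 1(2) unfolding B_simps by blast
      have "x \<noteq> Vertex (head G e)" if e: "e \<in> arcs G" "len G e = \<infinity>" for e
      proof
        assume "x = Vertex (head G e)"
        obtain a where a: "(e, a, len G e) \<in> pieces G leaf_pts"
          using prev_cut[OF finite_leaf_pts leaf_pts_subset e(1), of "len G e"] len_pos[OF e(1)]
          unfolding cuts_def by auto
        have "head B (Piece e a (len G e)) = u" "len B (Piece e a (len G e)) = \<infinity>"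
          using \<open>x = Vertex (head G e)\<close> x(1) e len_pos[OF e(1)] pieceD(2,6)[OF a]
          by (auto simp: B_simps pt_def)
        then show False using not_end[of "Piece e a (len G e)"] a by (force simp: B_simps)
      qed
      moreover have "x \<in> points G" using x(2) leaf_pts_subset unfolding points_def by blast
      ultimately have "x \<in> finite_points G" unfolding finite_points_def by blast
      then show ?thesis using x by blast
    qed
    then obtain x where x: "u = Old x" "x \<in> finite_points G" "x \<in> Vertex ` verts G \<union> leaf_pts" by blast
    let ?T = "{\<alpha> \<in> arcs B. tail B \<alpha> = u}" and ?H = "{\<alpha> \<in> arcs B. head B \<alpha> = u}"
    let ?P = "pieces G leaf_pts" and ?arc = "\<lambda>(e, a, b). Piece e a b"
    have dirs: "directions B y = (\<lambda>\<alpha>. (\<alpha>, 0, True)) ` ?T \<union> (\<lambda>\<alpha>. (\<alpha>, len B \<alpha>, False)) ` ?H"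
      unfolding 1(1) by (rule directions_Vertex) (rule B.len_pos)
    have "(\<Sum>d\<in>directions B y. slope B (balanced_map G h) d) =
      (\<Sum>d\<in>(\<lambda>\<alpha>. (\<alpha>, 0, True)) ` ?T. slope B (balanced_map G h) d) +
      (\<Sum>d\<in>(\<lambda>\<alpha>. (\<alpha>, len B \<alpha>, False)) ` ?H. slope B (balanced_map G h) d)"
      unfolding dirs using B.finite_arcs by (intro sum.union_disjoint) auto
    also have "(\<Sum>d\<in>(\<lambda>\<alpha>. (\<alpha>, 0, True)) ` ?T. slope B (balanced_map G h) d) = (\<Sum>\<alpha>\<in>?T. leaf_slope \<alpha>)"
    proof (subst sum.reindex)
      show "sum (slope B (balanced_map G h) \<circ> (\<lambda>\<alpha>. (\<alpha>, 0, True))) ?T = (\<Sum>\<alpha>\<in>?T. leaf_slope \<alpha>)"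
      proof (rule sum.cong[OF refl])
        fix \<alpha> assume "\<alpha> \<in> ?T"
        then have "(\<alpha>, 0, True) \<in> directions B y" unfolding dirs by blast
        from slope[OF this] show "(slope B (balanced_map G h) \<circ> (\<lambda>\<alpha>. (\<alpha>, 0, True))) \<alpha> = leaf_slope \<alpha>" by simp
      qed
    qed (auto intro: inj_onI)
    also have "(\<Sum>d\<in>(\<lambda>\<alpha>. (\<alpha>, len B \<alpha>, False)) ` ?H. slope B (balanced_map G h) d) = (\<Sum>\<alpha>\<in>?H. - leaf_slope \<alpha>)"
    proof (subst sum.reindex)
      show "sum (slope B (balanced_map G h) \<circ> (\<lambda>\<alpha>. (\<alpha>, len B \<alpha>, False))) ?H = (\<Sum>\<alpha>\<in>?H. - leaf_slope \<alpha>)"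
      proof (rule sum.cong[OF refl])
        fix \<alpha> assume "\<alpha> \<in> ?H"
        then have "(\<alpha>, len B \<alpha>, False) \<in> directions B y" unfolding dirs by blast
        from slope[OF this] show "(slope B (balanced_map G h) \<circ> (\<lambda>\<alpha>. (\<alpha>, len B \<alpha>, False))) \<alpha> = - leaf_slope \<alpha>" by simp
      qed
    qed (auto intro: inj_onI)
    also have "?T = ?arc ` {(e, a, b) \<in> ?P. pt G e a = x} \<union> Leaf ` (leaf_pts \<inter> {x})"
    proof (rule set_eqI)
      fix \<alpha>
      show "\<alpha> \<in> ?T \<longleftrightarrow> \<alpha> \<in> ?arc ` {(e, a, b) \<in> ?P. pt G e a = x} \<union> Leaf ` (leaf_pts \<inter> {x})"
        unfolding x(1) by (cases \<alpha>) (auto simp: B_simps)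
    qed
    also have "(\<Sum>\<alpha>\<in>?arc ` {(e, a, b) \<in> ?P. pt G e a = x} \<union> Leaf ` (leaf_pts \<inter> {x}). leaf_slope \<alpha>) =
      (\<Sum>\<alpha>\<in>?arc ` {(e, a, b) \<in> ?P. pt G e a = x}. leaf_slope \<alpha>) + (\<Sum>\<alpha>\<in>Leaf ` (leaf_pts \<inter> {x}). leaf_slope \<alpha>)"
      using finite_pieces[OF finite_leaf_pts]
      by (intro sum.union_disjoint) (auto intro: finite_subset[of _ ?P])
    \<comment> \<open>If the finite point \<open>x\<close> carries no leaf, its imbalance is 0, so
      both cases have the same formula.\<close>
    also have "(\<Sum>\<alpha>\<in>Leaf ` (leaf_pts \<inter> {x}). leaf_slope \<alpha>) = - imbalance G h x"
      using x(2) by (cases "x \<in> leaf_pts") (auto simp: leaf_slope_def leaf_pts_def)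
    also have "(\<Sum>\<alpha>\<in>?arc ` {(e, a, b) \<in> ?P. pt G e a = x}. leaf_slope \<alpha>) =
      (\<Sum>(e, a, b)\<in>{(e, a, b) \<in> ?P. pt G e a = x}. slope G h (e, a, True))"
      by (subst sum.reindex) (auto intro!: inj_onI sum.cong simp: leaf_slope_def)
    also have "?H = ?arc ` {(e, a, b) \<in> ?P. pt G e b = x}"
    proof (rule set_eqI)
      fix \<alpha>
      show "\<alpha> \<in> ?H \<longleftrightarrow> \<alpha> \<in> ?arc ` {(e, a, b) \<in> ?P. pt G e b = x}"
        unfolding x(1) by (cases \<alpha>) (auto simp: B_simps)
    qed
    also have "(\<Sum>\<alpha>\<in>?arc ` {(e, a, b) \<in> ?P. pt G e b = x}. - leaf_slope \<alpha>) =
      (\<Sum>(e, a, b)\<in>{(e, a, b) \<in> ?P. pt G e b = x}. slope G h (e, b, False))"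
    proof (subst sum.reindex)
      show "sum ((\<lambda>\<alpha>. - leaf_slope \<alpha>) \<circ> ?arc) {(e, a, b) \<in> ?P. pt G e b = x} =
        (\<Sum>(e, a, b)\<in>{(e, a, b) \<in> ?P. pt G e b = x}. slope G h (e, b, False))"
      proof (rule sum.cong[OF refl])
        fix p assume "p \<in> {(e, a, b) \<in> ?P. pt G e b = x}"
        then obtain e a b where p: "p = (e, a, b)" "(e, a, b) \<in> ?P" by auto
        have "slope G h (e, b, False) = - slope G h (e, a, True)" using piece_linear[OF p(2)] by metis
        then show "((\<lambda>\<alpha>. - leaf_slope \<alpha>) \<circ> ?arc) p = (case p of (e, a, b) \<Rightarrow> slope G h (e, b, False))"
          unfolding p(1) leaf_slope_def by simp
      qed
    qed (auto intro: inj_onI)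
    finally show ?thesis
      using sum_directions[OF finite_leaf_pts leaf_pts_subset x(3), of "slope G h"]
      unfolding imbalance_def by (simp add: algebra_simps)
  qed
qed

theorem linear_balanced_curve: "linear_curve B (balanced_map G h) leaf_base leaf_slope"
proof -
  interpret B: finite_metric_graph B by (rule B_graph)
  show ?thesis
    by unfold_locales (fact B_linear leaf_slope_integral B_balanced)+
qed

text \<open>An infinite arc is a leaf or the last piece of an infinite edge; it is matched with the
  base point of the leaf or with the old point at infinity. At the latter the only direction points
  inwards, so the outward slope is minus the jump, as on a leaf.\<close>

theorem sum_infinite_arcs:
  "(\<Sum>\<alpha> | \<alpha> \<in> arcs B \<and> len B \<alpha> = \<infinity>. nonpos_rep (leaf_slope \<alpha>)) =
   (\<Sum>x\<in>leaf_pts \<union> (points G - finite_points G). nonpos_rep (- jump G h x))"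
proof -
  let ?I = "{\<alpha> \<in> arcs B. len B \<alpha> = \<infinity>}"
  define \<pi> where "\<pi> \<alpha> = (case \<alpha> of Piece e a b \<Rightarrow> Vertex (head G e) | Leaf x \<Rightarrow> x)"
    for \<alpha> :: "('v, 'e) attached_arc"
  have piece_inf: "len G e = \<infinity>" "b = \<infinity>"
    if "(e, a, b) \<in> pieces G leaf_pts" "len B (Piece e a b) = \<infinity>" for e a b
  proof -
    show "b = \<infinity>" using that pieceD(2,6)[OF that(1)] unfolding B_simps by (cases a; cases b) auto
    then show "len G e = \<infinity>" using pieceD(10)[OF that(1)] by blast
  qed
  have not_finite: "Vertex (head G e) \<in> points G - finite_points G" if "e \<in> arcs G" "len G e = \<infinity>" for e
    using that head_in unfolding finite_points_def points_def by blast
  have slope: "leaf_slope \<alpha> = - jump G h (\<pi> \<alpha>)" if "\<alpha> \<in> ?I" for \<alpha>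
  proof -
    have "\<alpha> \<in> arcs B" using that by blast
    then show ?thesis
    proof (cases rule: arcs_B_cases)
      case (1 e a b)
      have inf: "len G e = \<infinity>" "b = \<infinity>" using piece_inf[OF 1(2)] that 1(1) by auto
      have "jump G h (Vertex (head G e)) = slope G h (e, \<infinity>, False)"
        unfolding jump_def directions_infinite_head[OF pieceD(1)[OF 1(2)] inf(1)] by simp
      also have "\<dots> = - slope G h (e, a, True)"
        using piece_linear[OF 1(2)] unfolding inf(2) by metis
      finally show ?thesis unfolding 1(1) leaf_slope_def \<pi>_def by simp
    next
      case (2 x)
      then show ?thesis unfolding leaf_slope_def \<pi>_def imbalance_eq_jump by simp
    qed
  qed
  have inj: "inj_on \<pi> ?I"
  proof (rule inj_onI)
    fix \<alpha> \<beta> assume *: "\<alpha> \<in> ?I" "\<beta> \<in> ?I" "\<pi> \<alpha> = \<pi> \<beta>"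
    have mixed: False if "(e, a, b) \<in> pieces G leaf_pts" "len B (Piece e a b) = \<infinity>"
      "x \<in> leaf_pts" "x = Vertex (head G e)" for e a b x
      using not_finite[OF pieceD(1)[OF that(1)] piece_inf(1)[OF that(1,2)]] that(3,4)
      unfolding leaf_pts_def by blast
    have "\<alpha> \<in> arcs B" "\<beta> \<in> arcs B" using * by auto
    from this(1) show "\<alpha> = \<beta>"
    proof (cases rule: arcs_B_cases)
      case p: (1 e a b)
      note e = pieceD(1)[OF p(2)] and inf = piece_inf[OF p(2)]
      from \<open>\<beta> \<in> arcs B\<close> show ?thesis
      proof (cases rule: arcs_B_cases)
        case q: (1 e' a' b')
        have "len G e = \<infinity>" "b' = b" using inf piece_inf[OF q(2)] *(1,2) p(1) q(1) by auto
        moreover have "head G e' = head G e" using *(3) p(1) q(1) unfolding \<pi>_def by simp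
        ultimately have "e' = e" using infinite_head[OF e _ pieceD(1)[OF q(2)]] by blast
        then show ?thesis using pieces_unique[of e a b _ a' b'] p q \<open>b' = b\<close> by auto
      next
        case (2 x)
        then show ?thesis using mixed[OF p(2)] *(1,3) p(1) unfolding \<pi>_def by simp
      qed
    next
      case p: (2 x)
      from \<open>\<beta> \<in> arcs B\<close> show ?thesis
      proof (cases rule: arcs_B_cases)
        case (1 e' a' b')
        then show ?thesis using mixed[OF 1(2)] *(2,3) p unfolding \<pi>_def by simp
      next
        case (2 x')
        then show ?thesis using *(3) p unfolding \<pi>_def by simp
      qed
    qed
  qed
  have img: "\<pi> ` ?I = leaf_pts \<union> (points G - finite_points G)"
  proof (intro equalityI subsetI)
    fix x assume "x \<in> \<pi> ` ?I"
    then obtain \<alpha> where \<alpha>: "\<alpha> \<in> arcs B" "len B \<alpha> = \<infinity>" "x = \<pi> \<alpha>" by blast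
    from \<alpha>(1) show "x \<in> leaf_pts \<union> (points G - finite_points G)"
    proof (cases rule: arcs_B_cases)
      case (1 e a b)
      then show ?thesis using not_finite[OF pieceD(1)[OF 1(2)]] piece_inf(1)[OF 1(2)] \<alpha> unfolding \<pi>_def by simp
    qed (use \<alpha>(3) in \<open>simp add: \<pi>_def\<close>)
  next
    fix x assume "x \<in> leaf_pts \<union> (points G - finite_points G)"
    then consider "x \<in> leaf_pts" | e where "e \<in> arcs G" "len G e = \<infinity>" "x = Vertex (head G e)"
      unfolding finite_points_def by blast
    then show "x \<in> \<pi> ` ?I"
    proof cases
      case 1
      then show ?thesis by (intro image_eqI[of _ _ "Leaf x"]) (auto simp: \<pi>_def B_simps)
    next
      case (2 e)
      obtain a where a: "(e, a, len G e) \<in> pieces G leaf_pts"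
        using prev_cut[OF finite_leaf_pts leaf_pts_subset 2(1), of "len G e"] len_pos[OF 2(1)]
        unfolding cuts_def by auto
      have "len B (Piece e a (len G e)) = \<infinity>" using 2(2) pieceD(2,6)[OF a] by (auto simp: B_simps)
      moreover have "Piece e a (len G e) \<in> arcs B" using a by (force simp: B_simps)
      ultimately show ?thesis using 2(3) by (intro image_eqI[of _ _ "Piece e a (len G e)"]) (auto simp: \<pi>_def)
    qed
  qed
  have "(\<Sum>\<alpha>\<in>?I. nonpos_rep (leaf_slope \<alpha>)) = (\<Sum>\<alpha>\<in>?I. nonpos_rep (- jump G h (\<pi> \<alpha>)))"
    by (rule sum.cong[OF refl]) (simp only: slope)
  also have "\<dots> = (\<Sum>x\<in>\<pi> ` ?I. nonpos_rep (- jump G h x))"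
    by (simp add: sum.reindex[OF inj])
  finally show ?thesis unfolding img .
qed

end

text \<open>The bijection \<open>f\<close> numbers \<open>F\<close> by the coordinates of the
  target. Existence of a weighted complex is asserted alongside the degree, so that the second
  conjunct is not vacuous.\<close>

theorem theorem34:
  fixes G :: "('v, 'e) metric_graph"
    and D :: "('v, 'e) point \<Rightarrow>\<^sub>0 int"
    and F :: "(('v, 'e) point \<Rightarrow> ereal) set"
    and f :: "'n::finite \<Rightarrow> ('v, 'e) point \<Rightarrow> ereal"
  assumes "tropical_curve G"
    and "divisor_on G D"
    and "R G D \<noteq> {}"
    and "\<not> (\<forall>g\<in>R G D. \<exists>c. \<forall>x\<in>points G. g x = c)"
    and "F \<subseteq> R G D"
    and "bij_betw f UNIV F"
    and "no_base_points G D F"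
  defines "\<phi> \<equiv> tropical_map f"
  shows "(\<exists>K m. image_tropical_curve (balanced_curve G \<phi>) (balanced_map G \<phi>) K m) \<and>
         (\<forall>K m. image_tropical_curve (balanced_curve G \<phi>) (balanced_map G \<phi>) K m \<longrightarrow>
                has_degree K m (divisor_degree D))"
proof -
  interpret finite_metric_graph G by (rule tropical_curve_finite_metric_graph[OF assms(1)])
  have F: "F = range f" using assms(6) unfolding bij_betw_def by simp
  have R: "f i \<in> R G D" for i using assms(5) F by blast
  have rational: "rational_function G (f i)" for i using R[of i] unfolding R_def by blast
  have effective: "0 \<le> real_of_int (Poly_Mapping.lookup D x) + ord_at G (f i) x" if "x \<in> points G" for x i
    using R[of i] that unfolding R_def by blast
  have base: "\<exists>i. real_of_int (Poly_Mapping.lookup D x) + ord_at G (f i) x = 0" if "x \<in> points G" for x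
    using assms(7) that unfolding no_base_points_def F by blast
  interpret \<phi>: piecewise_linear G \<phi> int_vectors
    unfolding \<phi>_def by (rule piecewise_linear_tropical_map[OF rational])
  interpret \<phi>: tropical_map_graph G \<phi> ..
  interpret B: linear_curve "balanced_curve G \<phi>" "balanced_map G \<phi>" \<phi>.leaf_base \<phi>.leaf_slope
    by (rule \<phi>.linear_balanced_curve)
  have jump: "jump G \<phi> x = tp (\<chi> i. ord_at G (f i) x)" for x
    unfolding \<phi>_def by (rule jump_tropical_map[OF rational])
  have ord_int: "ord_at G (f i) x \<in> \<int>" for i x
    unfolding ord_at_def
    by (intro Ints_sum piecewise_linear.has_slope_direction(2)[OF piecewise_linear_rational[OF rational]])
  have nonpos: "real_of_int (nonpos_rep (- jump G \<phi> x) $ i) =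
      - (real_of_int (Poly_Mapping.lookup D x) + ord_at G (f i) x)" if x: "x \<in> points G" for x i
  proof -
    \<comment> \<open>The term \<open>D(x)\<close> is the same in all coordinates and vanishes in
      the quotient, so \<open>z\<close> represents minus the jump.\<close>
    define z :: "int ^ 'n" where "z = (\<chi> i. - (Poly_Mapping.lookup D x + \<lfloor>ord_at G (f i) x\<rfloor>))"
    have z: "real_of_int (z $ i) = - (real_of_int (Poly_Mapping.lookup D x) + ord_at G (f i) x)" for i
      unfolding z_def using ord_int[of i x] by simp
    obtain j where "real_of_int (Poly_Mapping.lookup D x) + ord_at G (f j) x = 0" using base[OF x] by blast
    then have "z $ j = 0" using z[of j] by linarith
    moreover have "z $ i \<le> 0" for i using z[of i] effective[OF x, of i] by linarith
    moreover have "tp_of_int z = - jump G \<phi> x"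
      unfolding jump tp_uminus tp_of_int_def tp_eq_iff
      by (intro exI[of _ "- real_of_int (Poly_Mapping.lookup D x)"]) (simp add: z)
    ultimately have "nonpos_rep (- jump G \<phi> x) = z" by (intro nonpos_rep_eqI) auto
    then show ?thesis using z by simp
  qed
  define J where "J i = {x. ord_at G (f i) x \<noteq> 0 \<and> (\<exists>e\<in>arcs G. \<exists>t. x = Inner e t \<and> 0 < t \<and> ereal t < len G e)}" for i
  have J: "finite (J i)" "J i \<subseteq> points G" for i
    using piecewise_linear.finite_jumps[OF piecewise_linear_rational[OF rational, of i]]
    unfolding J_def ord_at_eq_jump points_def by auto
  \<comment> \<open>One finite set for all sums: it contains the points where some
    \<open>f i\<close> has nonzero order, the support of \<open>D\<close> and the points that carry
    unbounded ends. Each sum can be extended to \<open>Q\<close> by zeros, and the vertices make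
    \<open>sum_jumps\<close> applicable.\<close>
  define Q where "Q = Vertex ` verts G \<union> \<phi>.leaf_pts \<union> Poly_Mapping.keys D \<union> (\<Union>i. J i)"
  have "(\<Union>i. J i) \<subseteq> points G" "Vertex ` verts G \<subseteq> points G"
    using J(2) unfolding points_def by blast+
  then have Q: "finite Q" "Vertex ` verts G \<subseteq> Q" "Q \<subseteq> points G" "Poly_Mapping.keys D \<subseteq> Q"
    using finite_verts \<phi>.finite_leaf_pts J(1) \<phi>.leaf_pts_subset assms(2)
    unfolding Q_def divisor_on_def by (simp_all add: le_supI1 le_supI2)
  have ends_Q: "\<phi>.leaf_pts \<union> (points G - finite_points G) \<subseteq> Q"
    unfolding Q_def finite_points_def using head_in by auto
  have sum_ord: "(\<Sum>x\<in>Q. ord_at G (f i) x) = 0" for i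
    unfolding ord_at_eq_jump
    by (rule piecewise_linear.sum_jumps[OF piecewise_linear_rational[OF rational] Q(1-3)])
      (auto simp: Q_def J_def ord_at_eq_jump)
  have total: "(\<Sum>\<alpha> | \<alpha> \<in> arcs (balanced_curve G \<phi>) \<and> len (balanced_curve G \<phi>) \<alpha> = \<infinity>. nonpos_rep (\<phi>.leaf_slope \<alpha>)) =
    vec (- divisor_degree D)"
  proof -
    have "(\<Sum>x\<in>\<phi>.leaf_pts \<union> (points G - finite_points G). nonpos_rep (- jump G \<phi> x)) =
      (\<Sum>x\<in>Q. nonpos_rep (- jump G \<phi> x))"
    proof (rule sum.mono_neutral_left[OF Q(1) ends_Q], intro ballI)
      fix x assume "x \<in> Q - (\<phi>.leaf_pts \<union> (points G - finite_points G))"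
      then have "jump G \<phi> x = 0" using Q(3) unfolding \<phi>.leaf_pts_def imbalance_eq_jump by blast
      then show "nonpos_rep (- jump G \<phi> x) = 0" by (simp add: nonpos_rep_0)
    qed
    moreover have "(\<Sum>x\<in>Q. nonpos_rep (- jump G \<phi> x)) $ i = - divisor_degree D" for i
    proof -
      have "real_of_int ((\<Sum>x\<in>Q. nonpos_rep (- jump G \<phi> x)) $ i) =
        (\<Sum>x\<in>Q. - (real_of_int (Poly_Mapping.lookup D x) + ord_at G (f i) x))"
        unfolding sum_component of_int_sum by (rule sum.cong[OF refl]) (use nonpos Q(3) in blast)
      also have "\<dots> = - (\<Sum>x\<in>Q. real_of_int (Poly_Mapping.lookup D x)) - (\<Sum>x\<in>Q. ord_at G (f i) x)"
        by (simp add: sum.distrib sum_negf sum_subtractf)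
      also have "(\<Sum>x\<in>Q. real_of_int (Poly_Mapping.lookup D x)) = real_of_int (divisor_degree D)"
        unfolding divisor_degree_def of_int_sum
        by (rule sum.mono_neutral_right[OF Q(1,4)]) (simp add: in_keys_iff)
      finally have "real_of_int ((\<Sum>x\<in>Q. nonpos_rep (- jump G \<phi> x)) $ i) = real_of_int (- divisor_degree D)"
        using sum_ord by simp
      then show ?thesis using of_int_eq_iff by blast
    qed
    ultimately show ?thesis unfolding \<phi>.sum_infinite_arcs by (simp add: vec_eq_iff)
  qed
  show ?thesis
  proof (intro conjI allI impI)
    show "\<exists>K m. image_tropical_curve (balanced_curve G \<phi>) (balanced_map G \<phi>) K m"
      using B.image_tropical_curve_cells by blast
    show "has_degree K m (divisor_degree D)"
      if "image_tropical_curve (balanced_curve G \<phi>) (balanced_map G \<phi>) K m" for K m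
      unfolding has_degree_def B.sum_rays[OF that] by (rule total)
  qed
qed

end
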